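(* Let $f:\mathbb{R}^{n}\to(-\infty,+\infty]$ and $g:\mathbb{R}^{m}\to(-\infty,+\infty]$ be proper and closed (lower semicontinuous), possibly nonconvex, and let $H:\mathbb{R}^n\times\mathbb{R}^m\to\mathbb{R}$ be differentiable and satisfy, for some constants $M,N,L>0$ and all arguments, $$\|\nabla_yH(y^1,z)-\nabla_yH(y^2,z)\|\le M\|y^1-y^2\|,\quad \|\nabla_zH(y,z^1)-\nabla_zH(y,z^2)\|\le N\|z^1-z^2\|,$$ $$\|\nabla_yH(x^1)-\nabla_yH(x^2)\|\le L\|x^1-x^2\|,$$ where $x=(y,z)$. Let $\Phi(y,z)=f(y)+H(y,z)+g(z)$. Suppose $\Phi$ is coercive, $f$, $g$ and $H$ are all semi-algebraic, and the stepsizes $\gamma,\lambda>0$ satisfy $$\min\Big\{\frac1\gamma-M,\ \frac1\lambda-N\Big\}>0.$$ Let $x^k=(y^k,z^k)$, $k\ge 0$, be generated by $$y^{k+1}\in\mathbf{prox}_{\gamma f}\big(y^k-\gamma\nabla_yH(y^k,z^k)+\alpha^k\big),\qquad z^{k+1}\in\mathbf{prox}_{\lambda g}\big(z^k-\lambda\nabla_zH(y^{k+1},z^k)+\beta^k\big),$$ where the noise vectors satisfy $\|\alpha^k\|+\|\beta^k\|=\mathcal{O}(1/k^{p})$ for some real $p>1$. Then $$\sum_{k=0}^{+\infty}\|x^{k+1}-x^k\|<+\infty,$$ and $(x^k)_{k\ge0}$ converges to a critical point $x^*$ of $\Phi$.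
   Context: For a closed, possibly nonconvex function $J$, $\mathbf{prox}_J(x)=\arg\min_y\{J(y)+\frac{\|y-x\|^2}{2}\}$ is a set-valued map; the iterates are any elements of the sets. For a proper lower semicontinuous $J$, the Fréchet subdifferential $\hat\partial J(x)$ at $x\in\mathrm{dom}(J)$ is the set of $u$ with $\liminf_{y\to x,\,y\ne x}\frac{J(y)-J(x)-\langle u,y-x\rangle}{\|y-x\|}\ge 0$ (empty off $\mathrm{dom}(J)$); the limiting subdifferential is $\partial J(x)=\{u:\exists\, x^k\to x,\ J(x^k)\to J(x),\ u^k\in\hat\partial J(x^k),\ u^k\to u\}$. A critical point of $J$ is a point $x$ with $0\in\partial J(x)$. A set in $\mathbb{R}^n$ is semi-algebraic if it is a finite union of finite intersections of sets $\{p(u)=0,\ q(u)<0\}$ with $p,q$ real polynomials; a function is semi-algebraic if its graph is. Coercive means $\Phi(x)\to+\infty$ as $\|x\|\to\infty$. *)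

theory Defs
  imports "HOL-Analysis.Analysis"
begin

definition proper_fun :: "('a \<Rightarrow> ereal) \<Rightarrow> bool" where
  "proper_fun J \<longleftrightarrow> (\<forall>x. J x \<noteq> -\<infinity>) \<and> (\<exists>x. J x < \<infinity>)"

definition lsc_fun :: "('a::topological_space \<Rightarrow> ereal) \<Rightarrow> bool" where
  "lsc_fun J \<longleftrightarrow> (\<forall>x. J x \<le> Liminf (at x) J)"

definition coercive :: "('a::real_normed_vector \<Rightarrow> ereal) \<Rightarrow> bool" where
  "coercive J \<longleftrightarrow> (J \<longlongrightarrow> \<infinity>) at_infinity"

definition prox :: "('a::real_normed_vector \<Rightarrow> ereal) \<Rightarrow> 'a \<Rightarrow> 'a set" where
  "prox J x = {y. is_arg_min (\<lambda>y. J y + ereal ((norm (y - x))\<^sup>2 / 2)) (\<lambda>_. True) y}"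

definition gradient :: "('a::real_inner \<Rightarrow> real) \<Rightarrow> 'a \<Rightarrow> 'a" where
  "gradient F x = (THE D. GDERIV F x :> D)"

definition grad_fst :: "('a::real_inner \<times> 'b \<Rightarrow> real) \<Rightarrow> 'a \<times> 'b \<Rightarrow> 'a" where
  "grad_fst F x = gradient (\<lambda>y. F (y, snd x)) (fst x)"

definition grad_snd :: "('a \<times> 'b::real_inner \<Rightarrow> real) \<Rightarrow> 'a \<times> 'b \<Rightarrow> 'b" where
  "grad_snd F x = gradient (\<lambda>z. F (fst x, z)) (snd x)"

text \<open>The subdifferentials below are meant for functions that never take the value \<open>-\<infinity>\<close>,
  so that \<open>J x < \<infinity>\<close> makes \<open>J x\<close> finite and the difference quotient is well defined in
  \<^typ>\<open>ereal\<close>. The filter \<open>at x\<close> excludes the point \<open>x\<close> itself.\<close>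

definition frechet_subdiff :: "('a::real_inner \<Rightarrow> ereal) \<Rightarrow> 'a \<Rightarrow> 'a set" where
  "frechet_subdiff J x =
     {u. J x < \<infinity> \<and>
         0 \<le> Liminf (at x) (\<lambda>y. (J y - J x - ereal (u \<bullet> (y - x))) / ereal (norm (y - x)))}"

definition limiting_subdiff :: "('a::real_inner \<Rightarrow> ereal) \<Rightarrow> 'a \<Rightarrow> 'a set" where
  "limiting_subdiff J x =
     {u. \<exists>X U. X \<longlonglongrightarrow> x \<and> (\<lambda>k. J (X k)) \<longlonglongrightarrow> J x \<and>
           (\<forall>k::nat. U k \<in> frechet_subdiff J (X k)) \<and> U \<longlonglongrightarrow> u}"

definition critical_point :: "('a::real_inner \<Rightarrow> ereal) \<Rightarrow> 'a \<Rightarrow> bool" where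
  "critical_point J x \<longleftrightarrow> 0 \<in> limiting_subdiff J x"

text \<open>On a Euclidean space, \<^const>\<open>real_polynomial_function\<close> describes exactly the real
  polynomials in the coordinates. A member \<open>C\<close> of the finite family \<open>F\<close> is a finite set of
  pairs \<open>(p, q)\<close>, standing for the intersection of the sets \<open>{u. p u = 0 \<and> q u < 0}\<close>.\<close>

definition semialgebraic :: "'a::euclidean_space set \<Rightarrow> bool" where
  "semialgebraic S \<longleftrightarrow>
     (\<exists>F. finite F \<and>
          (\<forall>C\<in>F. finite C \<and>
             (\<forall>(p, q)\<in>C. real_polynomial_function p \<and> real_polynomial_function q)) \<and>
          S = (\<Union>C\<in>F. \<Inter>(p, q)\<in>C. {u. p u = 0 \<and> q u < 0}))"

text \<open>The graph of an extended-real-valued function is a subset of the product of the space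
  with the (finite) reals: points where the function is infinite contribute nothing.\<close>

definition semialgebraic_fun :: "('a::euclidean_space \<Rightarrow> ereal) \<Rightarrow> bool" where
  "semialgebraic_fun J \<longleftrightarrow> semialgebraic {(x, r::real). J x = ereal r}"

end

theory Submission
  imports Defs
begin

text \<open>
  Every prox step compares its result with all competitors. The vector formed from the optimality
  conditions of the two prox steps is therefore, up to a quadratic error with a fixed constant, a
  global subgradient \<open>U\<close> of \<open>\<Phi>\<close> at the new iterate (\<open>inexact_step\<close>), and its norm is at most a multiple
  of the step length plus the noise. Taking the old iterate as competitor shows that \<open>\<Phi>\<close> decreases by a
  multiple of the squared step length, up to a multiple of the squared noise. The noise is of order
  \<open>k powr -p\<close>, and the differences of the sequence \<open>k powr -p\<close> are of order \<open>k powr (-p - 1)\<close>, which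
  dominates \<open>k powr (-2 * p)\<close> because \<open>p > 1\<close>. So adding a multiple of \<open>k powr -p\<close> to the objective
  values makes them decrease; coercivity then keeps the iterates in a ball.

  The length of the trajectory is controlled by a Lojasiewicz inequality on that ball: for a limit
  value \<open>c\<close> there is \<open>\<theta> < 1\<close> with \<open>(\<Phi> x - c) powr \<theta> \<le> C * norm U\<close> for all \<open>x\<close> with value slightly above
  \<open>c\<close> (\<open>definable_Lojasiewicz\<close>). By concavity of \<open>s powr (1 - \<theta>)\<close> the step lengths telescope
  (\<open>noisy_descent_converges\<close>). The term \<open>k powr -p\<close> enters with the power \<open>\<theta>\<close>, which is summable if
  \<open>\<theta> > 1 / p\<close>; the exponent may be raised, so this is no restriction. The limit is critical since the
  subgradients \<open>U\<close> tend to \<open>0\<close> while the objective values converge to the value at the limit.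

  The Lojasiewicz inequality is derived without differentiating semi-algebraic curves. For every small
  \<open>t\<close> choose, definably, a point \<open>x t\<close> of value \<open>c + t\<close> with a shortest subgradient \<open>u t\<close>. A bounded
  definable function of one variable crosses every level at most \<open>D\<close> times and approaches its limit at
  a rate \<open>t powr (1 / m)\<close>, so its variation on \<open>[\<tau>, 2 * \<tau>]\<close> is of order \<open>\<tau> powr (1 / m)\<close>. Among \<open>N\<close>
  equidistant levels in \<open>[\<tau>, 2 * \<tau>]\<close> two consecutive ones thus have points at a distance of at most
  \<open>V / N\<close>, where \<open>V\<close> is of this order, and the subgradient inequality between them reads
  \<open>\<tau> / N \<le> norm (u t) * V / N + K * V\<^sup>2 / N\<^sup>2\<close>. Letting \<open>N\<close> grow gives \<open>\<tau> \<le> V * sup (norm (u t))\<close>, that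
  is, \<open>norm (u t)\<close> is at least a multiple of \<open>t powr (1 - 1 / m)\<close> somewhere in \<open>[\<tau>, 2 * \<tau>]\<close>. A definable
  condition on \<open>t\<close> either holds or fails for all small \<open>t > 0\<close>, so the bound holds at every small level.

  All of this needs the Tarski-Seidenberg theorem. A predicate is called definable here if it is
  determined by the signs of finitely many polynomials, and the theorem becomes closure under
  quantifiers (\<open>definable_ex\<close>). It follows the method of Cohen and Hoermander: the arrangement on the
  line of the signs of finitely many univariate polynomials is determined by the signs of finitely
  many polynomials in their coefficients (\<open>tame_family_param_polys\<close>).
\<close>

section \<open>Matching the signs of univariate polynomials\<close>

lemma poly_sgn_const_on_segment:
  fixes p :: "real poly"
  assumes "\<And>w. w \<in> closed_segment x y \<Longrightarrow> poly p w \<noteq> 0"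
  shows "sgn (poly p x) = sgn (poly p y)"
proof (rule ccontr)
  assume neq: "sgn (poly p x) \<noteq> sgn (poly p y)"
  have nz: "poly p x \<noteq> 0" "poly p y \<noteq> 0" using assms by auto
  then have ne: "poly p x * poly p y < 0" using neq
    by (auto simp: sgn_if mult_less_0_iff split: if_splits)
  then have "x \<noteq> y" by auto
  then consider "x < y" | "y < x" by linarith
  then show False
  proof cases
    case 1
    then show ?thesis using poly_IVT[OF 1 ne] assms by (force simp: closed_segment_eq_real_ivl)
  next
    case 2
    then show ?thesis using poly_IVT[OF 2, of p] ne assms
      by (force simp: closed_segment_eq_real_ivl mult.commute)
  qed
qed

text \<open>
  On a segment without critical points the polynomial is strictly monotone, so away from a root its
  sign is read off from the sign of the derivative and the side on which the point lies.
\<close>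
lemma sgn_poly_from_root:
  fixes p :: "real poly"
  assumes nz: "\<And>w. w \<in> closed_segment y x \<Longrightarrow> poly (pderiv p) w \<noteq> 0"
    and "poly p y = 0"
  shows "sgn (poly p x) = sgn (poly (pderiv p) x) * sgn (x - y)"
proof -
  have *: "sgn (poly (pderiv p) w) = sgn (poly (pderiv p) x)" if "w \<in> closed_segment y x" for w
  proof (rule poly_sgn_const_on_segment)
    fix v assume "v \<in> closed_segment w x"
    then have "v \<in> closed_segment y x" using that
      by (auto simp: closed_segment_eq_real_ivl split: if_splits)
    then show "poly (pderiv p) v \<noteq> 0" by (rule nz)
  qed
  consider "y < x" | "y = x" | "x < y" by linarith
  then show ?thesis
  proof cases
    case 1
    obtain v where v: "y < v" "v < x" "poly p x - poly p y = (x - y) * poly (pderiv p) v"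
      using poly_MVT[OF 1] by blast
    with *[of v] 1 show ?thesis using assms(2) by (simp add: sgn_mult closed_segment_eq_real_ivl)
  next
    case 2 then show ?thesis using assms(2) by simp
  next
    case 3
    obtain v where v: "x < v" "v < y" "poly p y - poly p x = (y - x) * poly (pderiv p) v"
      using poly_MVT[OF 3] by blast
    have "poly p x = (x - y) * poly (pderiv p) v" using v(3) assms(2) by (simp add: algebra_simps)
    with *[of v] v 3 show ?thesis by (simp add: sgn_mult closed_segment_eq_real_ivl)
  qed
qed

text \<open>
  Reflecting the line turns this into a question about large arguments, where a polynomial and its
  derivative have the signs of their leading coefficients, and these two signs agree.
\<close>
lemma poly_neg_far_left:
  fixes q :: "real poly"
  assumes pos: "\<And>w. w \<le> c \<Longrightarrow> poly (pderiv q) w > 0"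
  shows "\<exists>w<c. poly q w < 0"
proof -
  define r where "r = - pcompose q [:0, -1:]"
  have r: "poly r w = - poly q (- w)" for w by (simp add: r_def poly_pcompose)
  have r': "poly (pderiv r) w = poly (pderiv q) (- w)" for w
    by (simp add: r_def pderiv_minus pderiv_pcompose poly_pcompose pderiv_pCons)
  have "pderiv r \<noteq> 0" using r'[of "-c"] pos[of c] by auto
  then have deg: "degree r \<noteq> 0" by (auto simp: pderiv_eq_0_iff)
  have "lead_coeff (pderiv r) > 0"
  proof (rule ccontr)
    assume "\<not> ?thesis"
    then have "lead_coeff (- pderiv r) > 0" using \<open>pderiv r \<noteq> 0\<close>
      by (metis degree_minus coeff_minus leading_coeff_0_iff less_linear neg_0_less_iff_less)
    from poly_pinfty_gt_lc[OF this] obtain n where "\<And>x. x \<ge> n \<Longrightarrow> poly (- pderiv r) x \<ge> lead_coeff (- pderiv r)"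
      by blast
    from this[of "max n (-c)"] \<open>lead_coeff (- pderiv r) > 0\<close> have "poly (pderiv r) (max n (-c)) < 0" by simp
    moreover have "poly (pderiv r) (max n (-c)) > 0" unfolding r' by (rule pos) auto
    ultimately show False by simp
  qed
  moreover have "lead_coeff (pderiv r) = real (degree r) * lead_coeff r"
    using deg by (simp add: degree_pderiv coeff_pderiv)
  ultimately have "lead_coeff r > 0" by (simp add: zero_less_mult_iff)
  from poly_pinfty_gt_lc[OF this] obtain n where "\<And>x. x \<ge> n \<Longrightarrow> poly r x \<ge> lead_coeff r" by blast
  from this[of "max n (1-c)"] \<open>lead_coeff r > 0\<close> have "poly q (- max n (1-c)) < 0" by (simp add: r)
  moreover have "- max n (1-c) < c" by auto
  ultimately show ?thesis by blast
qed

text \<open>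
  Here \<open>h\<close> identifies the lines of \<open>p\<close> and \<open>q\<close>, and a cell is a component of the complement of \<open>Z\<close>,
  the points at which the sign of \<open>p\<close> is known to agree with that of \<open>q\<close>. The critical points of \<open>p\<close> lie
  in \<open>Z\<close>, so \<open>p\<close> increases on the cell of \<open>x\<close>, and so does \<open>q\<close> on the image. If the cell has a left end
  point \<open>z\<close>, then \<open>p z < 0\<close>, so \<open>q (h z) < 0\<close> and the intermediate value theorem gives a root; otherwise
  \<open>q\<close> is negative far to the left.
\<close>
lemma root_in_matched_cell_left:
  fixes p q :: "real poly"
  assumes h: "strict_mono h" "surj h" and Z: "finite Z"
    and Zp: "\<And>x. poly (pderiv p) x = 0 \<Longrightarrow> x \<in> Z"
    and m': "\<And>x. sgn (poly (pderiv p) x) = sgn (poly (pderiv q) (h x))"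
    and mZ: "\<And>z. z \<in> Z \<Longrightarrow> sgn (poly p z) = sgn (poly q (h z))"
    and x: "x \<notin> Z" "poly (pderiv p) x > 0" "poly p x \<le> 0" "poly q (h x) > 0"
  shows "\<exists>y<h x. poly q y = 0 \<and> (\<forall>z\<in>Z. h z \<notin> {y..h x})"
proof -
  have cell: "poly (pderiv p) w > 0" if "w \<le> x" "\<And>v. v \<in> Z \<Longrightarrow> w \<le> v \<Longrightarrow> \<not> v < x" for w
  proof -
    have "sgn (poly (pderiv p) w) = sgn (poly (pderiv p) x)"
    proof (rule poly_sgn_const_on_segment)
      fix v assume "v \<in> closed_segment w x"
      then have "w \<le> v" "v \<le> x" using that(1) by (simp_all add: closed_segment_eq_real_ivl)
      then show "poly (pderiv p) v \<noteq> 0" using Zp[of v] that(2)[of v] x(1) by (cases "v = x") auto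
    qed
    then show ?thesis using x(2) by (simp add: sgn_if split: if_splits)
  qed
  show ?thesis
  proof (cases "\<exists>z\<in>Z. z < x")
    case True
    define z where "z = Max {z\<in>Z. z < x}"
    have zin: "z \<in> Z" "z < x" and zmax: "\<And>v. v \<in> Z \<Longrightarrow> v < x \<Longrightarrow> v \<le> z"
      using True Z Max_in[of "{z\<in>Z. z < x}"] unfolding z_def
      by (auto intro!: Max_ge simp del: Max_less_iff)
    have pos: "poly (pderiv p) w > 0" if "z < w" "w \<le> x" for w
      using that zmax by (intro cell) (force simp: le_less)+
    obtain v where v: "z < v" "v < x" "poly p x - poly p z = (x - z) * poly (pderiv p) v"
      using poly_MVT[OF zin(2)] by blast
    have "(x - z) * poly (pderiv p) v > 0" using v pos[of v] zin(2) by (intro mult_pos_pos) auto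
    then have "poly p z < 0" using v(3) x(3) by linarith
    then have "poly q (h z) < 0" using mZ[OF zin(1)] by (simp add: sgn_if split: if_splits)
    moreover have "h z < h x" using h(1) zin(2) by (simp add: strict_mono_less)
    ultimately obtain y where y: "h z < y" "y < h x" "poly q y = 0"
      using poly_IVT_pos x(4) by blast
    have "h w \<notin> {y..h x}" if "w \<in> Z" for w
    proof
      assume "h w \<in> {y..h x}"
      then have "h z < h w" "h w \<le> h x" using y by auto
      then have "z < w" "w \<le> x" using h(1) by (simp_all add: strict_mono_less strict_mono_less_eq)
      then show False using zmax[OF that] that x(1) by (cases "w = x") auto
    qed
    then show ?thesis using y by blast
  next
    case False
    have pos: "poly (pderiv p) w > 0" if "w \<le> x" for w
      using that False by (intro cell) blast+
    have "poly (pderiv q) w > 0" if "w \<le> h x" for w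
    proof -
      obtain v where v: "w = h v" using h(2) by (metis surjD)
      then have "v \<le> x" using that h(1) by (simp add: strict_mono_less_eq)
      then show ?thesis using pos[of v] m'[of v] v by (simp add: sgn_if split: if_splits)
    qed
    then obtain u where "u < h x" "poly q u < 0" using poly_neg_far_left[of "h x" q] by blast
    then obtain y where y: "u < y" "y < h x" "poly q y = 0" using poly_IVT_pos x(4) by blast
    have "h z \<notin> {y..h x}" if "z \<in> Z" for z
    proof -
      have "x < z" using False that x(1) by (metis linorder_neqE)
      then have "h x < h z" using h(1) by (simp add: strict_mono_less)
      then show ?thesis by simp
    qed
    then show ?thesis using y by blast
  qed
qed

lemma root_in_matched_cell:
  fixes p q :: "real poly"
  assumes h: "strict_mono h" "surj h" and Z: "finite Z"
    and Zp: "\<And>x. poly (pderiv p) x = 0 \<Longrightarrow> x \<in> Z"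
    and m': "\<And>x. sgn (poly (pderiv p) x) = sgn (poly (pderiv q) (h x))"
    and mZ: "\<And>z. z \<in> Z \<Longrightarrow> sgn (poly p z) = sgn (poly q (h z))"
    and x: "x \<notin> Z" "sgn (poly p x) \<noteq> sgn (poly q (h x))" "poly q (h x) \<noteq> 0"
  shows "\<exists>y. y \<noteq> h x \<and> poly q y = 0 \<and> (\<forall>z\<in>Z. h z \<notin> closed_segment y (h x))"
proof -
  \<comment> \<open>Replacing \<open>(p, q)\<close> by \<open>(-p, -q)\<close> makes \<open>q (h x)\<close> positive; reflecting both axes then makes
     \<open>p' x\<close> positive.\<close>
  have pos: "\<exists>y. y \<noteq> h x \<and> poly q y = 0 \<and> (\<forall>z\<in>Z. h z \<notin> closed_segment y (h x))"
    if m': "\<And>x. sgn (poly (pderiv p) x) = sgn (poly (pderiv q) (h x))"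
      and mZ: "\<And>z. z \<in> Z \<Longrightarrow> sgn (poly p z) = sgn (poly q (h z))"
      and Zp: "\<And>x. poly (pderiv p) x = 0 \<Longrightarrow> x \<in> Z"
      and qx: "poly q (h x) > 0" and px: "poly p x \<le> 0" for p q
  proof (cases "poly (pderiv p) x > 0")
    case True
    from root_in_matched_cell_left[OF h Z Zp m' mZ x(1) True px qx]
    obtain y where "y < h x" "poly q y = 0" "\<forall>z\<in>Z. h z \<notin> {y..h x}" by blast
    then show ?thesis by (intro exI[of _ y]) (auto simp: closed_segment_eq_real_ivl)
  next
    case False
    define P where "P = pcompose p [:0, -1:]"
    define Q where "Q = pcompose q [:0, -1:]"
    have P: "poly P w = poly p (- w)" "poly (pderiv P) w = - poly (pderiv p) (- w)" for w
      by (simp_all add: P_def pderiv_pcompose poly_pcompose pderiv_pCons)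
    have Q: "poly Q w = poly q (- w)" "poly (pderiv Q) w = - poly (pderiv q) (- w)" for w
      by (simp_all add: Q_def pderiv_pcompose poly_pcompose pderiv_pCons)
    define k where "k = (\<lambda>w. - h (- w))"
    have k: "strict_mono k" "surj k"
    proof -
      show "strict_mono k" using h(1) by (auto simp: k_def strict_mono_def)
      show "surj k" unfolding surj_def k_def using h(2)
        by (metis add.inverse_inverse surjD)
    qed
    have nz: "poly (pderiv p) x \<noteq> 0" using Zp x(1) by blast
    have "\<exists>y<k (-x). poly Q y = 0 \<and> (\<forall>z\<in>uminus ` Z. k z \<notin> {y..k (- x)})"
    proof (rule root_in_matched_cell_left[OF k, where p = P])
      show "finite (uminus ` Z)" using Z by simp
      show "w \<in> uminus ` Z" if "poly (pderiv P) w = 0" for w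
        using that Zp[of "- w"] by (auto simp: P image_iff intro!: bexI[of _ "- w"])
      show "sgn (poly (pderiv P) w) = sgn (poly (pderiv Q) (k w))" for w
        using m'[of "- w"] by (simp add: P Q k_def sgn_minus)
      show "sgn (poly P w) = sgn (poly Q (k w))" if "w \<in> uminus ` Z" for w
        using mZ[of "- w"] that by (auto simp add: P Q k_def)
      show "- x \<notin> uminus ` Z" using x(1) by auto
      show "0 < poly (pderiv P) (- x)" using False nz by (simp add: P)
      show "poly P (- x) \<le> 0" "0 < poly Q (k (- x))" using px qx by (simp_all add: P Q k_def)
    qed
    then obtain y where "y < k (-x)" "poly Q y = 0" and yz: "\<forall>z\<in>uminus ` Z. k z \<notin> {y..k (- x)}" by blast
    then have "- y > h x" "poly q (- y) = 0" by (auto simp: Q k_def)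
    moreover have "h z \<notin> closed_segment (- y) (h x)" if "z \<in> Z" for z
      using yz that \<open>- y > h x\<close> by (auto simp: k_def closed_segment_eq_real_ivl)
    ultimately show ?thesis by (intro exI[of _ "- y"]) auto
  qed
  show ?thesis
  proof (cases "poly q (h x) > 0")
    case True
    then have "poly p x \<le> 0" using x(2) by (auto simp: sgn_if split: if_splits)
    then show ?thesis using pos[OF m' mZ Zp True] by blast
  next
    case False
    then have "poly (-q) (h x) > 0" "poly (-p) x \<le> 0" using x by (auto simp: sgn_if split: if_splits)
    from pos[of "-p" "-q", OF _ _ _ this] m' mZ Zp show ?thesis
      by (auto simp: pderiv_minus sgn_minus)
  qed
qed

text \<open>
  The map is linear on both sides of \<open>u\<close>, and exchanging \<open>u\<close> and \<open>w\<close> gives its inverse.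
\<close>
lemma push_map:
  fixes A B u w :: real
  assumes "A < u" "u < B" "A < w" "w < B"
  shows "\<exists>g. strict_mono g \<and> surj g \<and> g u = w \<and> (\<forall>y. y \<notin> {A<..<B} \<longrightarrow> g y = y) \<and> (\<forall>y\<in>{A<..<B}. g y \<in> {A<..<B})"
proof -
  define G where "G = (\<lambda>u w x. if x \<le> A \<or> B \<le> x then x
      else if x \<le> u then A + (x - A) * ((w - A) / (u - A)) else B - (B - x) * ((B - w) / (B - u)))"
  have mid: "A < G u w x \<and> G u w x < B \<and> (x \<le> u \<longleftrightarrow> G u w x \<le> w)"
    if "A < u" "u < B" "A < w" "w < B" "A < x" "x < B" for u w x
  proof (cases "x \<le> u")
    case True
    have "(x - A) * ((w - A) / (u - A)) > 0" using that by (intro mult_pos_pos divide_pos_pos) auto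
    moreover have "(x - A) * ((w - A) / (u - A)) \<le> (u - A) * ((w - A) / (u - A))"
      using that True by (intro mult_right_mono) auto
    ultimately show ?thesis using that True by (simp add: G_def)
  next
    case False
    have "(B - x) * ((B - w) / (B - u)) > 0" using that by (intro mult_pos_pos divide_pos_pos) auto
    moreover have "(B - x) * ((B - w) / (B - u)) < (B - u) * ((B - w) / (B - u))"
      using that False by (intro mult_strict_right_mono) auto
    ultimately show ?thesis using that False by (simp add: G_def)
  qed
  have sm: "strict_mono (G u w)"
  proof (rule strict_monoI)
    fix x y :: real assume xy: "x < y"
    note m = mid[OF assms]
    have c1: "0 < (w - A) / (u - A)" "0 < (B - w) / (B - u)" using assms by auto
    consider "x \<le> A \<or> B \<le> x" | "y \<le> A \<or> B \<le> y" "A < x" "x < B"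
      | "A < x" "y < B" "y \<le> u" | "A < x" "y < B" "x \<le> u" "u < y" | "A < x" "y < B" "u < x"
      by linarith
    then show "G u w x < G u w y"
    proof cases
      case 1
      then show ?thesis using m[of y] xy by (cases "A < y \<and> y < B") (auto simp: G_def)
    next
      case 2
      then show ?thesis using m[of x] xy by (auto simp: G_def)
    next
      case 3
      have "(x - A) * ((w - A) / (u - A)) < (y - A) * ((w - A) / (u - A))"
        by (rule mult_strict_right_mono) (use xy c1 in auto)
      then show ?thesis using 3 xy unfolding G_def by simp
    next
      case 4
      then show ?thesis using m[of x] m[of y] xy by auto
    next
      case 5
      have "(B - y) * ((B - w) / (B - u)) < (B - x) * ((B - w) / (B - u))"
        by (rule mult_strict_right_mono) (use xy c1 in auto)
      then show ?thesis using 5 xy unfolding G_def by simp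
    qed
  qed
  have inv: "G u w (G w u y) = y" for y
  proof (cases "A < y \<and> y < B")
    case True
    note m = mid[OF assms(3,4,1,2), of y]
    show ?thesis
    proof (cases "y \<le> w")
      case True': True
      then have e: "G w u y = A + (y - A) * ((u - A) / (w - A))" using True by (simp add: G_def)
      then have "G u w (G w u y) = A + (G w u y - A) * ((w - A) / (u - A))"
        using m True True' by (simp add: G_def)
      then show ?thesis using e assms by simp
    next
      case False
      then have e: "G w u y = B - (B - y) * ((B - u) / (B - w))" using True by (simp add: G_def)
      then have "G u w (G w u y) = B - (B - G w u y) * ((B - w) / (B - u))"
        using m True False by (simp add: G_def)
      then show ?thesis using e assms by simp
    qed
  qed (auto simp: G_def)
  have "surj (G u w)" by (metis inv surjI)
  moreover have "G u w u = w" using assms by (simp add: G_def)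
  moreover have "\<forall>y. y \<notin> {A<..<B} \<longrightarrow> G u w y = y" by (auto simp: G_def)
  moreover have "\<forall>y\<in>{A<..<B}. G u w y \<in> {A<..<B}" using mid[OF assms] by auto
  ultimately show ?thesis using sm by blast
qed

text \<open>
  The geometric step of the Cohen-Hoermander argument. Let \<open>h\<close> match the signs of the pairs in \<open>K\<close>,
  among them the derivatives of \<open>p\<close> and \<open>q\<close>, and let \<open>p\<close> and \<open>q\<close> have matching signs at the roots of the
  polynomials in \<open>K\<close>. Between consecutive such roots \<open>p\<close> is monotone, so it has at most one root there,
  and whether it has one is decided by the signs at the ends, hence in the same way for \<open>q\<close>. Moving
  the images of these roots to the roots of \<open>q\<close>, inside the cells, gives a map that also matches
  \<open>(p, q)\<close> and still matches \<open>K\<close>, since no polynomial of \<open>K\<close> changes sign within a cell.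
\<close>
lemma extend_order_match:
  fixes p q :: "real poly" and K :: "(real poly \<times> real poly) set"
  assumes h: "strict_mono h" "surj h" and K: "finite K"
    and match: "\<And>a b x. (a, b) \<in> K \<Longrightarrow> sgn (poly a x) = sgn (poly b (h x))"
    and pq': "(pderiv p, pderiv q) \<in> K" and p'0: "pderiv p \<noteq> 0"
    and roots: "\<And>a b x. (a, b) \<in> K \<Longrightarrow> a \<noteq> 0 \<Longrightarrow> poly a x = 0 \<Longrightarrow> sgn (poly p x) = sgn (poly q (h x))"
  shows "\<exists>k. strict_mono k \<and> surj k \<and>
     (\<forall>(a, b)\<in>insert (p, q) K. \<forall>x. sgn (poly a x) = sgn (poly b (k x)))"
proof -
  define Z where "Z = (\<Union>(a, b)\<in>{(a, b)\<in>K. a \<noteq> 0}. {x. poly a x = 0})"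
  have Z: "finite Z" unfolding Z_def
    by (rule finite_UN_I) (auto simp: poly_roots_finite intro: finite_subset[OF _ K])
  have ZI: "x \<in> Z" if "(a, b) \<in> K" "a \<noteq> 0" "poly a x = 0" for a b x
    using that by (auto simp: Z_def)
  have Zp: "x \<in> Z" if "poly (pderiv p) x = 0" for x using ZI[OF pq' p'0 that] .
  have mZ: "sgn (poly p z) = sgn (poly q (h z))" if "z \<in> Z" for z
    using that roots by (auto simp: Z_def)
  define good where "good k \<longleftrightarrow> strict_mono k \<and> surj k \<and> (\<forall>z\<in>Z. k z = h z) \<and>
     (\<forall>(a, b)\<in>K. \<forall>x. sgn (poly a x) = sgn (poly b (k x)))" for k :: "real \<Rightarrow> real"
  define R where "R = {x. poly p x = 0} - Z"
  have "p \<noteq> 0" using p'0 by auto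
  then have "finite R" by (simp add: R_def poly_roots_finite)
  \<comment> \<open>The roots of \<open>p\<close> outside \<open>Z\<close> are sent to roots of \<open>q\<close> one after the other, each
     time by an order automorphism that moves only points of one cell.\<close>
  have "S \<subseteq> R \<Longrightarrow> \<exists>k. good k \<and> (\<forall>r\<in>S. poly q (k r) = 0)" if "finite S" for S
    using that
  proof (induction S rule: finite_induct)
    case empty
    have "good h" using h match by (auto simp: good_def)
    then show ?case by blast
  next
    case (insert r S)
    then obtain k where k: "good k" and kS: "\<forall>r\<in>S. poly q (k r) = 0" by blast
    have km: "strict_mono k" "surj k" and kZ: "\<And>z. z \<in> Z \<Longrightarrow> k z = h z"
      and kK: "\<And>a b x. (a, b) \<in> K \<Longrightarrow> sgn (poly a x) = sgn (poly b (k x))"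
      using k by (auto simp: good_def)
    have r: "poly p r = 0" "r \<notin> Z" using insert.prems by (auto simp: R_def)
    have kr: "k r \<notin> k ` Z" using km(1) r(2) by (auto simp: strict_mono_eq)
    obtain w where w: "poly q w = 0" "\<forall>z\<in>Z. k z \<notin> closed_segment w (k r)"
    proof (cases "poly q (k r) = 0")
      case True
      then show ?thesis using that[of "k r"] kr by (metis closed_segment_idem empty_iff image_eqI insert_iff)
    next
      case False
      have "\<exists>y. y \<noteq> k r \<and> poly q y = 0 \<and> (\<forall>z\<in>Z. k z \<notin> closed_segment y (k r))"
        by (rule root_in_matched_cell[OF km Z Zp, where p = p])
          (use False kZ mZ kK[OF pq'] r in \<open>auto simp: sgn_if\<close>)
      then show ?thesis using that by blast
    qed
    \<comment> \<open>a slightly larger open interval that still misses the finite set \<open>k ` Z\<close>\<close>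
    obtain d1 d2 where d: "0 < d1" "\<forall>z\<in>k ` Z. z \<noteq> min w (k r) \<longrightarrow> d1 \<le> dist (min w (k r)) z"
      "0 < d2" "\<forall>z\<in>k ` Z. z \<noteq> max w (k r) \<longrightarrow> d2 \<le> dist (max w (k r)) z"
      using finite_set_avoid[OF finite_imageI[OF Z]] by metis
    define A where "A = min w (k r) - d1"
    define B where "B = max w (k r) + d2"
    have AB: "A < k r" "k r < B" "A < w" "w < B" using d(1,3) by (auto simp: A_def B_def)
    have ZAB: "k z \<notin> {A<..<B}" if "z \<in> Z" for z
    proof -
      have "k z < min w (k r) \<or> max w (k r) < k z"
        using w(2) that by (auto simp: closed_segment_eq_real_ivl split: if_splits)
      then show ?thesis using d(2,4) that by (auto simp: A_def B_def dist_real_def)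
    qed
    obtain g where g: "strict_mono g" "surj g" "g (k r) = w" "\<And>y. y \<notin> {A<..<B} \<Longrightarrow> g y = y"
       "\<And>y. y \<in> {A<..<B} \<Longrightarrow> g y \<in> {A<..<B}" using push_map[OF AB] by blast
    have gm: "strict_mono (g \<circ> k)" "surj (g \<circ> k)"
      using g(1) km(1) comp_surj[OF km(2) g(2)] by (auto simp: strict_mono_def)
    have gK: "sgn (poly a x) = sgn (poly b (g (k x)))" if ab: "(a, b) \<in> K" for a b x
    proof (cases "a = 0")
      case True
      have "poly b (k u) = 0" for u using kK[OF ab, of u] True by (simp add: sgn_if split: if_splits)
      moreover obtain u where "g (k x) = k u" using km(2) by (metis surjD)
      ultimately show ?thesis using True by simp
    next
      case False
      have "sgn (poly b (k x)) = sgn (poly b (g (k x)))"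
      proof (cases "k x \<in> {A<..<B}")
        case True
        show ?thesis
        proof (rule poly_sgn_const_on_segment)
          fix v assume "v \<in> closed_segment (k x) (g (k x))"
          then have v: "v \<in> {A<..<B}" using True g(5)[OF True]
            by (auto simp: closed_segment_eq_real_ivl split: if_splits)
          obtain u where u: "v = k u" using km(2) by (metis surjD)
          then have "u \<notin> Z" using ZAB v by blast
          then have "poly a u \<noteq> 0" using ZI[OF ab False] by blast
          then show "poly b v \<noteq> 0" using kK[OF ab, of u] u by (auto simp: sgn_if split: if_splits)
        qed
      qed (simp add: g(4))
      then show ?thesis using kK[OF ab] by simp
    qed
    have "good (g \<circ> k)" using gm gK kZ g(4)[OF ZAB] by (auto simp: good_def)
    moreover have "poly q ((g \<circ> k) s) = 0" if "s \<in> insert r S" for s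
    proof (cases "s = r")
      case True then show ?thesis using g(3) w(1) by simp
    next
      case False
      then have s: "s \<in> S" "poly p s = 0" using that insert.prems by (auto simp: R_def)
      have "k s \<notin> {A<..<B}"
      proof
        assume ks: "k s \<in> {A<..<B}"
        have "poly (pderiv p) v \<noteq> 0" if v: "v \<in> closed_segment r s" for v
        proof
          assume "poly (pderiv p) v = 0"
          then have "k v \<notin> {A<..<B}" using Zp ZAB by blast
          moreover have "k v \<in> closed_segment (k r) (k s)" using v km(1)
            by (auto simp: closed_segment_eq_real_ivl strict_mono_less_eq split: if_splits)
          ultimately show False using ks AB by (auto simp: closed_segment_eq_real_ivl split: if_splits)
        qed
        from sgn_poly_from_root[of r s p, OF this r(1)] this[of s] show False
          using s(2) False by (simp add: sgn_zero_iff)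
      qed
      then show ?thesis using g(4) kS s(1) by simp
    qed
    ultimately show ?case by blast
  qed
  then obtain k where k: "good k" and kR: "\<forall>r\<in>R. poly q (k r) = 0" using \<open>finite R\<close> by blast
  have km: "strict_mono k" "surj k" and kZ: "\<And>z. z \<in> Z \<Longrightarrow> k z = h z"
    and kK: "\<And>a b x. (a, b) \<in> K \<Longrightarrow> sgn (poly a x) = sgn (poly b (k x))"
    using k by (auto simp: good_def)
  have "bij k" using km by (simp add: bij_def strict_mono_imp_inj_on)
  define l where "l = inv k"
  have lk: "l (k x) = x" and kl: "k (l y) = y" for x y
    using \<open>bij k\<close> by (simp_all add: l_def bij_is_inj bij_is_surj surj_f_inv_f)
  have lm: "strict_mono l" "surj l"
    using km(1) lk kl by (auto intro!: strict_monoI surjI[of l k]) (metis strict_mono_less)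
  have "sgn (poly p x) = sgn (poly q (k x))" for x
  proof (cases "x \<in> Z \<or> poly p x = 0")
    case True
    then show ?thesis using mZ kZ kR by (cases "x \<in> Z") (auto simp: R_def)
  next
    case False
    show ?thesis
    proof (rule ccontr)
      assume neq: "sgn (poly p x) \<noteq> sgn (poly q (k x))"
      have "\<exists>y. y \<noteq> l (k x) \<and> poly p y = 0 \<and> (\<forall>z\<in>k ` Z. l z \<notin> closed_segment y (l (k x)))"
      proof (rule root_in_matched_cell[OF lm, where p = q])
        show "finite (k ` Z)" using Z by simp
        show "w \<in> k ` Z" if "poly (pderiv q) w = 0" for w
        proof -
          have "poly (pderiv p) (l w) = 0" using kK[OF pq', of "l w"] that
            by (simp add: kl sgn_if split: if_splits)
          then show ?thesis using Zp[of "l w"] kl[of w] by force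
        qed
        show "sgn (poly (pderiv q) w) = sgn (poly (pderiv p) (l w))" for w
          using kK[OF pq', of "l w"] by (simp add: kl)
        show "sgn (poly q z) = sgn (poly p (l z))" if "z \<in> k ` Z" for z
        proof -
          obtain u where "u \<in> Z" "z = k u" using \<open>z \<in> k ` Z\<close> by blast
          then show ?thesis using mZ[of u] kZ[of u] lk[of u] by simp
        qed
        show "k x \<notin> k ` Z" using False km(1) by (auto simp: strict_mono_eq)
      qed (use False neq in \<open>auto simp: lk\<close>)
      then obtain y where y: "y \<noteq> x" "poly p y = 0" "\<forall>z\<in>Z. z \<notin> closed_segment y x" by (auto simp: lk)
      have nz: "poly (pderiv p) w \<noteq> 0" if "w \<in> closed_segment y x" for w using y(3) Zp that by blast
      have "y \<in> R" using y by (auto simp: R_def)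
      then have qy: "poly q (k y) = 0" using kR by blast
      have nzq: "poly (pderiv q) w \<noteq> 0" if "w \<in> closed_segment (k y) (k x)" for w
      proof -
        obtain v where "w = k v" using km(2) by (metis surjD)
        then have "v \<in> closed_segment y x" using that km(1)
          by (simp add: closed_segment_eq_real_ivl strict_mono_less_eq split: if_splits)
        then have "l w \<in> closed_segment y x" using \<open>w = k v\<close> lk by simp
        then show ?thesis using nz kK[OF pq', of "l w"] by (auto simp: kl sgn_if split: if_splits)
      qed
      have "sgn (k x - k y) = sgn (x - y)" using km(1) by (auto simp: sgn_if strict_mono_less strict_mono_eq)
      then show False using neq sgn_poly_from_root[OF nz y(2)] sgn_poly_from_root[OF nzq qy] kK[OF pq', of x]
        by simp
    qed
  qed
  then show ?thesis using km kK by (intro exI[of _ k]) auto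
qed

section \<open>Polynomials with parameters\<close>

definition same_signs :: "('z \<Rightarrow> real) set \<Rightarrow> 'z \<Rightarrow> 'z \<Rightarrow> bool" where
  "same_signs Qs e e' \<longleftrightarrow> (\<forall>q\<in>Qs. sgn (q e) = sgn (q e'))"

text \<open>
  Polynomials in one variable whose coefficients are polynomials in a parameter \<open>e\<close>. The bound \<open>d\<close> is a
  formal degree: at particular parameters the leading coefficient may vanish.
\<close>
definition param_polys :: "nat \<Rightarrow> ('z::real_normed_vector \<Rightarrow> real poly) set" where
  "param_polys d = {P. (\<forall>k. real_polynomial_function (\<lambda>e. coeff (P e) k)) \<and> (\<forall>e. degree (P e) \<le> d)}"

lemma param_polysD:
  assumes "P \<in> param_polys d"
  shows "real_polynomial_function (\<lambda>e. coeff (P e) k)" "degree (P e) \<le> d"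
  using assms by (auto simp: param_polys_def)

text \<open>
  One step of division of \<open>p\<close> (formal degree \<open>d\<close>) by the truncation of \<open>q\<close> to degree \<open>m\<close>, cleared of
  denominators. The leading coefficient of \<open>q\<close> enters as a square so that signs at the roots of \<open>q\<close>
  are preserved. Lowering the degree by one is enough for the induction.
\<close>
definition reduct :: "nat \<Rightarrow> nat \<Rightarrow> real poly \<Rightarrow> real poly \<Rightarrow> real poly" where
  "reduct d m p q = smult ((coeff q m)\<^sup>2) p
     - smult (coeff q m * coeff p d) (monom 1 (d - m) * poly_cutoff (Suc m) q)"

lemma coeff_reduct:
  "coeff (reduct d m p q) k = (coeff q m)\<^sup>2 * coeff p k
     - coeff q m * coeff p d * (if k < d - m then 0 else if k - (d - m) < Suc m then coeff q (k - (d - m)) else 0)"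
  by (simp add: reduct_def coeff_monom_mult coeff_poly_cutoff)

lemma degree_reduct:
  assumes "degree p \<le> d" "m \<le> d" "0 < d"
  shows "degree (reduct d m p q) \<le> d - 1"
proof (rule degree_le, intro allI impI)
  fix k assume "d - 1 < k"
  then consider "k = d" | "d < k" by linarith
  then show "coeff (reduct d m p q) k = 0"
  proof cases
    case 1
    then show ?thesis using assms by (simp add: coeff_reduct power2_eq_square)
  next
    case 2
    then have "coeff p k = 0" using assms(1) by (simp add: coeff_eq_0)
    then show ?thesis using 2 assms(2) by (auto simp: coeff_reduct)
  qed
qed

lemma poly_cutoff_degree: "poly_cutoff (Suc (degree q)) q = q"
  by (rule poly_eqI) (auto simp: coeff_poly_cutoff coeff_eq_0)

lemma sgn_reduct_at_root:
  fixes p q :: "real poly"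
  assumes "q \<noteq> 0" "poly q x = 0"
  shows "sgn (poly (reduct d (degree q) p q) x) = sgn (poly p x)"
proof -
  have "sgn ((lead_coeff q)\<^sup>2) = 1" using assms(1)
    by (metis leading_coeff_0_iff sgn_pos zero_less_power2)
  then show ?thesis using assms(2) by (simp add: reduct_def poly_cutoff_degree sgn_mult)
qed

lemma param_polys_cutoff:
  assumes "P \<in> param_polys d" "0 < d"
  shows "(\<lambda>e. poly_cutoff d (P e)) \<in> param_polys (d - 1)"
proof -
  have "real_polynomial_function (\<lambda>e. coeff (poly_cutoff d (P e)) k)" for k
    unfolding coeff_poly_cutoff using param_polysD(1)[OF assms(1)] by (cases "k < d") auto
  then show ?thesis using assms(2) unfolding param_polys_def
    by (auto simp: coeff_poly_cutoff intro!: degree_le)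
qed

lemma param_polys_pderiv:
  assumes "P \<in> param_polys d"
  shows "(\<lambda>e. pderiv (P e)) \<in> param_polys (d - 1)"
  using assms unfolding param_polys_def
  by (auto simp: coeff_pderiv degree_pderiv intro!: diff_le_mono)

lemma param_polys_reduct:
  assumes "P \<in> param_polys d" "Q \<in> param_polys d" "m \<le> d" "0 < d"
  shows "(\<lambda>e. reduct d m (P e) (Q e)) \<in> param_polys (d - 1)"
proof -
  have "real_polynomial_function (\<lambda>e. coeff (reduct d m (P e) (Q e)) k)" for k
  proof -
    have "real_polynomial_function (\<lambda>e. if k < d - m then 0
        else if k - (d - m) < Suc m then coeff (Q e) (k - (d - m)) else 0)"
      using param_polysD(1)[OF assms(2)] real_polynomial_function.intros(2)
      by (cases "k < d - m"; cases "k - (d - m) < Suc m"; simp)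
    then show ?thesis
      unfolding coeff_reduct using param_polysD(1)[OF assms(1)] param_polysD(1)[OF assms(2)]
      by (intro real_polynomial_function_diff real_polynomial_function.intros(4)
          real_polynomial_function_power)
  qed
  then show ?thesis using assms degree_reduct by (auto simp: param_polys_def)
qed

lemma param_polys_mono: "d \<le> d' \<Longrightarrow> P \<in> param_polys d \<Longrightarrow> P \<in> param_polys d'"
  by (auto simp: param_polys_def intro: order_trans)

text \<open>
  The polynomials of \<open>F\<close> show the same arrangement of signs along the line at the parameters \<open>e\<close> and \<open>e'\<close>.
  Asking for a map of the whole line, rather than comparing lists of roots, retains exactly the order
  information that the induction needs.
\<close>
definition sign_equiv :: "('z \<Rightarrow> real poly) set \<Rightarrow> 'z \<Rightarrow> 'z \<Rightarrow> bool" where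
  "sign_equiv F e e' \<longleftrightarrow> (\<exists>h. strict_mono h \<and> surj h \<and>
     (\<forall>P\<in>F. \<forall>x. sgn (poly (P e) x) = sgn (poly (P e') (h x))))"

definition tame_family :: "('z::real_normed_vector \<Rightarrow> real poly) set \<Rightarrow> bool" where
  "tame_family F \<longleftrightarrow> (\<exists>Qs. finite Qs \<and> (\<forall>q\<in>Qs. real_polynomial_function q) \<and>
     (\<forall>e e'. same_signs Qs e e' \<longrightarrow> sign_equiv F e e'))"

lemma same_signs_degree:
  assumes "same_signs Qs e e'" "\<And>k. k \<le> d \<Longrightarrow> (\<lambda>e. coeff (P e) k) \<in> Qs" "P \<in> param_polys d"
  shows "degree (P e) = degree (P e')" "P e = 0 \<longleftrightarrow> P e' = 0"
proof -
  have *: "coeff (P e) k = 0 \<longleftrightarrow> coeff (P e') k = 0" for k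
  proof (cases "k \<le> d")
    case True
    then show ?thesis using assms(1) assms(2)[of k] unfolding same_signs_def by (metis sgn_zero_iff)
  next
    case False
    then show ?thesis using param_polysD(2)[OF assms(3)] by (metis coeff_eq_0 le_trans not_le)
  qed
  then show "P e = 0 \<longleftrightarrow> P e' = 0" by (simp add: poly_eq_iff)
  show "degree (P e) = degree (P e')"
    by (rule antisym; rule degree_le; metis * coeff_eq_0)
qed

text \<open>
  The algebraic step of the Cohen-Hoermander argument. If the coefficient of degree \<open>d\<close> of \<open>P\<close> vanishes
  at the parameter, \<open>P\<close> equals its truncation. Otherwise \<open>extend_order_match\<close> applies, as the reducts
  provide the signs of \<open>P\<close> at the roots of the other polynomials; the coefficients are added to the
  test functions so that the degrees, which select the right reduct, agree at \<open>e\<close> and \<open>e'\<close>.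
\<close>
lemma tame_family_add:
  assumes d: "0 < d" and P: "P \<in> param_polys d" and F: "finite F" "F \<subseteq> param_polys d"
    and tame: "tame_family (insert (\<lambda>e. poly_cutoff d (P e)) (insert (\<lambda>e. pderiv (P e)) F \<union>
       (\<lambda>(m, Q) e. reduct d m (P e) (Q e)) ` ({..d} \<times> insert (\<lambda>e. pderiv (P e)) F)))"
      (is "tame_family ?G")
  shows "tame_family (insert P F)"
proof -
  define F' where "F' = insert (\<lambda>e. pderiv (P e)) F"
  have F': "finite F'" "F' \<subseteq> param_polys d"
    using F param_polys_mono[OF _ param_polys_pderiv[OF P]] by (auto simp: F'_def)
  obtain Qs where Qs: "finite Qs" "\<forall>q\<in>Qs. real_polynomial_function q"
    and QG: "\<And>e e'. same_signs Qs e e' \<Longrightarrow> sign_equiv ?G e e'"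
    using tame unfolding tame_family_def by blast
  define C where "C = (\<lambda>(k, Q) e. coeff (Q e) k) ` ({..d} \<times> insert P F')"
  have CI: "(\<lambda>e. coeff (Q e) k) \<in> C" if "Q \<in> insert P F'" "k \<le> d" for Q k
    unfolding C_def by (rule image_eqI[of _ _ "(k, Q)"]) (use that in auto)
  have "finite C" using F' by (auto simp: C_def)
  moreover have "\<forall>q\<in>C. real_polynomial_function q"
    using F' P param_polysD(1) by (fastforce simp: C_def)
  moreover have "sign_equiv (insert P F) e e'" if ss: "same_signs (Qs \<union> C) e e'" for e e'
  proof -
    have ssQ: "same_signs Qs e e'" and ssC: "same_signs C e e'" using ss by (auto simp: same_signs_def)
    from QG[OF ssQ] obtain h where h: "strict_mono h" "surj h"
      and hG: "\<And>R x. R \<in> ?G \<Longrightarrow> sgn (poly (R e) x) = sgn (poly (R e') (h x))"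
      unfolding sign_equiv_def by (elim exE conjE) (rule that, auto)
    have c: "coeff (P e) d = 0 \<longleftrightarrow> coeff (P e') d = 0"
      using ssC CI[of P d] unfolding same_signs_def by (metis insertI1 order_refl sgn_zero_iff)
    show ?thesis
    proof (cases "coeff (P e) d = 0")
      case True
      have cut: "poly_cutoff d (P u) = P u" if "coeff (P u) d = 0" for u
        by (rule poly_eqI) (use that param_polysD(2)[OF P, of u] in
          \<open>auto simp: coeff_poly_cutoff not_less coeff_eq_0 le_less\<close>)
      have "sgn (poly (P e) x) = sgn (poly (P e') (h x))" for x
        using hG[of "\<lambda>e. poly_cutoff d (P e)" x] cut True c by simp
      then show ?thesis using h hG unfolding sign_equiv_def by blast
    next
      case False
      have "degree (P e) > 0" using False d by (metis coeff_eq_0 gr0I)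
      then have p'0: "pderiv (P e) \<noteq> 0" by (auto simp: pderiv_eq_0_iff)
      have "\<exists>k. strict_mono k \<and> surj k \<and>
          (\<forall>(a, b)\<in>insert (P e, P e') ((\<lambda>Q. (Q e, Q e')) ` F'). \<forall>x. sgn (poly a x) = sgn (poly b (k x)))"
      proof (rule extend_order_match[OF h])
        show "finite ((\<lambda>Q. (Q e, Q e')) ` F')" using F' by simp
        show "sgn (poly a x) = sgn (poly b (h x))" if "(a, b) \<in> (\<lambda>Q. (Q e, Q e')) ` F'" for a b x
          using that hG by (auto simp: F'_def)
        show "(pderiv (P e), pderiv (P e')) \<in> (\<lambda>Q. (Q e, Q e')) ` F'" by (auto simp: F'_def)
        show "pderiv (P e) \<noteq> 0" by fact
        fix a b x assume ab: "(a, b) \<in> (\<lambda>Q. (Q e, Q e')) ` F'" and a: "a \<noteq> 0" "poly a x = 0"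
        then obtain Q where Q: "Q \<in> F'" "a = Q e" "b = Q e'" by blast
        have deg: "degree (Q e) = degree (Q e')" "Q e = 0 \<longleftrightarrow> Q e' = 0"
          using same_signs_degree[OF ssC, of d Q] CI[of Q] Q(1) F'(2) by auto
        have "poly (Q e') (h x) = 0" using hG[of Q x] Q a by (auto simp: F'_def sgn_zero_iff)
        moreover have "degree (Q e) \<le> d" using Q(1) F'(2) param_polysD(2) by blast
        then have "(\<lambda>u. reduct d (degree (Q e)) (P u) (Q u)) \<in> ?G"
          using Q(1) unfolding F'_def[symmetric] by (force intro!: image_eqI[of _ _ "(degree (Q e), Q)"])
        from hG[OF this, of x] show "sgn (poly (P e) x) = sgn (poly (P e') (h x))"
          using sgn_reduct_at_root[of "Q e" x] sgn_reduct_at_root[of "Q e'" "h x"] deg Q a calculation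
          by simp
      qed
      then show ?thesis unfolding sign_equiv_def F'_def by auto
    qed
  qed
  ultimately show ?thesis unfolding tame_family_def using Qs by (intro exI[of _ "Qs \<union> C"]) auto
qed

text \<open>
  Induction on the degree \<open>d\<close> and, for fixed \<open>d\<close>, on the number of polynomials of formal degree \<open>d\<close>: each
  of them is traded for its truncation, its derivative and its reducts, which have lower degree.
\<close>
theorem tame_family_param_polys:
  fixes F :: "('z::real_normed_vector \<Rightarrow> real poly) set"
  assumes "finite F" "F \<subseteq> param_polys d"
  shows "tame_family F"
  using assms
proof (induction d arbitrary: F)
  case 0
  define Qs where "Qs = (\<lambda>P e. coeff (P e) 0) ` F"
  have "sign_equiv F e e'" if "same_signs Qs e e'" for e e'
  proof -
    have "sgn (poly (P e) x) = sgn (poly (P e') x)" if P: "P \<in> F" for P x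
    proof -
      have "degree (P u) = 0" for u using P 0 param_polysD(2) by blast
      then have "poly (P u) v = coeff (P u) 0" for u v by (simp add: poly_altdef)
      then show ?thesis using \<open>same_signs Qs e e'\<close> P by (auto simp: same_signs_def Qs_def)
    qed
    then show ?thesis unfolding sign_equiv_def by (intro exI[of _ "\<lambda>x. x"]) (auto simp: strict_mono_def)
  qed
  moreover have "finite Qs" "\<forall>q\<in>Qs. real_polynomial_function q"
    using 0 param_polysD(1) by (auto simp: Qs_def)
  ultimately show ?case unfolding tame_family_def by blast
next
  case (Suc d)
  have "L \<subseteq> param_polys d \<Longrightarrow> finite L \<Longrightarrow> tame_family (T \<union> L)"
    if "finite T" "T \<subseteq> param_polys (Suc d)"
    for T L :: "('z \<Rightarrow> real poly) set"
    using that
  proof (induction T arbitrary: L rule: finite_induct)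
    case empty
    then show ?case using Suc.IH[of L] by simp
  next
    case (insert P T)
    define F' where "F' = insert (\<lambda>e. pderiv (P e)) (T \<union> L)"
    have P: "P \<in> param_polys (Suc d)" using insert.prems by auto
    have L: "L \<subseteq> param_polys (Suc d)" using insert.prems param_polys_mono[of d "Suc d"] by auto
    have p': "(\<lambda>e. pderiv (P e)) \<in> param_polys d" "(\<lambda>e. poly_cutoff (Suc d) (P e)) \<in> param_polys d"
      using param_polys_pderiv[OF P] param_polys_cutoff[OF P] by simp_all
    have F': "finite F'" "F' \<subseteq> param_polys (Suc d)"
      using insert L p' param_polys_mono[of d "Suc d"] by (auto simp: F'_def)
    define R where "R = (\<lambda>(m, Q) e. reduct (Suc d) m (P e) (Q e)) ` ({..Suc d} \<times> F')"
    have R: "finite R" "R \<subseteq> param_polys d"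
      using F' param_polys_reduct[OF P] by (fastforce simp: R_def)+
    have "tame_family (T \<union> ({\<lambda>e. poly_cutoff (Suc d) (P e), \<lambda>e. pderiv (P e)} \<union> L \<union> R))"
      by (rule insert.IH) (use insert.prems R p' in auto)
    also have "T \<union> ({\<lambda>e. poly_cutoff (Suc d) (P e), \<lambda>e. pderiv (P e)} \<union> L \<union> R)
      = insert (\<lambda>e. poly_cutoff (Suc d) (P e)) (insert (\<lambda>e. pderiv (P e)) (T \<union> L) \<union>
        (\<lambda>(m, Q) e. reduct (Suc d) m (P e) (Q e)) ` ({..Suc d} \<times> insert (\<lambda>e. pderiv (P e)) (T \<union> L)))"
      by (auto simp: R_def F'_def)
    finally have "tame_family (insert P (T \<union> L))"
      by (intro tame_family_add[OF _ P]) (use insert L in auto)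
    then show ?case by simp
  qed
  from this[of F "{}"] Suc.prems show ?case by simp
qed

section \<open>Definable predicates and quantifiers\<close>

text \<open>
  Semi-algebraic sets in a form for which the Boolean operations are immediate: membership depends only
  on the signs of finitely many polynomials.
\<close>
definition definable :: "('z::real_normed_vector \<Rightarrow> bool) \<Rightarrow> bool" where
  "definable A \<longleftrightarrow> (\<exists>Qs. finite Qs \<and> (\<forall>q\<in>Qs. real_polynomial_function q) \<and>
     (\<forall>e e'. same_signs Qs e e' \<longrightarrow> A e = A e'))"

lemma polynomial_function_fst: "polynomial_function f \<Longrightarrow> polynomial_function (\<lambda>x. fst (f x))"
  using polynomial_function_compose[OF _ polynomial_function_bounded_linear[OF bounded_linear_fst], of f]
  by (simp add: o_def)

lemma polynomial_function_snd: "polynomial_function f \<Longrightarrow> polynomial_function (\<lambda>x. snd (f x))"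
  using polynomial_function_compose[OF _ polynomial_function_bounded_linear[OF bounded_linear_snd], of f]
  by (simp add: o_def)

lemma polynomial_function_Pair:
  fixes f :: "'a::real_normed_vector \<Rightarrow> 'b::real_normed_vector"
    and g :: "'a \<Rightarrow> 'c::real_normed_vector"
  assumes "polynomial_function f" "polynomial_function g"
  shows "polynomial_function (\<lambda>x. (f x, g x))"
proof -
  have "bounded_linear (\<lambda>u::'b. (u, 0::'c))" "bounded_linear (\<lambda>u::'c. (0::'b, u))"
    by (intro bounded_linear_Pair bounded_linear_ident bounded_linear_zero)+
  from this[THEN polynomial_function_bounded_linear]
  have a: "polynomial_function (\<lambda>x. (f x, 0::'c))" and b: "polynomial_function (\<lambda>x. (0::'b, g x))"
    using polynomial_function_compose[OF assms(1)] polynomial_function_compose[OF assms(2)]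
    by (simp_all add: o_def)
  show ?thesis using polynomial_function_add[OF a b] by simp
qed

lemma real_polynomial_function_inner:
  fixes f g :: "'z::real_normed_vector \<Rightarrow> 'a::euclidean_space"
  assumes "polynomial_function f" "polynomial_function g"
  shows "real_polynomial_function (\<lambda>x. f x \<bullet> g x)"
proof -
  have "real_polynomial_function (\<lambda>x. \<Sum>b\<in>Basis. (f x \<bullet> b) * (g x \<bullet> b))"
  proof (rule real_polynomial_function_sum[OF finite_Basis])
    fix b :: 'a assume "b \<in> Basis"
    then show "real_polynomial_function (\<lambda>x. (f x \<bullet> b) * (g x \<bullet> b))"
      using assms unfolding polynomial_function_iff_Basis_inner
      by (intro real_polynomial_function.intros(4)) auto
  qed
  then show ?thesis by (subst euclidean_inner)
qed

lemma polynomial_function_ident: "polynomial_function (\<lambda>x. x)"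
  using polynomial_function_id by simp

lemmas poly_intros =
  real_polynomial_function.intros(2-4) real_polynomial_function_diff real_polynomial_function_minus
  real_polynomial_function_power real_polynomial_function_inner
  polynomial_function_Pair polynomial_function_fst polynomial_function_snd
  polynomial_function_add polynomial_function_diff polynomial_function_mult polynomial_function_const
  polynomial_function_ident

lemma real_polynomial_functionI: "polynomial_function f \<Longrightarrow> real_polynomial_function f"
  by (simp add: real_polynomial_function_eq)

lemma real_polynomial_function_fst:
  fixes f :: "'z::real_normed_vector \<Rightarrow> real \<times> 'b::real_normed_vector"
  shows "polynomial_function f \<Longrightarrow> real_polynomial_function (\<lambda>x. fst (f x))"
  by (rule real_polynomial_functionI[OF polynomial_function_fst])

lemma real_polynomial_function_snd:
  fixes f :: "'z::real_normed_vector \<Rightarrow> 'b::real_normed_vector \<times> real"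
  shows "polynomial_function f \<Longrightarrow> real_polynomial_function (\<lambda>x. snd (f x))"
  by (rule real_polynomial_functionI[OF polynomial_function_snd])

lemma real_polynomial_function_ident: "real_polynomial_function (\<lambda>x. x)"
  by (rule real_polynomial_functionI[OF polynomial_function_ident])

lemmas term_intros = poly_intros real_polynomial_function_fst real_polynomial_function_snd
  real_polynomial_function_ident

lemma definable_less:
  assumes "real_polynomial_function f" "real_polynomial_function g"
  shows "definable (\<lambda>x. f x < g x)"
  unfolding definable_def
proof (intro exI[of _ "{\<lambda>x. f x - g x}"] conjI ballI allI impI)
  show "real_polynomial_function q" if "q \<in> {\<lambda>x. f x - g x}" for q
    using that real_polynomial_function_diff[OF assms] by simp
  show "(f e < g e) = (f e' < g e')" if "same_signs {\<lambda>x. f x - g x} e e'" for e e'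
    using that by (auto simp: same_signs_def sgn_if split: if_splits)
qed simp

lemma definable_not: "definable A \<Longrightarrow> definable (\<lambda>x. \<not> A x)"
  unfolding definable_def by simp

lemma definable_conj:
  assumes "definable A" "definable B"
  shows "definable (\<lambda>x. A x \<and> B x)"
proof -
  obtain Q R where "finite Q" "\<forall>q\<in>Q. real_polynomial_function q" "finite R" "\<forall>q\<in>R. real_polynomial_function q"
    and *: "\<And>e e'. same_signs Q e e' \<Longrightarrow> A e = A e'" "\<And>e e'. same_signs R e e' \<Longrightarrow> B e = B e'"
    using assms unfolding definable_def by (metis (no_types))
  moreover have "(A e \<and> B e) = (A e' \<and> B e')" if "same_signs (Q \<union> R) e e'" for e e'
    using *[of e e'] that unfolding same_signs_def by blast
  ultimately show ?thesis unfolding definable_def by (intro exI[of _ "Q \<union> R"]) blast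
qed

lemma definable_imp: "definable A \<Longrightarrow> definable B \<Longrightarrow> definable (\<lambda>x. A x \<longrightarrow> B x)"
  using definable_not[OF definable_conj[of A, OF _ definable_not[of B]]] by simp

lemma definable_le:
  "real_polynomial_function f \<Longrightarrow> real_polynomial_function g \<Longrightarrow> definable (\<lambda>x. f x \<le> g x)"
  using definable_not[OF definable_less[of g f]] by (simp add: not_less)

lemma definable_eq:
  assumes "real_polynomial_function f" "real_polynomial_function g"
  shows "definable (\<lambda>x. f x = g x)"
  using definable_conj[OF definable_le[OF assms] definable_le[OF assms(2,1)]]
  by (simp add: order_eq_iff)

lemma definable_compose:
  assumes "definable A" "polynomial_function g"
  shows "definable (\<lambda>x. A (g x))"
proof -
  obtain Q where Q: "finite Q" "\<forall>q\<in>Q. real_polynomial_function q"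
    and *: "\<And>e e'. same_signs Q e e' \<Longrightarrow> A e = A e'"
    using assms unfolding definable_def by blast
  have "\<forall>q\<in>(\<lambda>q. q \<circ> g) ` Q. real_polynomial_function q"
    using Q real_polynomial_function_compose[OF assms(2)] by auto
  moreover have "A (g e) = A (g e')" if "same_signs ((\<lambda>q. q \<circ> g) ` Q) e e'" for e e'
    using *[of "g e" "g e'"] that by (auto simp: same_signs_def)
  ultimately show ?thesis using Q(1) unfolding definable_def by (intro exI[of _ "(\<lambda>q. q \<circ> g) ` Q"]) auto
qed

lemma param_polys_add:
  assumes "P \<in> param_polys d" "Q \<in> param_polys d"
  shows "(\<lambda>e. P e + Q e) \<in> param_polys d"
  using assms unfolding param_polys_def
  by (simp add: degree_add_le) (intro allI real_polynomial_function.intros(3); simp)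

lemma param_polys_mult:
  assumes "P \<in> param_polys d" "Q \<in> param_polys d'"
  shows "(\<lambda>e. P e * Q e) \<in> param_polys (d + d')"
proof -
  have "real_polynomial_function (\<lambda>e. coeff (P e * Q e) k)" for k
    unfolding coeff_mult
    by (rule real_polynomial_function_sum)
       (auto intro!: real_polynomial_function.intros(4) param_polysD(1)[OF assms(1)] param_polysD(1)[OF assms(2)])
  then show ?thesis using assms by (auto simp: param_polys_def intro!: degree_mult_le[THEN order_trans] add_mono)
qed

lemma real_polynomial_function_last_variable:
  fixes p :: "'z::real_normed_vector \<times> real \<Rightarrow> real"
  assumes "real_polynomial_function p"
  shows "\<exists>d. \<exists>P\<in>param_polys d. \<forall>e v. poly (P e) v = p (e, v)"
  using assms
proof (induction p)
  case (linear f)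
  interpret bounded_linear f by fact
  have f: "f (e, v) = f (e, 0) + v * f (0, 1)" for e v
    using add[of "(e, 0)" "v *\<^sub>R (0, 1)"] scaleR[of v "(0, 1)"] by simp
  have "real_polynomial_function (\<lambda>e. f (e, 0))"
    by (intro real_polynomial_function.intros(1) bounded_linear_compose[OF \<open>bounded_linear f\<close>] bounded_linear_Pair
        bounded_linear_ident bounded_linear_zero)
  then have "real_polynomial_function (\<lambda>e. coeff [:f (e, 0), f (0, 1):] k)" for k
  proof (cases k)
    case (Suc j)
    then show ?thesis using real_polynomial_function.intros(2) by (cases j) simp_all
  qed simp
  then have "(\<lambda>e. [:f (e, 0), f (0, 1):]) \<in> param_polys 1"
    by (simp add: param_polys_def)
  moreover have "\<forall>e v. poly [:f (e, 0), f (0, 1):] v = f (e, v)" by (simp add: f[symmetric])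
  ultimately show ?case by (intro exI[of _ 1] bexI[of _ "\<lambda>e. [:f (e, 0), f (0, 1):]"])
next
  case (const c)
  have "(\<lambda>e. [:c:]) \<in> param_polys 0"
    by (auto simp: param_polys_def intro!: real_polynomial_function.intros(2))
  moreover have "\<forall>e v. poly [:c:] v = c" by simp
  ultimately show ?case by (intro exI[of _ 0] bexI[of _ "\<lambda>e. [:c:]"])
next
  case (add f g)
  then obtain d d' P Q where "P \<in> param_polys d" "Q \<in> param_polys d'"
    and e: "\<forall>e v. poly (P e) v = f (e, v)" "\<forall>e v. poly (Q e) v = g (e, v)" by blast
  then have "(\<lambda>e. P e + Q e) \<in> param_polys (max d d')"
    by (intro param_polys_add) (auto intro: param_polys_mono[rotated])
  then show ?case using e by (intro exI[of _ "max d d'"] bexI) auto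
next
  case (mult f g)
  then obtain d d' P Q where "P \<in> param_polys d" "Q \<in> param_polys d'"
    and e: "\<forall>e v. poly (P e) v = f (e, v)" "\<forall>e v. poly (Q e) v = g (e, v)" by blast
  then have "(\<lambda>e. P e * Q e) \<in> param_polys (d + d')" by (intro param_polys_mult)
  then show ?case using e by (intro exI[of _ "d + d'"] bexI) auto
qed

text \<open>
  Tarski-Seidenberg for one real variable. At parameters with the same signs on the test functions, the
  order isomorphism of the arrangements transports a witness \<open>v\<close> to a witness \<open>h v\<close>.
\<close>
lemma definable_ex_real:
  fixes A :: "'z::real_normed_vector \<times> real \<Rightarrow> bool"
  assumes "definable A"
  shows "definable (\<lambda>x. \<exists>v. A (x, v))"
proof -
  obtain Q where Q: "finite Q" "\<forall>q\<in>Q. real_polynomial_function q"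
    and A: "\<And>e e'. same_signs Q e e' \<Longrightarrow> A e = A e'"
    using assms unfolding definable_def by blast
  have "\<forall>q\<in>Q. \<exists>d P. P \<in> param_polys d \<and> (\<forall>e v. poly (P e) v = q (e, v))"
    using Q(2) real_polynomial_function_last_variable by blast
  then obtain D P where P: "\<And>q. q \<in> Q \<Longrightarrow> P q \<in> param_polys (D q)"
    "\<And>q e v. q \<in> Q \<Longrightarrow> poly (P q e) v = q (e, v)" by metis
  have "P ` Q \<subseteq> param_polys (Max (D ` Q))"
    using P(1) Q(1) by (auto intro!: param_polys_mono[OF Max_ge])
  then have "tame_family (P ` Q)" using Q(1) by (intro tame_family_param_polys) auto
  then obtain R where R: "finite R" "\<forall>q\<in>R. real_polynomial_function q"
    and eq: "\<And>e e'. same_signs R e e' \<Longrightarrow> sign_equiv (P ` Q) e e'"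
    unfolding tame_family_def by blast
  have imp: "\<exists>v. A (e', v)" if ss: "same_signs R e e'" and v: "A (e, v)" for e e' v
  proof -
    obtain h where h: "\<And>q x. q \<in> Q \<Longrightarrow> sgn (poly (P q e) x) = sgn (poly (P q e') (h x))"
      using eq[OF ss] unfolding sign_equiv_def by auto
    have "same_signs Q (e, v) (e', h v)" using h P(2) by (simp add: same_signs_def)
    then show ?thesis using A v by blast
  qed
  moreover have "same_signs R e' e" if "same_signs R e e'" for e e' using that by (simp add: same_signs_def)
  ultimately show ?thesis unfolding definable_def using R by (intro exI[of _ R]) blast
qed

text \<open>
  The vector is split off one coordinate direction at a time; this is why the induction is over the
  span of a growing set of basis vectors, with a base point \<open>w\<close>.
\<close>
lemma definable_ex_pair:
  fixes A :: "'z::real_normed_vector \<times> 'a::euclidean_space \<Rightarrow> bool"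
  assumes A: "definable A"
  shows "definable (\<lambda>x. \<exists>v. A (x, v))"
proof -
  have "definable (\<lambda>(x, w). \<exists>v\<in>span B. A (x, w + v))" if "finite B" for B
    using that
  proof (induction B rule: finite_induct)
    case empty
    then show ?case using A by (simp add: case_prod_unfold)
  next
    case (insert b B)
    have "definable (\<lambda>y. case (fst (fst y), snd (fst y) + snd y *\<^sub>R b) of (x, w) \<Rightarrow> \<exists>v\<in>span B. A (x, w + v))"
      by (rule definable_compose[OF insert.IH]) (intro poly_intros)
    from definable_ex_real[OF this]
    have "definable (\<lambda>(x, w). \<exists>r. \<exists>v\<in>span B. A (x, w + r *\<^sub>R b + v))"
      by (simp add: case_prod_unfold)
    moreover have "(\<exists>v\<in>span (insert b B). A (x, w + v)) \<longleftrightarrow> (\<exists>r. \<exists>v\<in>span B. A (x, w + r *\<^sub>R b + v))" for x w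
    proof
      assume "\<exists>v\<in>span (insert b B). A (x, w + v)"
      then obtain v r where "v - r *\<^sub>R b \<in> span B" "A (x, w + v)" by (auto simp: span_insert)
      then show "\<exists>r. \<exists>v\<in>span B. A (x, w + r *\<^sub>R b + v)"
        by (intro exI[of _ r] bexI[of _ "v - r *\<^sub>R b"]) auto
    next
      assume "\<exists>r. \<exists>v\<in>span B. A (x, w + r *\<^sub>R b + v)"
      then obtain v r where "v \<in> span B" "A (x, w + (r *\<^sub>R b + v))" by (auto simp: add.assoc)
      moreover from this have "r *\<^sub>R b + v \<in> span (insert b B)" by (auto simp: span_insert intro!: exI[of _ r])
      ultimately show "\<exists>v\<in>span (insert b B). A (x, w + v)" by blast
    qed
    ultimately show ?case by simp
  qed
  from this[of Basis] have "definable (\<lambda>(x, w::'a). \<exists>v. A (x, w + v))" by simp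
  from definable_compose[OF this, of "\<lambda>x. (x, 0)"]
  show ?thesis by (simp add: polynomial_function_Pair polynomial_function_ident polynomial_function_const)
qed

lemma definable_ex:
  fixes A :: "'z::real_normed_vector \<Rightarrow> 'a::euclidean_space \<Rightarrow> bool"
  assumes "definable (\<lambda>p. A (fst p) (snd p))"
  shows "definable (\<lambda>x. \<exists>v. A x v)"
  using definable_ex_pair[OF assms] by simp

lemma definable_all:
  fixes A :: "'z::real_normed_vector \<Rightarrow> 'a::euclidean_space \<Rightarrow> bool"
  assumes "definable (\<lambda>p. A (fst p) (snd p))"
  shows "definable (\<lambda>x. \<forall>v. A x v)"
  using definable_not[OF definable_ex[of "\<lambda>x v. \<not> A x v"]] definable_not[OF assms] by simp

lemmas definable_intros = definable_conj definable_imp definable_not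
  definable_ex definable_all definable_less definable_le definable_eq

lemma definable_semialgebraic:
  assumes "semialgebraic S"
  shows "definable (\<lambda>x. x \<in> S)"
proof -
  obtain F where *: "finite F \<and> (\<forall>C\<in>F. finite C \<and>
       (\<forall>(p, q)\<in>C. real_polynomial_function p \<and> real_polynomial_function q)) \<and>
       S = (\<Union>C\<in>F. \<Inter>(p, q)\<in>C. {u. p u = 0 \<and> q u < 0})"
    using assms unfolding semialgebraic_def by (rule exE)
  then have F: "finite F" "\<And>C. C \<in> F \<Longrightarrow> finite C"
    and S: "S = (\<Union>C\<in>F. \<Inter>(p, q)\<in>C. {u. p u = 0 \<and> q u < 0})" by simp_all
  have rpf: "real_polynomial_function p \<and> real_polynomial_function q" if "C \<in> F" "(p, q) \<in> C" for C p q
    using * that by (metis (no_types, lifting) case_prodD)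
  define Q where "Q = fst ` (\<Union>F) \<union> snd ` (\<Union>F)"
  have "e' \<in> S" if "same_signs Q e e'" "e \<in> S" for e e'
  proof -
    obtain C where C: "C \<in> F" "\<And>p q. (p, q) \<in> C \<Longrightarrow> p e = 0 \<and> q e < 0" using \<open>e \<in> S\<close> by (auto simp: S)
    have "p e' = 0 \<and> q e' < 0" if pq: "(p, q) \<in> C" for p q
    proof -
      have "p \<in> Q" "q \<in> Q" using pq C(1) by (force simp: Q_def)+
      then have "sgn (p e) = sgn (p e')" "sgn (q e) = sgn (q e')"
        using \<open>same_signs Q e e'\<close> by (auto simp: same_signs_def)
      then show ?thesis using C(2)[OF pq] by (auto simp: sgn_if split: if_splits)
    qed
    then show ?thesis using C(1) by (auto simp: S)
  qed
  moreover have "same_signs Q e' e" if "same_signs Q e e'" for e e' using that by (simp add: same_signs_def)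
  moreover have "finite Q" "\<forall>q\<in>Q. real_polynomial_function q"
    using F rpf by (fastforce simp: Q_def)+
  ultimately show ?thesis unfolding definable_def by (intro exI[of _ Q]) blast
qed

section \<open>Definable functions of one variable: variation\<close>

lemma real_polynomial_function_as_poly:
  fixes q :: "real \<Rightarrow> real"
  assumes "real_polynomial_function q"
  shows "\<exists>p. \<forall>x. q x = poly p x"
proof -
  obtain a n where "q = (\<lambda>x. \<Sum>i\<le>n. a i * x ^ i)"
    using assms real_polynomial_function_iff_sum by blast
  then have "q x = poly (\<Sum>i\<le>n. monom (a i) i) x" for x by (simp add: poly_sum poly_monom)
  then show ?thesis by blast
qed

text \<open>
  To the right of \<open>0\<close> and before the first positive root, all nonzero polynomials involved have constant
  sign.
\<close>
lemma definable_germ: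
  fixes A :: "real \<Rightarrow> bool"
  assumes "definable A"
  shows "\<exists>\<eta>>0. (\<forall>t. 0 < t \<and> t < \<eta> \<longrightarrow> A t) \<or> (\<forall>t. 0 < t \<and> t < \<eta> \<longrightarrow> \<not> A t)"
proof -
  obtain Q where Q: "finite Q" "\<forall>q\<in>Q. real_polynomial_function q"
    and A: "\<And>e e'. same_signs Q e e' \<Longrightarrow> A e = A e'"
    using assms unfolding definable_def by blast
  have "\<forall>q\<in>Q. \<exists>p. \<forall>x. q x = poly p x"
    using Q(2) real_polynomial_function_as_poly by blast
  then obtain P where P: "\<And>q x. q \<in> Q \<Longrightarrow> q x = poly (P q) x" by metis
  define Z where "Z = (\<Union>q\<in>{q\<in>Q. P q \<noteq> 0}. {x. poly (P q) x = 0})"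
  have "finite Z" using Q(1) by (auto simp: Z_def poly_roots_finite)
  define \<eta> where "\<eta> = Min (insert 1 {z\<in>Z. z > 0})"
  have "\<eta> > 0" using \<open>finite Z\<close> by (simp add: \<eta>_def)
  have noZ: "z \<notin> Z" if "0 < z" "z < \<eta>" for z
    using that \<open>finite Z\<close> by (auto simp: \<eta>_def)
  have "same_signs Q s t" if "0 < s" "s < \<eta>" "0 < t" "t < \<eta>" for s t
    unfolding same_signs_def
  proof
    fix q assume q: "q \<in> Q"
    show "sgn (q s) = sgn (q t)"
    proof (cases "P q = 0")
      case False
      have "sgn (poly (P q) s) = sgn (poly (P q) t)"
      proof (rule poly_sgn_const_on_segment)
        fix w assume "w \<in> closed_segment s t"
        then have "w \<notin> Z" using that noZ by (auto simp: closed_segment_eq_real_ivl split: if_splits)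
        then show "poly (P q) w \<noteq> 0" using q False by (auto simp: Z_def)
      qed
      then show ?thesis using P[OF q] by simp
    qed (simp add: P[OF q])
  qed
  then have "A s = A t" if "0 < s" "s < \<eta>" "0 < t" "t < \<eta>" for s t using A that by blast
  then show ?thesis using \<open>\<eta> > 0\<close> by blast
qed

text \<open>
  Uniform finiteness: for fixed \<open>c\<close>, the truth value changes between \<open>t j\<close> and \<open>t (Suc j)\<close> only if one of
  finitely many nonzero polynomials of bounded degree in \<open>t\<close> has a root between them, and a root can
  serve at most two neighbouring intervals.
\<close>
lemma definable_crossings:
  fixes B :: "real \<times> real \<Rightarrow> bool"
  assumes "definable B"
  shows "\<exists>D. \<forall>c N t. strict_mono t \<longrightarrow> card {j. j < N \<and> B (c, t j) \<noteq> B (c, t (Suc j))} \<le> (D::nat)"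
proof -
  obtain Q where Q: "finite Q" "\<forall>q\<in>Q. real_polynomial_function q"
    and B: "\<And>e e'. same_signs Q e e' \<Longrightarrow> B e = B e'"
    using assms unfolding definable_def by blast
  have "\<forall>q\<in>Q. \<exists>d P. P \<in> param_polys d \<and> (\<forall>e v. poly (P e) v = q (e, v))"
    using Q(2) real_polynomial_function_last_variable by blast
  then obtain d P where P: "\<And>q. q \<in> Q \<Longrightarrow> P q \<in> param_polys (d q)"
    "\<And>q e v. q \<in> Q \<Longrightarrow> poly (P q e) v = q (e, v)" by metis
  have "card {j. j < N \<and> B (c, t j) \<noteq> B (c, t (Suc j))} \<le> 2 * (\<Sum>q\<in>Q. d q)"
    if inc: "strict_mono t" for c N and t :: "nat \<Rightarrow> real"
  proof -
    define Z where "Z = (\<Union>q\<in>{q\<in>Q. P q c \<noteq> 0}. {x. poly (P q c) x = 0})"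
    have finZ: "finite Z" using Q(1) by (auto simp: Z_def poly_roots_finite)
    have "card Z \<le> (\<Sum>q\<in>{q\<in>Q. P q c \<noteq> 0}. card {x. poly (P q c) x = 0})"
      unfolding Z_def using Q(1) by (intro card_UN_le) auto
    also have "\<dots> \<le> (\<Sum>q\<in>{q\<in>Q. P q c \<noteq> 0}. d q)"
    proof (rule sum_mono)
      fix q assume "q \<in> {q\<in>Q. P q c \<noteq> 0}"
      then have "card {x. poly (P q c) x = 0} \<le> degree (P q c)" "degree (P q c) \<le> d q"
        using card_poly_roots_bound param_polysD(2)[OF P(1)] by auto
      then show "card {x. poly (P q c) x = 0} \<le> d q" by simp
    qed
    also have "\<dots> \<le> (\<Sum>q\<in>Q. d q)" using Q(1) by (intro sum_mono2) auto
    finally have cardZ: "card Z \<le> (\<Sum>q\<in>Q. d q)" .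
    define J where "J z = {j. j < N \<and> t j \<le> z \<and> z \<le> t (Suc j)}" for z
    have J2: "card (J z) \<le> 2" for z
    proof (cases "J z = {}")
      case False
      define m where "m = (LEAST j. j \<in> J z)"
      have m: "m \<in> J z" using False unfolding m_def by (metis LeastI ex_in_conv)
      have "J z \<subseteq> {m, Suc m}"
      proof
        fix j assume j: "j \<in> J z"
        have "m \<le> j" unfolding m_def using j by (rule Least_le)
        moreover have "j \<le> Suc m"
        proof (rule ccontr)
          assume "\<not> j \<le> Suc m"
          then have "t (Suc m) < t j" using inc by (simp add: strict_mono_less)
          then show False using m j by (simp add: J_def)
        qed
        ultimately show "j \<in> {m, Suc m}" by auto
      qed
      then have "card (J z) \<le> card {m, Suc m}" by (intro card_mono) auto
      then show ?thesis by simp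
    qed simp
    have "{j. j < N \<and> B (c, t j) \<noteq> B (c, t (Suc j))} \<subseteq> (\<Union>z\<in>Z. J z)"
    proof
      fix j assume j: "j \<in> {j. j < N \<and> B (c, t j) \<noteq> B (c, t (Suc j))}"
      then have "\<not> same_signs Q (c, t j) (c, t (Suc j))" using B by blast
      then obtain q where q: "q \<in> Q" "sgn (poly (P q c) (t j)) \<noteq> sgn (poly (P q c) (t (Suc j)))"
        using P(2) by (auto simp: same_signs_def)
      then obtain z where "z \<in> closed_segment (t j) (t (Suc j))" "poly (P q c) z = 0"
        using poly_sgn_const_on_segment by blast
      moreover have "P q c \<noteq> 0" using q(2) by auto
      moreover have "t j < t (Suc j)" using inc by (simp add: strict_mono_less)
      ultimately show "j \<in> (\<Union>z\<in>Z. J z)" using q(1) j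
        by (auto simp: Z_def J_def closed_segment_eq_real_ivl)
    qed
    then have "card {j. j < N \<and> B (c, t j) \<noteq> B (c, t (Suc j))} \<le> card (\<Union>z\<in>Z. J z)"
      by (intro card_mono) (auto simp: finZ J_def)
    also have "\<dots> \<le> (\<Sum>z\<in>Z. card (J z))" using finZ by (rule card_UN_le)
    also have "\<dots> \<le> (\<Sum>z\<in>Z. 2)" by (rule sum_mono) (rule J2)
    also have "\<dots> \<le> 2 * (\<Sum>q\<in>Q. d q)" using cardZ by simp
    finally show ?thesis .
  qed
  then show ?thesis by blast
qed

definition definable_on :: "real \<Rightarrow> (real \<Rightarrow> real) \<Rightarrow> bool" where
  "definable_on \<eta> h \<longleftrightarrow> definable (\<lambda>p::real \<times> real. 0 < fst p \<and> fst p < \<eta> \<and> snd p = h (fst p))"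

lemma definable_on_ex:
  fixes A :: "real \<Rightarrow> 'z::real_normed_vector \<Rightarrow> real \<Rightarrow> bool"
  assumes h: "definable_on \<eta> h" and A: "definable (\<lambda>p. A (fst (fst p)) (snd (fst p)) (snd p))"
  shows "definable (\<lambda>p. 0 < fst p \<and> fst p < \<eta> \<and> A (fst p) (snd p) (h (fst p)))"
proof -
  have "definable (\<lambda>p. \<exists>s. (0 < fst p \<and> fst p < \<eta> \<and> s = h (fst p)) \<and> A (fst p) (snd p) s)"
  proof (rule definable_ex, rule definable_conj)
    show "definable (\<lambda>p::(real \<times> 'z) \<times> real. 0 < fst (fst p) \<and> fst (fst p) < \<eta> \<and> snd p = h (fst (fst p)))"
      using definable_compose[OF h[unfolded definable_on_def], of "\<lambda>p::(real \<times> 'z) \<times> real. (fst (fst p), snd p)"]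
      by (simp add: poly_intros)
  qed (rule A)
  then show ?thesis by (rule back_subst[of definable]) auto
qed

lemma definable_on_germ:
  fixes A :: "real \<Rightarrow> real \<Rightarrow> bool"
  assumes h: "definable_on \<eta> h" "\<eta> > 0" and A: "definable (\<lambda>p. A (fst p) (snd p))"
  shows "(\<forall>\<^sub>F t in at_right 0. A t (h t)) \<or> (\<forall>\<^sub>F t in at_right 0. \<not> A t (h t))"
proof -
  have "definable (\<lambda>t. \<exists>s. (0 < t \<and> t < \<eta> \<and> s = h t) \<and> A t s)"
    by (rule definable_ex, rule definable_conj) (use h A in \<open>simp_all add: definable_on_def\<close>)
  from definable_germ[OF this] obtain e where e: "e > 0"
    "(\<forall>t. 0 < t \<and> t < e \<longrightarrow> (t < \<eta> \<and> A t (h t))) \<or> (\<forall>t. 0 < t \<and> t < e \<longrightarrow> \<not> (t < \<eta> \<and> A t (h t)))"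
    by auto
  then show ?thesis
  proof (elim disjE)
    assume "\<forall>t. 0 < t \<and> t < e \<longrightarrow> (t < \<eta> \<and> A t (h t))"
    then have "\<forall>\<^sub>F t in at_right 0. A t (h t)"
      using e(1) unfolding eventually_at_right_field by (intro exI[of _ e]) auto
    then show ?thesis ..
  next
    assume *: "\<forall>t. 0 < t \<and> t < e \<longrightarrow> \<not> (t < \<eta> \<and> A t (h t))"
    have "\<forall>\<^sub>F t in at_right 0. \<not> A t (h t)"
      using e(1) h(2) * unfolding eventually_at_right_field by (intro exI[of _ "min e \<eta>"]) auto
    then show ?thesis ..
  qed
qed

text \<open>
  A discrete form of Banach's indicatrix formula: \<open>\<bar>h (t (Suc j)) - h (t j)\<bar>\<close> is the measure of the levels \<open>c\<close>
  separating the two values, and every level separates at most \<open>D\<close> of these pairs.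
\<close>
lemma definable_on_variation:
  assumes h: "definable_on \<eta> h"
  shows "\<exists>D. \<forall>N t a b. (\<forall>j\<le>N. 0 < t j \<and> t j < \<eta> \<and> h (t j) \<in> {a..b}) \<longrightarrow> strict_mono t \<longrightarrow>
     (\<Sum>j<N. \<bar>h (t (Suc j)) - h (t j)\<bar>) \<le> real D * (b - a)"
proof -
  have "definable (\<lambda>p::real \<times> real. 0 < fst p \<and> fst p < \<eta> \<and> h (fst p) \<le> snd p)"
    by (rule definable_on_ex[OF h]) (intro definable_le real_polynomial_functionI poly_intros)
  from definable_compose[OF this, of "\<lambda>p. (snd p, fst p)"]
  have "definable (\<lambda>p::real \<times> real. 0 < snd p \<and> snd p < \<eta> \<and> h (snd p) \<le> fst p)"
    by (simp add: poly_intros)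
  from definable_crossings[OF this] obtain D where
    D: "\<And>c N t. strict_mono t \<Longrightarrow> card {j. j < N \<and> (0 < t j \<and> t j < \<eta> \<and> h (t j) \<le> c) \<noteq>
         (0 < t (Suc j) \<and> t (Suc j) < \<eta> \<and> h (t (Suc j)) \<le> c)} \<le> D" by auto
  have "(\<Sum>j<N. \<bar>h (t (Suc j)) - h (t j)\<bar>) \<le> real D * (b - a)"
    if t: "\<forall>j\<le>N. 0 < t j \<and> t j < \<eta> \<and> h (t j) \<in> {a..b}" and inc: "strict_mono t" for N t a b
  proof -
    have ab: "a \<le> b" using t by force
    define I where "I j = {min (h (t j)) (h (t (Suc j))) ..< max (h (t j)) (h (t (Suc j)))}" for j
    have int: "integrable lborel (indicator (I j) :: real \<Rightarrow> real)" for j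
      by (rule integrable_real_indicator) (auto simp: I_def min_def max_def)
    have "(\<Sum>j<N. \<bar>h (t (Suc j)) - h (t j)\<bar>) = (\<Sum>j<N. integral\<^sup>L lborel (indicator (I j)))"
    proof (rule sum.cong[OF refl])
      fix j
      have "integral\<^sup>L lborel (indicator (I j)) = measure lborel (I j)" by simp
      also have "\<dots> = \<bar>h (t (Suc j)) - h (t j)\<bar>" by (auto simp: I_def min_def max_def)
      finally show "\<bar>h (t (Suc j)) - h (t j)\<bar> = integral\<^sup>L lborel (indicator (I j))" by simp
    qed
    also have "\<dots> = integral\<^sup>L lborel (\<lambda>c. \<Sum>j<N. indicator (I j) c)"
      by (rule Bochner_Integration.integral_sum[symmetric]) (rule int)
    also have "\<dots> \<le> integral\<^sup>L lborel (\<lambda>c. real D * indicator {a..b} c)"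
    proof (rule integral_mono)
      show "integrable lborel (\<lambda>c. \<Sum>j<N. indicator (I j) c :: real)"
        by (intro Bochner_Integration.integrable_sum int)
      show "integrable lborel (\<lambda>c. real D * indicator {a..b} c)"
        using ab by (intro integrable_mult_right integrable_real_indicator) auto
      show "(\<Sum>j<N. indicator (I j) c :: real) \<le> real D * indicator {a..b} c" for c
      proof (cases "c \<in> {a..b}")
        case True
        have "(\<Sum>j<N. indicator (I j) c :: real) = real (card {j. j < N \<and> c \<in> I j})"
        proof -
          have "(\<Sum>j<N. indicator (I j) c :: real) = (\<Sum>j\<in>{j. j < N \<and> c \<in> I j}. 1)"
            by (rule sum.mono_neutral_cong_right) (auto simp: indicator_def)
          then show ?thesis by simp
        qed
        also have "{j. j < N \<and> c \<in> I j} = {j. j < N \<and> (0 < t j \<and> t j < \<eta> \<and> h (t j) \<le> c) \<noteq>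
            (0 < t (Suc j) \<and> t (Suc j) < \<eta> \<and> h (t (Suc j)) \<le> c)}"
          using t by (auto simp: I_def)
        also have "real (card \<dots>) \<le> real D" using D[OF inc] by simp
        finally show ?thesis using True by simp
      next
        case False
        have "c \<notin> I j" if "j < N" for j
        proof -
          have "h (t j) \<in> {a..b}" "h (t (Suc j)) \<in> {a..b}" using t that by auto
          then show ?thesis using False by (auto simp: I_def min_def max_def split: if_splits)
        qed
        then show ?thesis using False by simp
      qed
    qed
    also have "\<dots> = real D * (b - a)" using ab by simp
    finally show ?thesis .
  qed
  then show ?thesis by blast
qed

section \<open>Definable functions of one variable: behaviour at the end point\<close>

text \<open>
  By compactness the values have a cluster point \<open>l\<close>. The condition that \<open>h s\<close> lies within \<open>e\<close> of \<open>l\<close>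
  cannot fail for all small \<open>s\<close>, so it holds for all small \<open>s\<close>.
\<close>
lemma definable_on_limit:
  assumes h: "definable_on \<eta> h" "\<eta> > 0" and bnd: "\<And>t. 0 < t \<Longrightarrow> t < \<eta> \<Longrightarrow> \<bar>h t\<bar> \<le> B"
  shows "\<exists>l. (h \<longlongrightarrow> l) (at_right 0)"
proof -
  define F where "F = filtermap h (at_right 0)"
  have "F \<noteq> bot" by (simp add: F_def filtermap_bot_iff)
  moreover have "\<forall>\<^sub>F y in F. y \<in> {-B..B}"
    unfolding F_def eventually_filtermap eventually_at_right_field
    using h(2) bnd by (intro exI[of _ \<eta>]) (auto simp: abs_le_iff minus_le_iff)
  ultimately obtain l where l: "inf (nhds l) F \<noteq> bot"
    using compact_Icc[of "-B" B] unfolding compact_filter by blast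
  have "\<forall>\<^sub>F s in at_right 0. dist (h s) l < e" if "e > 0" for e
  proof -
    have "definable (\<lambda>p::real \<times> real. l - e < snd p \<and> snd p < l + e)"
      by (intro definable_intros real_polynomial_functionI poly_intros)
    from definable_on_germ[OF h this]
    show ?thesis
    proof
      assume "\<forall>\<^sub>F s in at_right 0. l - e < h s \<and> h s < l + e"
      then show ?thesis by eventually_elim (auto simp: dist_real_def)
    next
      assume "\<forall>\<^sub>F s in at_right 0. \<not> (l - e < h s \<and> h s < l + e)"
      then have "\<forall>\<^sub>F y in F. \<not> (l - e < y \<and> y < l + e)" by (simp add: F_def eventually_filtermap)
      moreover have "\<forall>\<^sub>F y in nhds l. l - e < y \<and> y < l + e"
        using eventually_nhds_in_open[of "{l - e<..<l + e}" l] that by simp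
      ultimately have "\<forall>\<^sub>F y in inf (nhds l) F. False" unfolding eventually_inf by blast
      then have False using l by (simp add: trivial_limit_def)
      then show ?thesis by simp
    qed
  qed
  then have "(h \<longlongrightarrow> l) (at_right 0)" by (rule tendstoI)
  then show ?thesis ..
qed

text \<open>
  A point of the graph is isolated on its vertical line, so one of the defining polynomials that do not
  vanish identically on this line is zero there. By \<open>definable_on_germ\<close> one polynomial serves all small
  \<open>t\<close>.
\<close>
lemma definable_on_algebraic:
  assumes h: "definable_on \<eta> h" "\<eta> > 0"
  shows "\<exists>d. \<exists>P\<in>param_polys d. \<forall>\<^sub>F t in at_right 0. P t \<noteq> 0 \<and> poly (P t) (h t) = 0"
proof -
  obtain Q where Q: "finite Q" "\<And>q. q \<in> Q \<Longrightarrow> real_polynomial_function q"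
    and G: "\<And>e e'. same_signs Q e e' \<Longrightarrow> (0 < fst e \<and> fst e < \<eta> \<and> snd e = h (fst e)) =
       (0 < fst e' \<and> fst e' < \<eta> \<and> snd e' = h (fst e'))"
    using h(1) unfolding definable_on_def definable_def by blast
  have "\<forall>q\<in>Q. \<exists>d P. P \<in> param_polys d \<and> (\<forall>e v. poly (P e) v = q (e, v))"
    using Q(2) real_polynomial_function_last_variable by blast
  then obtain d P where P: "\<And>q. q \<in> Q \<Longrightarrow> P q \<in> param_polys (d q)"
    "\<And>q e v. q \<in> Q \<Longrightarrow> poly (P q e) v = q (e, v)" by metis
  define A where "A q t s \<longleftrightarrow> (\<exists>v. poly (P q t) v \<noteq> 0) \<and> poly (P q t) s = 0" for q t and s :: real
  have A: "definable (\<lambda>p. A q (fst p) (snd p))" if q: "q \<in> Q" for q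
  proof -
    have rp: "real_polynomial_function (\<lambda>x. q (f x, g x))" if "polynomial_function f" "polynomial_function g"
      for f g :: "'z::real_normed_vector \<Rightarrow> real"
      using real_polynomial_function_compose[OF polynomial_function_Pair[OF that] Q(2)[OF q]] by (simp add: o_def)
    show ?thesis unfolding A_def P(2)[OF q] by (intro definable_intros rp poly_intros)
  qed
  have "\<exists>q\<in>Q. \<not> (\<forall>\<^sub>F t in at_right 0. \<not> A q t (h t))"
  proof (rule ccontr)
    assume "\<not> ?thesis"
    then have "\<forall>\<^sub>F t in at_right 0. \<forall>q\<in>Q. \<not> A q t (h t)"
      using Q(1) by (intro eventually_ball_finite) auto
    moreover have "\<forall>\<^sub>F t in at_right 0. 0 < t \<and> t < \<eta>"
      using h(2) unfolding eventually_at_right_field by blast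
    ultimately have "\<forall>\<^sub>F t in at_right 0. 0 < t \<and> t < \<eta> \<and> (\<forall>q\<in>Q. \<not> A q t (h t))"
      by eventually_elim simp
    then have "\<exists>t. 0 < t \<and> t < \<eta> \<and> (\<forall>q\<in>Q. \<not> A q t (h t))"
      by (rule eventually_happens'[rotated]) simp
    then obtain t where t: "0 < t" "t < \<eta>" "\<And>q. q \<in> Q \<Longrightarrow> \<not> A q t (h t)" by blast
    \<comment> \<open>No polynomial that is not identically zero in \<open>s\<close> vanishes at \<open>h t\<close>, so the signs are
       the same at all neighbouring values of \<open>s\<close>.\<close>
    have "\<forall>\<^sub>F s in at (h t). sgn (q (t, s)) = sgn (q (t, h t))" if q: "q \<in> Q" for q
    proof (cases "\<exists>v. poly (P q t) v \<noteq> 0")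
      case True
      then have nz: "poly (P q t) (h t) \<noteq> 0" using t(3)[OF q] by (auto simp: A_def)
      have lim: "(poly (P q t) \<longlongrightarrow> poly (P q t) (h t)) (at (h t))"
        by (intro tendsto_intros)
      have "\<forall>\<^sub>F s in at (h t). sgn (poly (P q t) s) = sgn (poly (P q t) (h t))"
      proof (cases "poly (P q t) (h t) > 0")
        case True
        then show ?thesis using order_tendstoD(1)[OF lim True] by (auto elim!: eventually_mono)
      next
        case False
        then have "poly (P q t) (h t) < 0" using nz by simp
        then show ?thesis using order_tendstoD(2)[OF lim, of 0] by (auto elim!: eventually_mono)
      qed
      then show ?thesis by (simp add: P(2)[OF q])
    next
      case False
      then show ?thesis using P(2)[OF q] by simp
    qed
    then have "\<forall>\<^sub>F s in at (h t). \<forall>q\<in>Q. sgn (q (t, s)) = sgn (q (t, h t))"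
      using Q(1) by (intro eventually_ball_finite) auto
    moreover have "\<forall>\<^sub>F s in at (h t). s \<noteq> h t" by (simp add: eventually_at_filter)
    ultimately have "\<forall>\<^sub>F s in at (h t). s \<noteq> h t \<and> (\<forall>q\<in>Q. sgn (q (t, s)) = sgn (q (t, h t)))"
      by eventually_elim simp
    then have "\<exists>s. s \<noteq> h t \<and> (\<forall>q\<in>Q. sgn (q (t, s)) = sgn (q (t, h t)))"
      by (rule eventually_happens'[rotated]) simp
    then obtain s where s: "s \<noteq> h t" "\<forall>q\<in>Q. sgn (q (t, s)) = sgn (q (t, h t))" by blast
    then have "same_signs Q (t, s) (t, h t)" by (simp add: same_signs_def)
    from G[OF this] s(1) t show False by simp
  qed
  then obtain q where q: "q \<in> Q" "\<not> (\<forall>\<^sub>F t in at_right 0. \<not> A q t (h t))" by blast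
  then have "\<forall>\<^sub>F t in at_right 0. A q t (h t)" using definable_on_germ[OF h A[OF q(1)]] by blast
  then have "\<forall>\<^sub>F t in at_right 0. P q t \<noteq> 0 \<and> poly (P q t) (h t) = 0"
    by eventually_elim (auto simp: A_def)
  then show ?thesis using P(1)[OF q(1)] by blast
qed

lemma poly_lipschitz_at_0:
  fixes b :: "real poly"
  shows "\<exists>L\<ge>0. \<forall>t. 0 < t \<and> t < 1 \<longrightarrow> \<bar>poly b 0 - poly b t\<bar> \<le> L * t"
proof (cases b)
  case (pCons a c)
  have "compact (poly c ` {0..1})" by (intro compact_continuous_image continuous_intros) auto
  then have "bounded (poly c ` {0..1})" by (rule compact_imp_bounded)
  then obtain L where L: "\<And>y. y \<in> poly c ` {0..1} \<Longrightarrow> norm y \<le> L"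
    unfolding bounded_iff by blast
  have "\<bar>poly b 0 - poly b t\<bar> \<le> L * t" if "0 < t" "t < 1" for t
  proof -
    have "\<bar>poly c t\<bar> * t \<le> L * t" using L[of "poly c t"] that by (intro mult_right_mono) auto
    then show ?thesis using that by (simp add: pCons abs_mult mult.commute)
  qed
  moreover have "L \<ge> 0" using L[of "poly c 0"] abs_ge_zero[of "poly c 0"] by force
  ultimately show ?thesis by blast
qed

text \<open>
  Near \<open>t = 0\<close> the values \<open>h t\<close> are roots of a polynomial that differs by \<open>O(t)\<close> from a nonzero polynomial
  \<open>P0\<close>, of which the limit \<open>l\<close> is a root; the exponent \<open>m\<close> is the multiplicity of \<open>l\<close>.
\<close>
lemma definable_on_holder:
  assumes h: "definable_on \<eta> h" "\<eta> > 0" and bnd: "\<And>t. 0 < t \<Longrightarrow> t < \<eta> \<Longrightarrow> \<bar>h t\<bar> \<le> B"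
  shows "\<exists>l C m. 0 \<le> C \<and> 1 \<le> (m::nat) \<and> (\<forall>\<^sub>F t in at_right 0. \<bar>h t - l\<bar> ^ m \<le> C * t)"
proof -
  obtain l where l: "(h \<longlongrightarrow> l) (at_right 0)" using definable_on_limit[OF assms] by blast
  obtain d P where P: "P \<in> param_polys d" and ev: "\<forall>\<^sub>F t in at_right 0. P t \<noteq> 0 \<and> poly (P t) (h t) = 0"
    using definable_on_algebraic[OF h] by blast
  have evI: "\<forall>\<^sub>F t in at_right 0. 0 < t \<and> t < e" if "e > 0" for e :: real
    using that unfolding eventually_at_right_field by blast
  obtain \<alpha> where \<alpha>: "\<And>k t. coeff (P t) k = poly (\<alpha> k) t"
    using real_polynomial_function_as_poly[OF param_polysD(1)[OF P]] by metis
  define K where "K = {k. k \<le> d \<and> \<alpha> k \<noteq> 0}"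
  have "K \<noteq> {}"
  proof -
    have "\<exists>t. P t \<noteq> 0 \<and> poly (P t) (h t) = 0"
      by (rule eventually_happens'[OF _ ev]) simp
    then obtain t where "P t \<noteq> 0" by blast
    then have "coeff (P t) (degree (P t)) \<noteq> 0" "degree (P t) \<le> d" using param_polysD(2)[OF P] by auto
    then show ?thesis using \<alpha> by (auto simp: K_def)
  qed
  have finK: "finite K" by (simp add: K_def)
  define e where "e = Min ((\<lambda>k. order 0 (\<alpha> k)) ` K)"
  have "e \<in> (\<lambda>k. order 0 (\<alpha> k)) ` K" unfolding e_def using finK \<open>K \<noteq> {}\<close> by (intro Min_in) auto
  then obtain k0 where k0: "k0 \<in> K" "order 0 (\<alpha> k0) = e" by auto
  \<comment> \<open>Dividing all coefficients by the common power of \<open>t\<close> leaves a polynomial that does not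
     degenerate at \<open>t = 0\<close>.\<close>
  have "\<exists>b. \<alpha> k = [:0, 1:] ^ e * b" if "k \<le> d" for k
  proof (cases "\<alpha> k = 0")
    case False
    then have "e \<le> order 0 (\<alpha> k)" using that finK unfolding e_def K_def by (intro Min_le) auto
    then have "[:0, 1:] ^ e dvd \<alpha> k" using order_1[of 0 "\<alpha> k"] by (auto intro: power_le_dvd)
    then show ?thesis by (auto elim: dvdE)
  qed auto
  then obtain b where b: "\<And>k. k \<le> d \<Longrightarrow> \<alpha> k = [:0, 1:] ^ e * b k" by metis
  have bk0: "poly (b k0) 0 \<noteq> 0"
  proof
    assume "poly (b k0) 0 = 0"
    then have "[:0, 1:] dvd b k0" using poly_eq_0_iff_dvd[of "b k0" 0] by simp
    then have "[:0, 1:] ^ Suc e dvd [:0, 1:] ^ e * b k0"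
      unfolding power_Suc2 by (rule mult_dvd_mono[OF dvd_refl])
    then have "[:0, 1:] ^ Suc e dvd \<alpha> k0" using b[of k0] k0(1) by (simp only: K_def mem_Collect_eq)
    moreover have "\<alpha> k0 \<noteq> 0" using k0(1) by (simp add: K_def)
    ultimately show False using order_2[of "\<alpha> k0" 0] k0(2) by simp
  qed
  define P0 where "P0 = (\<Sum>k\<le>d. monom (poly (b k) 0) k)"
  have "coeff P0 k0 = poly (b k0) 0" using k0(1) by (simp add: P0_def coeff_sum K_def)
  then have "P0 \<noteq> 0" using bk0 by auto
  obtain L where L: "\<And>k. 0 \<le> L k" "\<And>k t. 0 < t \<Longrightarrow> t < 1 \<Longrightarrow> \<bar>poly (b k) 0 - poly (b k) t\<bar> \<le> L k * t"
  proof -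
    have "\<forall>k. \<exists>L. 0 \<le> L \<and> (\<forall>t. 0 < t \<and> t < 1 \<longrightarrow> \<bar>poly (b k) 0 - poly (b k) t\<bar> \<le> L * t)"
      using poly_lipschitz_at_0 by blast
    from choice[OF this] show thesis using that by blast
  qed
  define C where "C = (\<Sum>k\<le>d. L k * \<bar>B\<bar> ^ k)"
  have C0: "C \<ge> 0" unfolding C_def using L(1) by (intro sum_nonneg) simp
  have bound: "\<forall>\<^sub>F t in at_right 0. \<bar>poly P0 (h t)\<bar> \<le> C * t"
    using ev evI[OF zero_less_one] evI[OF h(2)]
  proof eventually_elim
    case (elim t)
    then have t: "0 < t" "t < 1" "t < \<eta>" and root: "poly (P t) (h t) = 0" by auto
    have "poly (P t) (h t) = (\<Sum>k\<le>d. coeff (P t) k * h t ^ k)"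
      unfolding poly_altdef using param_polysD(2)[OF P, of t]
      by (intro sum.mono_neutral_left) (auto simp: coeff_eq_0)
    then have "0 = (\<Sum>k\<le>d. coeff (P t) k * h t ^ k)" using root by simp
    also have "\<dots> = t ^ e * (\<Sum>k\<le>d. poly (b k) t * h t ^ k)"
      unfolding sum_distrib_left by (rule sum.cong) (auto simp: \<alpha> b poly_power)
    finally have z: "(\<Sum>k\<le>d. poly (b k) t * h t ^ k) = 0" using t(1) by simp
    have "poly P0 (h t) = (\<Sum>k\<le>d. (poly (b k) 0 - poly (b k) t) * h t ^ k)"
      using z by (simp add: P0_def poly_sum poly_monom left_diff_distrib sum_subtractf)
    then have "\<bar>poly P0 (h t)\<bar> \<le> (\<Sum>k\<le>d. \<bar>(poly (b k) 0 - poly (b k) t) * h t ^ k\<bar>)" by simp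
    also have "\<dots> \<le> (\<Sum>k\<le>d. L k * \<bar>B\<bar> ^ k * t)"
    proof (rule sum_mono)
      fix k
      have "\<bar>h t\<bar> ^ k \<le> \<bar>B\<bar> ^ k" using bnd[OF t(1) t(3)] by (intro power_mono) auto
      then have "\<bar>poly (b k) 0 - poly (b k) t\<bar> * \<bar>h t\<bar> ^ k \<le> (L k * t) * \<bar>B\<bar> ^ k"
        using L t by (intro mult_mono) auto
      then show "\<bar>(poly (b k) 0 - poly (b k) t) * h t ^ k\<bar> \<le> L k * \<bar>B\<bar> ^ k * t"
        by (simp add: abs_mult power_abs ac_simps)
    qed
    also have "\<dots> = C * t" by (simp add: C_def sum_distrib_right)
    finally show "\<bar>poly P0 (h t)\<bar> \<le> C * t" .
  qed
  have "((\<lambda>t. poly P0 (h t)) \<longlongrightarrow> poly P0 l) (at_right 0)"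
    by (intro tendsto_intros l)
  moreover have "((\<lambda>t. poly P0 (h t)) \<longlongrightarrow> 0) (at_right 0)"
  proof (rule Lim_null_comparison)
    show "\<forall>\<^sub>F t in at_right 0. norm (poly P0 (h t)) \<le> C * t" using bound by simp
    show "((\<lambda>t. C * t) \<longlongrightarrow> 0) (at_right 0)" by (auto intro!: tendsto_eq_intros)
  qed
  ultimately have root: "poly P0 l = 0" by (rule tendsto_unique[rotated]) simp
  define m where "m = order l P0"
  have "m \<ge> 1" using root \<open>P0 \<noteq> 0\<close> unfolding m_def by (simp add: order_root Suc_leI)
  obtain R where R: "P0 = [:- l, 1:] ^ m * R" "\<not> [:- l, 1:] dvd R"
    using order_decomp[OF \<open>P0 \<noteq> 0\<close>, of l] unfolding m_def by blast
  then have Rl: "\<bar>poly R l\<bar> > 0" by (simp add: poly_eq_0_iff_dvd)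
  have "((\<lambda>t. \<bar>poly R (h t)\<bar>) \<longlongrightarrow> \<bar>poly R l\<bar>) (at_right 0)"
    by (intro tendsto_intros l)
  then have "\<forall>\<^sub>F t in at_right 0. \<bar>poly R (h t)\<bar> > \<bar>poly R l\<bar> / 2"
    by (rule order_tendstoD(1)) (use Rl in simp)
  then have "\<forall>\<^sub>F t in at_right 0. \<bar>h t - l\<bar> ^ m \<le> (2 * C / \<bar>poly R l\<bar>) * t"
    using bound
  proof eventually_elim
    case (elim t)
    have "\<bar>h t - l\<bar> ^ m * (\<bar>poly R l\<bar> / 2) \<le> \<bar>h t - l\<bar> ^ m * \<bar>poly R (h t)\<bar>"
      using elim by (intro mult_left_mono) auto
    also have "\<dots> = \<bar>poly P0 (h t)\<bar>" by (simp add: R(1) abs_mult power_abs)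
    also have "\<dots> \<le> C * t" using elim by simp
    finally show ?case using Rl by (simp add: field_simps)
  qed
  moreover have "2 * C / \<bar>poly R l\<bar> \<ge> 0" using C0 by simp
  ultimately show ?thesis using \<open>m \<ge> 1\<close> by blast
qed

section \<open>Variation near the end point and definable selection\<close>

lemma le_powr_inverse_of_power_le:
  fixes x y :: real
  assumes "x ^ m \<le> y" "0 \<le> x" "1 \<le> m"
  shows "x \<le> y powr (1 / real m)"
proof (cases "x = 0")
  case False
  then have "x > 0" using assms(2) by simp
  then have "x = (x ^ m) powr (1 / real m)"
    using assms(3) by (simp add: powr_realpow[symmetric] powr_powr)
  also have "\<dots> \<le> y powr (1 / real m)"
    using assms \<open>x > 0\<close> by (intro powr_mono2) auto
  finally show ?thesis .
qed simp

text \<open>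
  The variation of \<open>f\<close> over the dyadic interval from \<open>\<tau>\<close> to \<open>2 * \<tau>\<close> is of order \<open>\<tau> powr (1 / m)\<close> as \<open>\<tau>\<close>
  tends to \<open>0\<close>.
\<close>
definition variation_bound :: "(real \<Rightarrow> 'a::real_normed_vector) \<Rightarrow> real \<Rightarrow> nat \<Rightarrow> real \<Rightarrow> bool" where
  "variation_bound f V m \<delta> \<longleftrightarrow> 0 \<le> V \<and> 1 \<le> m \<and> 0 < \<delta> \<and>
     (\<forall>\<tau> N t. 0 < \<tau> \<longrightarrow> \<tau> < \<delta> \<longrightarrow> (\<forall>j\<le>N. \<tau> \<le> t j \<and> t j \<le> 2 * \<tau>) \<longrightarrow> strict_mono t \<longrightarrow>
       (\<Sum>j<N. norm (f (t (Suc j)) - f (t j))) \<le> V * \<tau> powr (1 / real m))"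

text \<open>
  Combines the crossing bound with the Hoelder estimate: on the dyadic interval the values stay within
  \<open>r\<close> of the limit.
\<close>
lemma definable_on_small_variation:
  assumes h: "definable_on \<eta> h" "\<eta> > 0" and bnd: "\<And>t. 0 < t \<Longrightarrow> t < \<eta> \<Longrightarrow> \<bar>h t\<bar> \<le> B"
  shows "\<exists>V m \<delta>. variation_bound h V m \<delta>"
proof -
  obtain l C m where C: "0 \<le> C" "1 \<le> (m::nat)" and ev: "\<forall>\<^sub>F t in at_right 0. \<bar>h t - l\<bar> ^ m \<le> C * t"
    using definable_on_holder[OF assms] by blast
  obtain e where e: "e > 0" "\<And>t. 0 < t \<Longrightarrow> t < e \<Longrightarrow> \<bar>h t - l\<bar> ^ m \<le> C * t"
    using ev unfolding eventually_at_right_field by blast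
  obtain D where D: "\<And>N t a b. (\<forall>j\<le>N. 0 < t j \<and> t j < \<eta> \<and> h (t j) \<in> {a..b}) \<Longrightarrow> strict_mono t \<Longrightarrow>
     (\<Sum>j<N. \<bar>h (t (Suc j)) - h (t j)\<bar>) \<le> real D * (b - a)"
    using definable_on_variation[OF h(1)] by blast
  define V where "V = real D * 2 * (2 * C) powr (1 / real m)"
  have "(\<Sum>j<N. norm (h (t (Suc j)) - h (t j))) \<le> V * \<tau> powr (1 / real m)"
    if \<tau>: "0 < \<tau>" "\<tau> < min e \<eta> / 2" and t: "\<forall>j\<le>N. \<tau> \<le> t j \<and> t j \<le> 2 * \<tau>" and inc: "strict_mono t"
    for \<tau> N t
  proof -
    define r where "r = (2 * C * \<tau>) powr (1 / real m)"
    have "0 < t j \<and> t j < \<eta> \<and> h (t j) \<in> {l - r..l + r}" if "j \<le> N" for j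
    proof -
      have tj: "\<tau> \<le> t j" "t j \<le> 2 * \<tau>" using t that by auto
      then have "\<bar>h (t j) - l\<bar> ^ m \<le> C * t j" using \<tau> by (intro e(2)) auto
      also have "\<dots> \<le> 2 * C * \<tau>" using tj C(1) mult_left_mono[of "t j" "2 * \<tau>" C] by simp
      finally have "\<bar>h (t j) - l\<bar> \<le> r" unfolding r_def using C(2) by (intro le_powr_inverse_of_power_le) auto
      then show ?thesis using tj \<tau> by auto
    qed
    then have "(\<Sum>j<N. \<bar>h (t (Suc j)) - h (t j)\<bar>) \<le> real D * ((l + r) - (l - r))"
      using inc by (intro D) auto
    also have "\<dots> = V * \<tau> powr (1 / real m)"
      using \<tau>(1) C(1) by (simp add: V_def r_def powr_mult)
    finally show ?thesis by simp
  qed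
  moreover have "V \<ge> 0" by (simp add: V_def)
  moreover have "min e \<eta> / 2 > 0" using e(1) h(2) by simp
  ultimately show ?thesis using C(2)
    by (intro exI[of _ V] exI[of _ m] exI[of _ "min e \<eta> / 2"]) (simp add: variation_bound_def)
qed

lemma variation_bound_Basis:
  fixes f :: "real \<Rightarrow> 'a::euclidean_space"
  assumes "\<And>b. b \<in> Basis \<Longrightarrow> \<exists>V m \<delta>. variation_bound (\<lambda>t. f t \<bullet> b) V m \<delta>"
  shows "\<exists>V m \<delta>. variation_bound f V m \<delta>"
proof -
  obtain V m \<delta> where vb: "\<And>b. b \<in> Basis \<Longrightarrow> variation_bound (\<lambda>t. f t \<bullet> b) (V b) (m b) (\<delta> b)"
    using assms by metis
  then have V: "\<And>b. b \<in> Basis \<Longrightarrow> 0 \<le> V b" and m: "\<And>b. b \<in> Basis \<Longrightarrow> 1 \<le> m b"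
    and \<delta>: "\<And>b. b \<in> Basis \<Longrightarrow> 0 < \<delta> b"
    by (simp_all add: variation_bound_def)
  have var: "(\<Sum>j<N. norm (f (t (Suc j)) \<bullet> b - f (t j) \<bullet> b)) \<le> V b * \<tau> powr (1 / real (m b))"
    if "b \<in> Basis" "0 < \<tau>" "\<tau> < \<delta> b" "\<forall>j\<le>N. \<tau> \<le> t j \<and> t j \<le> 2 * \<tau>" "strict_mono t" for b \<tau> N t
    using vb[OF that(1)] that(2-) unfolding variation_bound_def by blast
  define M where "M = Max (insert 1 (m ` Basis))"
  define d where "d = Min (insert 1 (\<delta> ` Basis))"
  have M: "1 \<le> M" "\<And>b. b \<in> Basis \<Longrightarrow> m b \<le> M"
    unfolding M_def by (rule Max_ge; simp)+
  have d0: "0 < d" unfolding d_def using \<delta> by (subst Min_gr_iff) auto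
  have d: "d \<le> 1" "\<And>b. b \<in> Basis \<Longrightarrow> d \<le> \<delta> b"
    unfolding d_def by (rule Min_le; simp)+
  have "(\<Sum>j<N. norm (f (t (Suc j)) - f (t j))) \<le> (\<Sum>b\<in>Basis. V b) * \<tau> powr (1 / real M)"
    if \<tau>: "0 < \<tau>" "\<tau> < d" and t: "\<forall>j\<le>N. \<tau> \<le> t j \<and> t j \<le> 2 * \<tau>" and inc: "strict_mono t" for \<tau> N t
  proof -
    have "(\<Sum>j<N. norm (f (t (Suc j)) - f (t j))) \<le> (\<Sum>j<N. \<Sum>b\<in>Basis. norm (f (t (Suc j)) \<bullet> b - f (t j) \<bullet> b))"
      by (intro sum_mono order_trans[OF norm_le_l1]) (simp add: inner_diff_left)
    also have "\<dots> = (\<Sum>b\<in>Basis. \<Sum>j<N. norm (f (t (Suc j)) \<bullet> b - f (t j) \<bullet> b))" by (rule sum.swap)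
    also have "\<dots> \<le> (\<Sum>b\<in>Basis. V b * \<tau> powr (1 / real M))"
    proof (rule sum_mono)
      fix b :: 'a assume b: "b \<in> Basis"
      have "(\<Sum>j<N. norm (f (t (Suc j)) \<bullet> b - f (t j) \<bullet> b)) \<le> V b * \<tau> powr (1 / real (m b))"
        using \<tau> d(2)[OF b] t inc by (intro var[OF b]) auto
      also have "\<tau> powr (1 / real (m b)) \<le> \<tau> powr (1 / real M)"
        using \<tau> d(1) M(1) M(2)[OF b] m[OF b] by (intro powr_mono') (auto intro!: divide_left_mono)
      then have "V b * \<tau> powr (1 / real (m b)) \<le> V b * \<tau> powr (1 / real M)"
        using V[OF b] by (rule mult_left_mono)
      finally show "(\<Sum>j<N. norm (f (t (Suc j)) \<bullet> b - f (t j) \<bullet> b)) \<le> V b * \<tau> powr (1 / real M)" .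
    qed
    finally show ?thesis by (simp add: sum_distrib_right)
  qed
  moreover have "(\<Sum>b\<in>(Basis::'a set). V b) \<ge> 0" using V by (intro sum_nonneg)
  ultimately show ?thesis using M(1) d0
    by (intro exI[of _ "\<Sum>b\<in>Basis. V b"] exI[of _ M] exI[of _ d]) (simp add: variation_bound_def)
qed

text \<open>
  The lexicographic minimum of each fibre, obtained by minimising one coordinate after the other.
\<close>
lemma definable_selection:
  fixes D :: "real \<Rightarrow> 'a::euclidean_space set"
  assumes D: "definable (\<lambda>p. snd p \<in> D (fst p))"
    and comp: "\<And>t. 0 < t \<Longrightarrow> t < \<eta> \<Longrightarrow> compact (D t)" and ne: "\<And>t. 0 < t \<Longrightarrow> t < \<eta> \<Longrightarrow> D t \<noteq> {}"
  shows "\<exists>\<xi>. (\<forall>t. 0 < t \<longrightarrow> t < \<eta> \<longrightarrow> \<xi> t \<in> D t) \<and> (\<forall>b\<in>Basis. definable_on \<eta> (\<lambda>t. \<xi> t \<bullet> b))"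
proof -
  have "\<exists>E. definable (\<lambda>p. snd p \<in> E (fst p)) \<and> (\<forall>t. 0 < t \<longrightarrow> t < \<eta> \<longrightarrow> compact (E t) \<and> E t \<noteq> {} \<and>
      E t \<subseteq> D t \<and> (\<forall>b\<in>B. \<forall>x\<in>E t. \<forall>y\<in>E t. x \<bullet> b = y \<bullet> b))" if "finite B" for B :: "'a set"
    using that
  proof (induction B rule: finite_induct)
    case empty
    then show ?case using assms by (intro exI[of _ D]) auto
  next
    case (insert b B)
    then obtain E where E: "definable (\<lambda>p. snd p \<in> E (fst p))" and
      Et: "\<And>t. 0 < t \<Longrightarrow> t < \<eta> \<Longrightarrow> compact (E t) \<and> E t \<noteq> {} \<and> E t \<subseteq> D t \<and>
        (\<forall>b\<in>B. \<forall>x\<in>E t. \<forall>y\<in>E t. x \<bullet> b = y \<bullet> b)" by blast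
    define E' where "E' t = {x \<in> E t. \<forall>y. y \<in> E t \<longrightarrow> x \<bullet> b \<le> y \<bullet> b}" for t
    have "definable (\<lambda>p. snd p \<in> E (fst p) \<and> (\<forall>y. y \<in> E (fst p) \<longrightarrow> snd p \<bullet> b \<le> y \<bullet> b))"
    proof (intro definable_conj E definable_all definable_imp definable_le poly_intros)
      show "definable (\<lambda>p::(real \<times> 'a) \<times> 'a. snd p \<in> E (fst (fst p)))"
        using definable_compose[OF E, of "\<lambda>p::(real \<times> 'a) \<times> 'a. (fst (fst p), snd p)"] by (simp add: poly_intros)
    qed
    then have "definable (\<lambda>p. snd p \<in> E' (fst p))" by (simp add: E'_def)
    moreover have "\<forall>t. 0 < t \<longrightarrow> t < \<eta> \<longrightarrow> compact (E' t) \<and> E' t \<noteq> {} \<and> E' t \<subseteq> D t \<and>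
        (\<forall>c\<in>insert b B. \<forall>x\<in>E' t. \<forall>y\<in>E' t. x \<bullet> c = y \<bullet> c)"
    proof (intro allI impI)
      fix t assume t: "0 < t" "t < \<eta>"
      note Et = Et[OF t]
      have "continuous_on (E t) (\<lambda>x. x \<bullet> b)" by (intro continuous_intros)
      then obtain x0 where x0: "x0 \<in> E t" "\<And>y. y \<in> E t \<Longrightarrow> x0 \<bullet> b \<le> y \<bullet> b"
        using continuous_attains_inf[of "E t" "\<lambda>x. x \<bullet> b"] Et by blast
      then have eq: "E' t = E t \<inter> {x. x \<bullet> b \<le> x0 \<bullet> b}" unfolding E'_def by (auto intro: order_trans)
      have "closed {x. x \<bullet> b \<le> x0 \<bullet> b}" by (intro closed_Collect_le continuous_intros)
      then have "compact (E' t)" unfolding eq using Et by (intro compact_Int_closed) auto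
      moreover have "x0 \<in> E' t" using x0 by (simp add: E'_def)
      moreover have "E' t \<subseteq> D t" using Et by (auto simp: E'_def)
      moreover have "x \<bullet> c = y \<bullet> c" if "c \<in> insert b B" "x \<in> E' t" "y \<in> E' t" for c x y
      proof (cases "c = b")
        case True
        have "x \<bullet> b \<le> y \<bullet> b" "y \<bullet> b \<le> x \<bullet> b" using that(2,3) unfolding E'_def by blast+
        then show ?thesis using True by simp
      next
        case False
        then show ?thesis using that Et unfolding E'_def by blast
      qed
      ultimately show "compact (E' t) \<and> E' t \<noteq> {} \<and> E' t \<subseteq> D t \<and>
        (\<forall>c\<in>insert b B. \<forall>x\<in>E' t. \<forall>y\<in>E' t. x \<bullet> c = y \<bullet> c)" by blast
    qed
    ultimately show ?case by (intro exI[of _ E'] conjI)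
  qed
  from this[OF finite_Basis] obtain E where E: "definable (\<lambda>p. snd p \<in> E (fst p))" and
      Et': "\<forall>t. 0 < t \<longrightarrow> t < \<eta> \<longrightarrow> compact (E t) \<and> E t \<noteq> {} \<and>
      E t \<subseteq> D t \<and> (\<forall>b\<in>Basis. \<forall>x\<in>E t. \<forall>y\<in>E t. x \<bullet> b = y \<bullet> b)"
    by (elim exE conjE)
  have Et: "E t \<noteq> {}" "E t \<subseteq> D t" "\<And>b x y. b \<in> Basis \<Longrightarrow> x \<in> E t \<Longrightarrow> y \<in> E t \<Longrightarrow> x \<bullet> b = y \<bullet> b"
    if "0 < t" "t < \<eta>" for t using Et' that by blast+
  define \<xi> where "\<xi> t = (SOME x. x \<in> E t)" for t
  have \<xi>: "\<xi> t \<in> E t" if "0 < t" "t < \<eta>" for t using Et(1)[OF that] unfolding \<xi>_def by (simp add: some_in_eq)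
  have "definable_on \<eta> (\<lambda>t. \<xi> t \<bullet> b)" if b: "b \<in> Basis" for b
  proof -
    have "definable (\<lambda>p::real \<times> real. 0 < fst p \<and> fst p < \<eta> \<and> (\<exists>x. x \<in> E (fst p) \<and> snd p = x \<bullet> b))"
    proof (intro definable_conj definable_ex)
      show "definable (\<lambda>p::(real \<times> real) \<times> 'a. snd p \<in> E (fst (fst p)))"
        using definable_compose[OF E, of "\<lambda>p::(real \<times> real) \<times> 'a. (fst (fst p), snd p)"] by (simp add: poly_intros)
    qed (intro definable_intros term_intros)+
    moreover have "(0 < t \<and> t < \<eta> \<and> (\<exists>x. x \<in> E t \<and> s = x \<bullet> b)) \<longleftrightarrow> (0 < t \<and> t < \<eta> \<and> s = \<xi> t \<bullet> b)" for t s
      using \<xi>[of t] Et(3)[of t b _ "\<xi> t"] b by metis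
    ultimately show ?thesis by (simp add: definable_on_def)
  qed
  moreover have "\<xi> t \<in> D t" if "0 < t" "t < \<eta>" for t using \<xi>[OF that] Et(2)[OF that] by blast
  ultimately show ?thesis by (intro exI[of _ \<xi>] conjI allI impI ballI)
qed

section \<open>The Lojasiewicz inequality\<close>

text \<open>
  A proximal subgradient with a global quadratic error. Unlike for Frechet subgradients, no limit is
  involved, so the relation is first-order over \<open>\<Phi>\<close> and closed under limits of \<open>x\<close> and \<open>u\<close>.
\<close>
definition quad_subgradient :: "('a::real_inner \<Rightarrow> ereal) \<Rightarrow> real \<Rightarrow> 'a \<Rightarrow> real \<Rightarrow> 'a \<Rightarrow> bool" where
  "quad_subgradient \<Phi> K x r u \<longleftrightarrow>
     \<Phi> x = ereal r \<and> (\<forall>w. ereal (r + u \<bullet> (w - x) - K * (norm (w - x))\<^sup>2) \<le> \<Phi> w)"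

lemma definable_quad_subgradient:
  fixes \<Phi> :: "'a::euclidean_space \<Rightarrow> ereal"
  assumes graph: "definable (\<lambda>p::'a \<times> real. \<Phi> (fst p) = ereal (snd p))" and ninf: "\<And>x. \<Phi> x \<noteq> -\<infinity>"
  shows "definable (\<lambda>p::real \<times> 'a \<times> 'a. norm (fst (snd p)) \<le> \<rho> \<and>
           quad_subgradient \<Phi> K (fst (snd p)) (c + fst p) (snd (snd p)))"
proof -
  have ge: "ereal b \<le> \<Phi> w \<longleftrightarrow> (\<forall>r. \<Phi> w = ereal r \<longrightarrow> b \<le> r)" for b w
    using ninf[of w] by (cases "\<Phi> w") auto
  have nrm: "norm (x::'a) \<le> \<rho> \<longleftrightarrow> 0 \<le> \<rho> \<and> x \<bullet> x \<le> \<rho>\<^sup>2" for x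
    using norm_le_square[of x \<rho>] norm_ge_zero[of x] by (auto intro: order_trans)
  have gr: "definable (\<lambda>x. \<Phi> (f x) = ereal (g x))" if "polynomial_function f" "polynomial_function g"
    for f and g :: "'z::real_normed_vector \<Rightarrow> real"
    using definable_compose[OF graph polynomial_function_Pair[OF that]] by simp
  show ?thesis
    unfolding quad_subgradient_def ge nrm power2_norm_eq_inner
    by (intro definable_intros gr term_intros)
qed

text \<open>
  In the limit the inequality at \<open>w = x\<close> gives \<open>r \<le> \<Phi> x\<close>, and lower semicontinuity gives the reverse; so
  the value \<open>r\<close> is kept although \<open>\<Phi>\<close> need not be continuous.
\<close>
lemma closed_quad_subgradient:
  fixes \<Phi> :: "'a::euclidean_space \<Rightarrow> ereal"
  assumes lsc: "\<And>X x b. X \<longlonglongrightarrow> x \<Longrightarrow> (\<And>j::nat. \<Phi> (X j) \<le> ereal b) \<Longrightarrow> \<Phi> x \<le> ereal b"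
  shows "closed {(x, u). norm x \<le> \<rho> \<and> quad_subgradient \<Phi> K x r u}"
  unfolding closed_sequential_limits
proof (intro allI impI, elim conjE)
  fix Y and q :: "'a \<times> 'a"
  assume Y: "\<forall>n. Y n \<in> {(x, u). norm x \<le> \<rho> \<and> quad_subgradient \<Phi> K x r u}" and lim: "Y \<longlonglongrightarrow> q"
  obtain x u where q: "q = (x, u)" by (cases q)
  have X: "(\<lambda>n. fst (Y n)) \<longlonglongrightarrow> x" and U: "(\<lambda>n. snd (Y n)) \<longlonglongrightarrow> u"
    using tendsto_fst[OF lim] tendsto_snd[OF lim] by (simp_all add: q)
  have Yn: "norm (fst (Y n)) \<le> \<rho>" "\<Phi> (fst (Y n)) = ereal r"
    "\<And>w. ereal (r + snd (Y n) \<bullet> (w - fst (Y n)) - K * (norm (w - fst (Y n)))\<^sup>2) \<le> \<Phi> w" for n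
    using Y by (auto simp: quad_subgradient_def case_prod_unfold)
  have "norm x \<le> \<rho>"
    by (rule tendsto_upperbound[OF tendsto_norm[OF X]]) (auto simp: Yn)
  moreover have quad: "ereal (r + u \<bullet> (w - x) - K * (norm (w - x))\<^sup>2) \<le> \<Phi> w" for w
  proof (rule LIMSEQ_le_const2)
    show "(\<lambda>n. ereal (r + snd (Y n) \<bullet> (w - fst (Y n)) - K * (norm (w - fst (Y n)))\<^sup>2))
      \<longlonglongrightarrow> ereal (r + u \<bullet> (w - x) - K * (norm (w - x))\<^sup>2)"
      by (intro tendsto_intros X U)
  qed (use Yn(3) in auto)
  moreover have "\<Phi> x = ereal r"
  proof (rule antisym)
    show "\<Phi> x \<le> ereal r" by (rule lsc[OF X]) (simp add: Yn)
    show "ereal r \<le> \<Phi> x" using quad[of x] by simp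
  qed
  ultimately show "q \<in> {(x, u). norm x \<le> \<rho> \<and> quad_subgradient \<Phi> K x r u}"
    by (simp add: q quad_subgradient_def)
qed

text \<open>
  Along \<open>Suc N\<close> equal steps of the level, some pair of consecutive points is at most \<open>V / Suc N\<close> apart. The
  subgradient inequality between them bounds the level difference; multiplied by \<open>Suc N\<close>, its quadratic
  term disappears in the limit.
\<close>
lemma quad_subgradient_norm_lower_bound:
  fixes x u :: "real \<Rightarrow> 'a::real_inner"
  assumes K: "0 \<le> K" and \<tau>: "0 < \<tau>" and V: "0 \<le> V"
    and sub: "\<And>t. \<tau> \<le> t \<Longrightarrow> t \<le> 2 * \<tau> \<Longrightarrow> quad_subgradient \<Phi> K (x t) (c + t) (u t)"
    and small: "\<And>t. \<tau> \<le> t \<Longrightarrow> t \<le> 2 * \<tau> \<Longrightarrow> norm (u t) \<le> \<omega>"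
    and var: "\<And>N t. (\<forall>j\<le>N. \<tau> \<le> t j \<and> t j \<le> 2 * \<tau>) \<Longrightarrow> strict_mono t \<Longrightarrow>
       (\<Sum>j<N. norm (x (t (Suc j)) - x (t j))) \<le> V"
  shows "\<tau> \<le> \<omega> * V"
proof -
  have step: "\<tau> \<le> \<omega> * V + K * V\<^sup>2 / real (Suc N)" for N
  proof -
    define n where "n = Suc N"
    define t where "t j = \<tau> + real j * (\<tau> / real n)" for j
    have tb: "\<tau> \<le> t j" "t j \<le> 2 * \<tau>" if "j \<le> n" for j
    proof -
      show "\<tau> \<le> t j" using \<tau> by (simp add: t_def)
      have "real j * (\<tau> / real n) \<le> real n * (\<tau> / real n)"
        using that \<tau> by (intro mult_right_mono) auto
      then show "t j \<le> 2 * \<tau>" by (simp add: t_def n_def)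
    qed
    have inc: "t (Suc j) - t j = \<tau> / real n" for j by (simp add: t_def algebra_simps add_divide_distrib)
    have "strict_mono t"
    proof (rule strict_monoI)
      fix i j :: nat assume "i < j"
      then have "real i * (\<tau> / real n) < real j * (\<tau> / real n)"
        using \<tau> by (intro mult_strict_right_mono) (auto simp: n_def)
      then show "t i < t j" by (simp add: t_def)
    qed
    have sum: "(\<Sum>j<n. norm (x (t (Suc j)) - x (t j))) \<le> V" by (rule var) (use tb \<open>strict_mono t\<close> in auto)
    have "\<exists>j<n. norm (x (t (Suc j)) - x (t j)) \<le> V / real n"
    proof (rule ccontr)
      assume "\<not> ?thesis"
      then have "(\<Sum>j<n. V / real n) < (\<Sum>j<n. norm (x (t (Suc j)) - x (t j)))"
        by (intro sum_strict_mono) (auto simp: n_def not_le)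
      then show False using sum by (simp add: n_def)
    qed
    then obtain j where j: "j < n" "norm (x (t (Suc j)) - x (t j)) \<le> V / real n" by blast
    define s where "s = t (Suc j)"
    define D where "D = norm (x (t j) - x s)"
    have D: "0 \<le> D" "D \<le> V / real n" using j(2) by (auto simp: D_def s_def norm_minus_commute)
    have s: "\<tau> \<le> s" "s \<le> 2 * \<tau>" using tb[of "Suc j"] j(1) by (auto simp: s_def)
    have "\<Phi> (x (t j)) = ereal (c + t j)" using sub[OF tb[of j]] j(1) by (simp add: quad_subgradient_def)
    then have "c + s + u s \<bullet> (x (t j) - x s) - K * (norm (x (t j) - x s))\<^sup>2 \<le> c + t j"
      using sub[OF s] unfolding quad_subgradient_def by (metis ereal_less_eq(3))
    then have "s - t j \<le> - (u s \<bullet> (x (t j) - x s)) + K * D\<^sup>2" by (simp add: D_def)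
    also have "- (u s \<bullet> (x (t j) - x s)) \<le> norm (u s) * D"
      unfolding D_def using Cauchy_Schwarz_ineq2[of "u s" "x (t j) - x s"] by linarith
    also have "norm (u s) * D \<le> \<omega> * (V / real n)"
      using small[OF s] D by (intro mult_mono) (auto intro: order_trans[OF norm_ge_zero])
    also have "K * D\<^sup>2 \<le> K * (V / real n)\<^sup>2"
      using D K by (intro mult_left_mono power_mono) auto
    finally have "\<tau> / real n \<le> \<omega> * (V / real n) + K * (V / real n)\<^sup>2" using inc[of j] by (simp add: s_def)
    then have "real n * (\<tau> / real n) \<le> real n * (\<omega> * (V / real n) + K * (V / real n)\<^sup>2)"
      by (rule mult_left_mono) simp
    moreover have "r * (\<tau> / r) = \<tau>" "r * (\<omega> * (V / r) + K * (V / r)\<^sup>2) = \<omega> * V + K * V\<^sup>2 / r"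
      if "r > 0" for r
      using that by (simp_all add: field_simps power2_eq_square)
    ultimately show ?thesis unfolding n_def[symmetric] by (simp add: n_def del: of_nat_Suc)
  qed
  have "(\<lambda>N. \<omega> * V + K * V\<^sup>2 / real (Suc N)) \<longlonglongrightarrow> \<omega> * V + 0"
    by (intro tendsto_add tendsto_const LIMSEQ_Suc[OF lim_const_over_n])
  then show ?thesis using LIMSEQ_le_const[of _ "\<omega> * V + 0" \<tau>] step by auto
qed

text \<open>
  The values \<open>c + t\<close> with \<open>t\<close> small are either all missed on the ball, and there is nothing to show, or all
  attained. In the second case the fibres \<open>E t\<close> of pairs with the shortest subgradient are compact and
  a definable selection exists. The exponent is fixed by the Hoelder exponent of the selected points
  before the inequality for the subgradients is tested, so there is no circularity.
\<close>
theorem definable_Lojasiewicz: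
  fixes \<Phi> :: "'a::euclidean_space \<Rightarrow> ereal"
  assumes graph: "definable (\<lambda>p::'a \<times> real. \<Phi> (fst p) = ereal (snd p))" and ninf: "\<And>x. \<Phi> x \<noteq> -\<infinity>"
    and lsc: "\<And>X x b. X \<longlonglongrightarrow> x \<Longrightarrow> (\<And>j::nat. \<Phi> (X j) \<le> ereal b) \<Longrightarrow> \<Phi> x \<le> ereal b"
    and K: "0 \<le> K"
  shows "\<exists>\<theta> C \<delta>. 0 \<le> \<theta> \<and> \<theta> < 1 \<and> 0 \<le> C \<and> 0 < \<delta> \<and>
    (\<forall>x u t. norm x \<le> \<rho> \<longrightarrow> 0 < t \<longrightarrow> t < \<delta> \<longrightarrow> quad_subgradient \<Phi> K x (c + t) u \<longrightarrow> t powr \<theta> \<le> C * norm u)"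
proof -
  define S where "S t = {(x, u). norm x \<le> \<rho> \<and> quad_subgradient \<Phi> K x (c + t) u}" for t
  have S_def': "q \<in> S t \<longleftrightarrow> norm (fst q) \<le> \<rho> \<and> quad_subgradient \<Phi> K (fst q) (c + t) (snd q)" for q t
    by (simp add: S_def case_prod_unfold)
  have defS: "definable (\<lambda>p. snd p \<in> S (fst p))"
    using definable_quad_subgradient[OF graph ninf, of \<rho> K c] by (simp add: S_def')
  have closedS: "closed (S t)" for t unfolding S_def by (rule closed_quad_subgradient[OF lsc])
  have "definable (\<lambda>t. \<exists>q. q \<in> S t)" by (rule definable_ex[OF defS])
  from definable_germ[OF this] obtain \<eta> where \<eta>: "\<eta> > 0" and
    cases: "(\<forall>t. 0 < t \<and> t < \<eta> \<longrightarrow> (\<exists>q. q \<in> S t)) \<or> (\<forall>t. 0 < t \<and> t < \<eta> \<longrightarrow> \<not> (\<exists>q. q \<in> S t))" by blast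
  show ?thesis
  proof (cases "\<forall>t. 0 < t \<and> t < \<eta> \<longrightarrow> (\<exists>q. q \<in> S t)")
    case False
    then have "\<And>t q. 0 < t \<Longrightarrow> t < \<eta> \<Longrightarrow> q \<notin> S t" using cases by blast
    then have "\<forall>x u t. norm x \<le> \<rho> \<longrightarrow> 0 < t \<longrightarrow> t < \<eta> \<longrightarrow> quad_subgradient \<Phi> K x (c + t) u \<longrightarrow> t powr 0 \<le> 0 * norm u"
      unfolding S_def' by (metis fst_conv snd_conv)
    then show ?thesis using \<eta> by (intro exI[of _ 0] exI[of _ \<eta>]) auto
  next
    case True
    define E where "E t = {q \<in> S t. \<forall>q'. q' \<in> S t \<longrightarrow> snd q \<bullet> snd q \<le> snd q' \<bullet> snd q'}" for t
    have "definable (\<lambda>p::real \<times> 'a \<times> 'a. snd p \<in> S (fst p) \<and>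
       (\<forall>q'. q' \<in> S (fst p) \<longrightarrow> snd (snd p) \<bullet> snd (snd p) \<le> snd q' \<bullet> snd q'))"
    proof (intro definable_conj defS definable_all definable_imp definable_le term_intros)
      show "definable (\<lambda>p::(real \<times> 'a \<times> 'a) \<times> 'a \<times> 'a. snd p \<in> S (fst (fst p)))"
        using definable_compose[OF defS, of "\<lambda>p::(real \<times> 'a \<times> 'a) \<times> 'a \<times> 'a. (fst (fst p), snd p)"]
        by (simp add: poly_intros)
    qed
    then have defE: "definable (\<lambda>p. snd p \<in> E (fst p))" by (simp add: E_def)
    have E: "compact (E t) \<and> E t \<noteq> {}" if t: "0 < t" "t < \<eta>" for t
    proof -
      obtain q0 where q0: "q0 \<in> S t" using True t by blast
      define T where "T = S t \<inter> (cball 0 \<rho> \<times> cball 0 (norm (snd q0)))"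
      have "compact T" unfolding T_def
        by (intro closed_Int_compact closedS compact_Times compact_cball)
      moreover have cont: "continuous_on T (\<lambda>q. snd q \<bullet> snd q)" by (intro continuous_intros)
      moreover have "q0 \<in> T" using q0 by (cases q0) (auto simp: T_def S_def)
      ultimately obtain q1 where q1: "q1 \<in> T" "\<And>q. q \<in> T \<Longrightarrow> snd q1 \<bullet> snd q1 \<le> snd q \<bullet> snd q"
        using continuous_attains_inf[of T "\<lambda>q. snd q \<bullet> snd q"] cont by blast
      have min: "snd q1 \<bullet> snd q1 \<le> snd q \<bullet> snd q" if "q \<in> S t" for q
      proof (cases "q \<in> T")
        case False
        then have "norm (snd q) > norm (snd q0)" using that
          by (cases q) (auto simp: T_def S_def)
        moreover have "norm (snd q1) \<le> norm (snd q0)" using q1(1) by (auto simp: T_def)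
        ultimately show ?thesis unfolding power2_norm_eq_inner[symmetric] by (intro power_mono) auto
      qed (rule q1(2))
      have "q1 \<in> E t" using q1(1) min by (auto simp: E_def T_def)
      moreover have "E t = T \<inter> {q. snd q \<bullet> snd q \<le> snd q1 \<bullet> snd q1}"
      proof -
        have "q \<in> T" if "q \<in> E t" for q
        proof -
          have "snd q \<bullet> snd q \<le> snd q0 \<bullet> snd q0" using that q0 unfolding E_def by blast
          then have "norm (snd q) \<le> norm (snd q0)" by (simp add: norm_le)
          then show ?thesis using that by (cases q) (auto simp: E_def T_def S_def)
        qed
        then show ?thesis using min q1(1) by (auto simp: E_def T_def intro: order_trans)
      qed
      moreover have "closed {q::'a \<times> 'a. snd q \<bullet> snd q \<le> snd q1 \<bullet> snd q1}"
        by (intro closed_Collect_le continuous_intros)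
      ultimately show ?thesis using \<open>compact T\<close> by (auto intro: compact_Int_closed)
    qed
    obtain \<xi> where \<xi>: "\<And>t. 0 < t \<Longrightarrow> t < \<eta> \<Longrightarrow> \<xi> t \<in> E t"
      and def\<xi>: "\<And>b. b \<in> Basis \<Longrightarrow> definable_on \<eta> (\<lambda>t. \<xi> t \<bullet> b)"
      using definable_selection[OF defE, of \<eta>] E by blast
    define x u where "x t = fst (\<xi> t)" and "u t = snd (\<xi> t)" for t
    have xS: "norm (x t) \<le> \<rho>" "quad_subgradient \<Phi> K (x t) (c + t) (u t)" if "0 < t" "t < \<eta>" for t
      using \<xi>[OF that] by (auto simp: E_def S_def' x_def u_def)
    have umin: "norm (u t) \<le> norm v" if "0 < t" "t < \<eta>" "norm y \<le> \<rho>" "quad_subgradient \<Phi> K y (c + t) v" for t y v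
    proof -
      have "(y, v) \<in> S t" using that by (simp add: S_def)
      then have "u t \<bullet> u t \<le> v \<bullet> v" using \<xi>[OF that(1,2)] by (force simp: E_def u_def)
      then show ?thesis by (simp add: norm_le)
    qed
    have "\<exists>V m \<delta>. variation_bound x V m \<delta>"
    proof (rule variation_bound_Basis)
      fix b :: 'a assume b: "b \<in> Basis"
      have "(b, 0) \<in> (Basis :: ('a \<times> 'a) set)" using b by (simp add: Basis_prod_def)
      from def\<xi>[OF this] have "definable_on \<eta> (\<lambda>t. x t \<bullet> b)" by (simp add: inner_prod_def x_def)
      then show "\<exists>V m \<delta>. variation_bound (\<lambda>t. x t \<bullet> b) V m \<delta>"
      proof (rule definable_on_small_variation[OF _ \<eta>])
        show "\<bar>x t \<bullet> b\<bar> \<le> \<rho>" if "0 < t" "t < \<eta>" for t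
          using Basis_le_norm[OF b, of "x t"] xS(1)[OF that] by linarith
      qed
    qed
    then obtain V m \<delta> where V: "0 \<le> V" "1 \<le> (m::nat)" "0 < \<delta>" and
      var: "\<And>\<tau> N t. 0 < \<tau> \<Longrightarrow> \<tau> < \<delta> \<Longrightarrow> (\<forall>j\<le>N. \<tau> \<le> t j \<and> t j \<le> 2 * \<tau>) \<Longrightarrow> strict_mono t \<Longrightarrow>
       (\<Sum>j<N. norm (x (t (Suc j)) - x (t j))) \<le> V * \<tau> powr (1 / real m)"
      unfolding variation_bound_def by blast
    define \<theta> where "\<theta> = 1 - 1 / real m"
    have \<theta>: "0 \<le> \<theta>" "\<theta> < 1" using V(2) by (auto simp: \<theta>_def)
    \<comment> \<open>A factor \<open>2\<close> is lost because \<open>t\<close> may be as large as \<open>2 * \<tau>\<close>, another one makes the final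
       contradiction strict; \<open>V + 1\<close> is positive even if \<open>V = 0\<close>.\<close>
    define C where "C = 4 * (V + 1)"
    have C: "C > 0" using V(1) by (simp add: C_def)
    \<comment> \<open>The lower bound \<open>t powr \<theta> \<le> C * norm (u t)\<close>, raised to the power \<open>2 * m\<close> so that it
       becomes a polynomial inequality.\<close>
    define lb where "lb t v \<longleftrightarrow> t ^ (2 * (m - 1)) \<le> C ^ (2 * m) * (v \<bullet> v) ^ m" for t and v :: 'a
    have iff: "lb t (u t) \<longleftrightarrow> t powr \<theta> \<le> C * norm (u t)" if "t > 0" for t
    proof -
      have "C ^ (2 * m) * (u t \<bullet> u t) ^ m = (C * norm (u t)) ^ (2 * m)"
        by (simp add: power_mult_distrib power_mult power2_norm_eq_inner[symmetric])
      moreover have "t ^ (2 * (m - 1)) = (t powr \<theta>) ^ (2 * m)"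
      proof -
        have "(t powr \<theta>) ^ (2 * m) = t powr (\<theta> * real (2 * m))"
          using that by (simp add: powr_realpow[symmetric] powr_powr)
        also have "\<theta> * real (2 * m) = real (2 * (m - 1))" using V(2) by (simp add: \<theta>_def field_simps of_nat_diff)
        finally show ?thesis using powr_realpow[OF that, of "2 * (m - 1)"] by simp
      qed
      ultimately show ?thesis unfolding lb_def
        using V(2) C power_mono_iff[of "t powr \<theta>" "C * norm (u t)" "2 * m"] by simp
    qed
    have lbE: "(\<exists>q. q \<in> E t \<and> lb t (snd q)) \<longleftrightarrow> t powr \<theta> \<le> C * norm (u t)" if t: "0 < t" "t < \<eta>" for t
    proof -
      have eq: "snd q \<bullet> snd q = u t \<bullet> u t" if q: "q \<in> E t" for q
      proof (rule antisym)
        show "snd q \<bullet> snd q \<le> u t \<bullet> u t" "u t \<bullet> u t \<le> snd q \<bullet> snd q"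
          using q \<xi>[OF t] unfolding E_def u_def by blast+
      qed
      have "lb t (snd q) \<longleftrightarrow> lb t (u t)" if "q \<in> E t" for q unfolding lb_def eq[OF that] ..
      then show ?thesis using \<xi>[OF t] iff[OF t(1)] by blast
    qed
    have "definable (\<lambda>t. \<exists>q. q \<in> E t \<and> lb t (snd q))"
      unfolding lb_def by (intro definable_ex definable_conj defE definable_le term_intros)
    from definable_germ[OF this] obtain e0 where e0: "e0 > 0" and
      alt: "(\<forall>t. 0 < t \<and> t < e0 \<longrightarrow> (\<exists>q. q \<in> E t \<and> lb t (snd q))) \<or>
        (\<forall>t. 0 < t \<and> t < e0 \<longrightarrow> \<not> (\<exists>q. q \<in> E t \<and> lb t (snd q)))" by blast
    define e where "e = min e0 \<eta>"
    have e: "e > 0" "e \<le> \<eta>" using e0 \<eta> by (simp_all add: e_def)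
    have low: "t powr \<theta> \<le> C * norm (u t)" if "0 < t" "t < e" for t
    proof (rule ccontr)
      assume "\<not> t powr \<theta> \<le> C * norm (u t)"
      then have "\<not> (\<exists>q. q \<in> E t \<and> lb t (snd q))" using lbE that e(2) by simp
      then have neg: "\<forall>t. 0 < t \<and> t < e0 \<longrightarrow> \<not> (\<exists>q. q \<in> E t \<and> lb t (snd q))"
        using alt that unfolding e_def by (meson min_less_iff_conj)
      define \<tau> where "\<tau> = min e \<delta> / 3"
      have \<tau>: "0 < \<tau>" "2 * \<tau> < e" "\<tau> < \<delta>" using e V(3) by (auto simp: \<tau>_def)
      have "norm (u t) \<le> 2 * \<tau> powr \<theta> / C" if t: "\<tau> \<le> t" "t \<le> 2 * \<tau>" for t
      proof -
        have t': "0 < t" "t < e0" "t < \<eta>" using \<tau> t e by (auto simp: e_def)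
        have "\<not> t powr \<theta> \<le> C * norm (u t)" using neg t' lbE[OF t'(1,3)] by blast
        then have "C * norm (u t) \<le> t powr \<theta>" by simp
        also have "\<dots> \<le> (2 * \<tau>) powr \<theta>" using t t' \<theta> by (intro powr_mono2) auto
        also have "\<dots> = 2 powr \<theta> * \<tau> powr \<theta>" using \<tau> by (simp add: powr_mult)
        also have "\<dots> \<le> 2 * \<tau> powr \<theta>" using \<theta> powr_mono[of \<theta> 1 2] by (intro mult_right_mono) auto
        finally show ?thesis using C by (simp add: field_simps)
      qed
      then have "\<tau> \<le> (2 * \<tau> powr \<theta> / C) * (V * \<tau> powr (1 / real m))"
        using \<tau> e(2) V(1) var[OF \<tau>(1,3)] xS(2)
        by (intro quad_subgradient_norm_lower_bound[OF K \<tau>(1), of _ \<Phi> x c u]) auto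
      also have "\<dots> = 2 * V / C * (\<tau> powr \<theta> * \<tau> powr (1 / real m))" by simp
      also have "\<tau> powr \<theta> * \<tau> powr (1 / real m) = \<tau>" using \<tau>(1) by (simp add: powr_add[symmetric] \<theta>_def)
      finally have "1 * \<tau> \<le> 2 * V / C * \<tau>" by simp
      then have "1 \<le> 2 * V / C" by (rule mult_right_le_imp_le) (rule \<tau>(1))
      then show False using V(1) by (simp add: C_def field_simps)
    qed
    have "t powr \<theta> \<le> C * norm v" if t: "norm y \<le> \<rho>" "0 < t" "t < e" "quad_subgradient \<Phi> K y (c + t) v" for y v t
    proof -
      have "t powr \<theta> \<le> C * norm (u t)" by (rule low[OF t(2,3)])
      also have "\<dots> \<le> C * norm v" using umin[OF t(2) _ t(1,4)] t(3) e(2) C by (intro mult_left_mono) auto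
      finally show ?thesis .
    qed
    then show ?thesis using \<theta> C e(1) by (intro exI[of _ \<theta>] exI[of _ C] exI[of _ e]) auto
  qed
qed

section \<open>Convergence of descent sequences with summable errors\<close>

text \<open>
  Concavity of the power \<open>1 - \<theta>\<close>, multiplied by \<open>s powr \<theta>\<close> to avoid a quotient.
\<close>
lemma powr_diff_ge_tangent:
  fixes s s' \<theta> :: real
  assumes "0 < s" "0 \<le> s'" "0 \<le> \<theta>" "\<theta> < 1"
  shows "(1 - \<theta>) * (s - s') \<le> s powr \<theta> * (s powr (1 - \<theta>) - s' powr (1 - \<theta>))"
proof -
  have s: "s powr \<theta> * s powr (1 - \<theta>) = s" using assms by (simp add: powr_add[symmetric])
  have "s powr \<theta> * s' powr (1 - \<theta>) \<le> \<theta> * s + (1 - \<theta>) * s'"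
  proof (cases "s' = 0")
    case False
    then show ?thesis using assms Youngs_inequality_0[of \<theta> "1 - \<theta>" s s'] by simp
  qed (use assms in simp)
  then show ?thesis using s by (simp add: algebra_simps)
qed

lemma summable_half_recursion:
  fixes D b :: "nat \<Rightarrow> real"
  assumes D: "\<And>n. 0 \<le> D n" and rec: "\<And>n. D (Suc n) \<le> D n / 2 + b n"
    and B: "\<And>n. (\<Sum>k<n. b k) \<le> B"
  shows "summable D"
proof (rule summableI_nonneg_bounded[OF D])
  fix n
  have "(\<Sum>k<Suc n. D k) = D 0 + (\<Sum>k<n. D (Suc k))" by (rule sum.lessThan_Suc_shift)
  also have "\<dots> \<le> D 0 + (\<Sum>k<n. D k / 2 + b k)" by (intro add_left_mono sum_mono rec)
  also have "\<dots> = D 0 + (\<Sum>k<n. D k) / 2 + (\<Sum>k<n. b k)" by (simp add: sum.distrib sum_divide_distrib)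
  also have "\<dots> \<le> D 0 + (\<Sum>k<n. D k) / 2 + B" using B by simp
  finally have "(\<Sum>k<Suc n. D k) \<le> D 0 + (\<Sum>k<n. D k) / 2 + B" .
  then show "(\<Sum>k<n. D k) \<le> 2 * (D 0 + B)" using D[of n] by simp
qed

text \<open>
  The tangent inequality turns the decrease of \<open>s\<close> into \<open>(D (Suc n))\<^sup>2 \<le> P n * (D n + e n)\<close> with telescoping
  \<open>P\<close>, and the inequality of the means makes this linear.
\<close>
lemma summable_of_Lojasiewicz_decrease:
  fixes s D e :: "nat \<Rightarrow> real"
  assumes a: "0 < a" and C: "0 \<le> C" and \<theta>: "0 \<le> \<theta>" "\<theta> < 1"
    and s: "\<And>n. 0 \<le> s n" and D: "\<And>n. 0 \<le> D n" and e: "\<And>n. 0 \<le> e n" "summable e"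
    and dec: "\<And>n. a * (D n)\<^sup>2 \<le> s n - s (Suc n)"
    and loj: "\<And>n. s (Suc n) powr \<theta> \<le> C * D n + e n"
  shows "summable D"
proof -
  define \<psi> where "\<psi> n = s n powr (1 - \<theta>)" for n
  define c where "c = (C + 1) / (a * (1 - \<theta>))"
  define P where "P n = c * (\<psi> (Suc n) - \<psi> (Suc (Suc n)))" for n
  have c: "0 \<le> c" using a C \<theta> by (simp add: c_def)
  have mono: "s (Suc n) \<le> s n" for n using dec[of n] a by (smt (verit) mult_nonneg_nonneg zero_le_power2)
  have P0: "0 \<le> P n" for n unfolding P_def \<psi>_def
    using c \<theta> s mono by (intro mult_nonneg_nonneg) (auto intro!: powr_mono2)
  have rec: "D (Suc n) \<le> D n / 2 + (e n / 2 + P n / 2)" for n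
  proof (cases "s (Suc n) = 0")
    case True
    then have "a * (D (Suc n))\<^sup>2 \<le> 0" using dec[of "Suc n"] s[of "Suc (Suc n)"] by simp
    then have "D (Suc n) = 0" using a by (simp add: mult_le_0_iff)
    then show ?thesis using D[of n] e(1)[of n] P0[of n] by simp
  next
    case False
    then have pos: "0 < s (Suc n)" using s[of "Suc n"] by simp
    have "(1 - \<theta>) * (a * (D (Suc n))\<^sup>2) \<le> (1 - \<theta>) * (s (Suc n) - s (Suc (Suc n)))"
      using dec[of "Suc n"] \<theta> by (intro mult_left_mono) auto
    also have "\<dots> \<le> s (Suc n) powr \<theta> * (\<psi> (Suc n) - \<psi> (Suc (Suc n)))"
      unfolding \<psi>_def by (rule powr_diff_ge_tangent[OF pos s \<theta>])
    also have "\<dots> \<le> ((C + 1) * (D n + e n)) * (\<psi> (Suc n) - \<psi> (Suc (Suc n)))"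
    proof (rule mult_right_mono)
      have "0 \<le> C * e n + D n" using C D[of n] e(1)[of n] by simp
      then show "s (Suc n) powr \<theta> \<le> (C + 1) * (D n + e n)"
        using loj[of n] by (simp add: algebra_simps)
      show "0 \<le> \<psi> (Suc n) - \<psi> (Suc (Suc n))" unfolding \<psi>_def using s mono \<theta> by (auto intro!: powr_mono2)
    qed
    finally have fin: "(1 - \<theta>) * (a * (D (Suc n))\<^sup>2)
      \<le> (C + 1) * (D n + e n) * (\<psi> (Suc n) - \<psi> (Suc (Suc n)))" .
    have "(D (Suc n))\<^sup>2 \<le> P n * (D n + e n)"
    proof -
      have "(a * (1 - \<theta>)) * (D (Suc n))\<^sup>2 \<le> (C + 1) * (D n + e n) * (\<psi> (Suc n) - \<psi> (Suc (Suc n)))"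
        using fin by (simp only: mult_ac)
      moreover have "0 < a * (1 - \<theta>)" using a \<theta> by simp
      ultimately have "(D (Suc n))\<^sup>2 \<le> (C + 1) * (D n + e n) * (\<psi> (Suc n) - \<psi> (Suc (Suc n))) / (a * (1 - \<theta>))"
        by (subst pos_le_divide_eq) (simp_all only: mult_ac)
      then show ?thesis by (simp add: P_def c_def mult_ac)
    qed
    also have "\<dots> \<le> ((P n + (D n + e n)) / 2)\<^sup>2"
    proof -
      have "x * y \<le> ((x + y) / 2)\<^sup>2" for x y :: real
      proof -
        have "((x + y) / 2)\<^sup>2 - x * y = ((x - y) / 2)\<^sup>2" by (simp add: power2_eq_square field_simps)
        then show ?thesis using zero_le_power2[of "(x - y) / 2"] by linarith
      qed
      then show ?thesis .
    qed
    finally have "(D (Suc n))\<^sup>2 \<le> ((P n + (D n + e n)) / 2)\<^sup>2" .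
    then have "D (Suc n) \<le> (P n + (D n + e n)) / 2"
      by (rule power2_le_imp_le) (use P0[of n] D[of n] e(1)[of n] in simp)
    then show ?thesis by simp
  qed
  have "(\<Sum>k<n. e k / 2 + P k / 2) \<le> suminf e / 2 + c * \<psi> 1 / 2" for n
  proof -
    have "(\<Sum>k<n. P k) = c * (\<psi> 1 - \<psi> (Suc n))"
      unfolding P_def sum_distrib_left[symmetric] using sum_lessThan_telescope'[of "\<lambda>k. \<psi> (Suc k)" n] by simp
    also have "\<dots> \<le> c * \<psi> 1" using c by (intro mult_left_mono) (simp_all add: \<psi>_def)
    finally have "(\<Sum>k<n. P k) \<le> c * \<psi> 1" .
    moreover have "(\<Sum>k<n. e k) \<le> suminf e" using e by (intro sum_le_suminf) auto
    ultimately show ?thesis by (simp add: sum.distrib sum_divide_distrib[symmetric])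
  qed
  then show ?thesis by (intro summable_half_recursion[where b = "\<lambda>k. e k / 2 + P k / 2"] D rec)
qed

lemma quad_subgradient_imp_frechet:
  fixes \<Phi> :: "'a::euclidean_space \<Rightarrow> ereal"
  assumes q: "quad_subgradient \<Phi> K x r u"
  shows "u \<in> frechet_subdiff \<Phi> x"
proof -
  have r: "\<Phi> x = ereal r" and ge: "\<And>w. ereal (r + u \<bullet> (w - x) - K * (norm (w - x))\<^sup>2) \<le> \<Phi> w"
    using q by (auto simp: quad_subgradient_def)
  have le: "ereal (- K * norm (y - x)) \<le> (\<Phi> y - \<Phi> x - ereal (u \<bullet> (y - x))) / ereal (norm (y - x))"
    if "y \<noteq> x" for y
  proof (cases "\<Phi> y")
    case (real v)
    have n: "norm (y - x) > 0" using that by simp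
    have "- K * (norm (y - x))\<^sup>2 \<le> v - r - u \<bullet> (y - x)" using ge[of y] real by simp
    then have "- K * norm (y - x) \<le> (v - r - u \<bullet> (y - x)) / norm (y - x)"
      using n by (simp add: pos_le_divide_eq power2_eq_square algebra_simps)
    then show ?thesis using n by (simp add: real r)
  next
    case PInf
    then show ?thesis using that by (simp add: r)
  next
    case MInf
    then show ?thesis using ge[of y] by simp
  qed
  have "((\<lambda>y. ereal (- K * norm (y - x))) \<longlongrightarrow> ereal (- K * norm (x - x))) (at x)"
    by (intro tendsto_intros)
  then have "Liminf (at x) (\<lambda>y. ereal (- K * norm (y - x))) = 0"
    by (intro lim_imp_Liminf) (auto simp: zero_ereal_def)
  moreover have "Liminf (at x) (\<lambda>y. ereal (- K * norm (y - x)))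
     \<le> Liminf (at x) (\<lambda>y. (\<Phi> y - \<Phi> x - ereal (u \<bullet> (y - x))) / ereal (norm (y - x)))"
    by (rule Liminf_mono) (use le in \<open>auto simp: eventually_at_filter\<close>)
  ultimately show ?thesis using r by (simp add: frechet_subdiff_def)
qed

lemma powr_add_le_twice:
  fixes s t \<theta> :: real
  assumes "0 \<le> s" "0 \<le> t" "0 \<le> \<theta>" "\<theta> \<le> 1"
  shows "(s + t) powr \<theta> \<le> 2 * (s powr \<theta> + t powr \<theta>)"
proof -
  have "(s + t) powr \<theta> \<le> (2 * max s t) powr \<theta>" using assms by (intro powr_mono2) auto
  also have "\<dots> = 2 powr \<theta> * max s t powr \<theta>" using assms by (simp add: powr_mult)
  also have "\<dots> \<le> 2 * (s powr \<theta> + t powr \<theta>)"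
    using assms powr_mono[of \<theta> 1 2] by (intro mult_mono) (auto simp: max_def)
  finally show ?thesis .
qed

text \<open>
  The sequence \<open>T\<close> absorbs the errors in the decrease of the objective, and \<open>\<sigma>\<close> is an exponent from which on
  its powers are summable. When the value \<open>\<phi> (Suc n)\<close> lies below the limit value \<open>c\<close>, the inequality of
  Lojasiewicz is not available, but then the excess of \<open>\<phi> + T\<close> over \<open>c\<close> is at most \<open>T\<close>.
\<close>
theorem noisy_descent_converges:
  fixes \<Phi> :: "'a::euclidean_space \<Rightarrow> ereal" and X U :: "nat \<Rightarrow> 'a" and \<phi> \<epsilon> T :: "nat \<Rightarrow> real"
  assumes graph: "definable (\<lambda>p::'a \<times> real. \<Phi> (fst p) = ereal (snd p))" and ninf: "\<And>x. \<Phi> x \<noteq> -\<infinity>"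
    and lsc: "\<And>X x b. X \<longlonglongrightarrow> x \<Longrightarrow> (\<And>j::nat. \<Phi> (X j) \<le> ereal b) \<Longrightarrow> \<Phi> x \<le> ereal b"
    and K: "0 \<le> K" and a: "0 < a" and C: "0 \<le> C"
    and sub: "\<And>n. quad_subgradient \<Phi> K (X n) (\<phi> n) (U n)"
    and Ub: "\<And>n. norm (U (Suc n)) \<le> C * (norm (X (Suc n) - X n) + \<epsilon> n)"
    and dec: "\<And>n. \<phi> (Suc n) + T (Suc n) \<le> \<phi> n + T n - a * (norm (X (Suc n) - X n))\<^sup>2"
    and bnd: "\<And>n. norm (X n) \<le> \<rho>"
    and \<epsilon>: "\<And>n. 0 \<le> \<epsilon> n" "summable \<epsilon>"
    and T: "\<And>n. 0 \<le> T n" "T \<longlonglongrightarrow> 0"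
    and \<sigma>: "\<sigma> < 1" "\<And>\<theta>. \<sigma> \<le> \<theta> \<Longrightarrow> \<theta> < 1 \<Longrightarrow> summable (\<lambda>n. T n powr \<theta>)"
  shows "summable (\<lambda>n. norm (X (Suc n) - X n)) \<and> (\<exists>xs. X \<longlonglongrightarrow> xs \<and> critical_point \<Phi> xs)"
proof -
  define D where "D n = norm (X (Suc n) - X n)" for n
  define F where "F n = \<phi> n + T n" for n
  have val: "\<Phi> (X n) = ereal (\<phi> n)" for n using sub by (simp add: quad_subgradient_def)
  have Fdec: "a * (D n)\<^sup>2 \<le> F n - F (Suc n)" for n using dec[of n] by (simp add: F_def D_def)
  have "decseq F"
  proof (rule decseq_SucI)
    fix n
    have "0 \<le> a * (D n)\<^sup>2" using a by simp
    then show "F (Suc n) \<le> F n" using Fdec[of n] by linarith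
  qed
  \<comment> \<open>The quadratic minorant at \<open>X 0\<close> bounds \<open>\<Phi>\<close> from below on the bounded sequence.\<close>
  have "\<phi> 0 - norm (U 0) * (2 * \<rho>) - K * (2 * \<rho>)\<^sup>2 \<le> F n" for n
  proof -
    have d: "norm (X n - X 0) \<le> 2 * \<rho>" using norm_triangle_ineq4[of "X n" "X 0"] bnd[of n] bnd[of 0] by linarith
    have "ereal (\<phi> 0 + U 0 \<bullet> (X n - X 0) - K * (norm (X n - X 0))\<^sup>2) \<le> ereal (\<phi> n)"
      using sub[of 0] val[of n] unfolding quad_subgradient_def by metis
    then have "\<phi> 0 + U 0 \<bullet> (X n - X 0) - K * (norm (X n - X 0))\<^sup>2 \<le> \<phi> n" by simp
    moreover have "- (norm (U 0) * (2 * \<rho>)) \<le> U 0 \<bullet> (X n - X 0)"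
      using Cauchy_Schwarz_ineq2[of "U 0" "X n - X 0"] mult_left_mono[OF d norm_ge_zero[of "U 0"]] by linarith
    moreover have "K * (norm (X n - X 0))\<^sup>2 \<le> K * (2 * \<rho>)\<^sup>2"
      using d K by (intro mult_left_mono power_mono) auto
    ultimately show ?thesis using T(1)[of n] unfolding F_def by linarith
  qed
  then obtain c where c: "F \<longlonglongrightarrow> c" "\<And>n. c \<le> F n"
    using decseq_convergent[OF \<open>decseq F\<close>] by metis
  have \<phi>c: "\<phi> \<longlonglongrightarrow> c" using tendsto_diff[OF c(1) T(2)] by (simp add: F_def)
  have "\<exists>\<theta> C \<delta>. 0 \<le> \<theta> \<and> \<theta> < 1 \<and> 0 \<le> C \<and> 0 < \<delta> \<and>
    (\<forall>x u t. norm x \<le> \<rho> \<longrightarrow> 0 < t \<longrightarrow> t < \<delta> \<longrightarrow> quad_subgradient \<Phi> K x (c + t) u \<longrightarrow> t powr \<theta> \<le> C * norm u)"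
    by (rule definable_Lojasiewicz[OF graph ninf lsc K])
  then obtain \<theta>1 C1 \<delta> where \<theta>1: "0 \<le> \<theta>1" "\<theta>1 < 1" and C1: "0 \<le> C1" and \<delta>: "0 < \<delta>"
    and KL: "\<And>x u t. norm x \<le> \<rho> \<Longrightarrow> 0 < t \<Longrightarrow> t < \<delta> \<Longrightarrow> quad_subgradient \<Phi> K x (c + t) u \<Longrightarrow> t powr \<theta>1 \<le> C1 * norm u"
    by blast
  define \<theta> where "\<theta> = max \<theta>1 \<sigma>"
  have \<theta>: "0 \<le> \<theta>" "\<theta> < 1" "\<theta>1 \<le> \<theta>" "\<sigma> \<le> \<theta>" using \<theta>1 \<sigma>(1) by (auto simp: \<theta>_def)
  have "\<forall>\<^sub>F n in sequentially. \<phi> n < c + min \<delta> 1"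
    using order_tendstoD(2)[OF \<phi>c, of "c + min \<delta> 1"] \<delta> by simp
  then obtain n0 where n0: "\<And>n. n \<ge> n0 \<Longrightarrow> \<phi> n < c + min \<delta> 1" unfolding eventually_sequentially by blast
  have sumT: "summable (\<lambda>n. T n powr \<theta>)" using \<sigma>(2) \<theta> by blast
  define e where "e n = 2 * C1 * C * \<epsilon> n + 2 * T (Suc n) powr \<theta>" for n
  have e0: "0 \<le> e n" for n using C1 C \<epsilon>(1) by (simp add: e_def)
  have "summable e" unfolding e_def
    using \<epsilon>(2) sumT summable_Suc_iff[of "\<lambda>n. T n powr \<theta>"] by (intro summable_add summable_mult) simp_all
  have loj: "(F (Suc n) - c) powr \<theta> \<le> 2 * C1 * C * D n + e n" if n: "n \<ge> n0" for n
  proof (cases "\<phi> (Suc n) \<le> c")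
    case True
    then have "(F (Suc n) - c) powr \<theta> \<le> T (Suc n) powr \<theta>"
      using c(2)[of "Suc n"] \<theta> by (intro powr_mono2) (auto simp: F_def)
    also have "\<dots> \<le> 2 * T (Suc n) powr \<theta>" by simp
    also have "\<dots> \<le> 2 * C1 * C * D n + e n" using C1 C \<epsilon>(1) by (simp add: e_def D_def)
    finally show ?thesis .
  next
    case False
    define t where "t = \<phi> (Suc n) - c"
    have t: "0 < t" "t < \<delta>" "t < 1" using False n0[of "Suc n"] n by (auto simp: t_def)
    have "t powr \<theta> \<le> t powr \<theta>1" using t \<theta> by (intro powr_mono') auto
    also have "\<dots> \<le> C1 * norm (U (Suc n))"
      using KL[OF bnd t(1,2), of "Suc n"] sub[of "Suc n"] by (simp add: t_def)
    also have "\<dots> \<le> C1 * (C * (D n + \<epsilon> n))" using Ub[of n] C1 by (intro mult_left_mono) (auto simp: D_def)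
    finally have t\<theta>: "t powr \<theta> \<le> C1 * C * D n + C1 * C * \<epsilon> n" by (simp add: algebra_simps)
    have "(F (Suc n) - c) powr \<theta> = (t + T (Suc n)) powr \<theta>" by (simp add: F_def t_def algebra_simps)
    also have "\<dots> \<le> 2 * (t powr \<theta> + T (Suc n) powr \<theta>)"
      using t T(1) \<theta> by (intro powr_add_le_twice) auto
    also have "\<dots> \<le> 2 * C1 * C * D n + e n" using t\<theta> by (simp add: e_def algebra_simps)
    finally show ?thesis .
  qed
  have "summable (\<lambda>n. D (n + n0))"
  proof (rule summable_of_Lojasiewicz_decrease[OF a _ \<theta>(1,2)])
    show "0 \<le> 2 * C1 * C" using C1 C by simp
    show "0 \<le> F (n + n0) - c" for n using c(2) by simp
    show "summable (\<lambda>n. e (n + n0))" using \<open>summable e\<close> by (rule summable_ignore_initial_segment)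
    show "a * (D (n + n0))\<^sup>2 \<le> (F (n + n0) - c) - (F (Suc n + n0) - c)" for n using Fdec[of "n + n0"] by simp
    show "(F (Suc n + n0) - c) powr \<theta> \<le> 2 * C1 * C * D (n + n0) + e (n + n0)" for n using loj[of "n + n0"] by simp
  qed (use e0 in \<open>auto simp: D_def\<close>)
  then have sumD: "summable D" by (simp add: summable_iff_shift)
  have "summable (\<lambda>n. X (Suc n) - X n)" by (rule summable_norm_cancel) (use sumD in \<open>simp add: D_def[abs_def]\<close>)
  then have "(\<lambda>n. \<Sum>k<n. X (Suc k) - X k) \<longlonglongrightarrow> (\<Sum>k. X (Suc k) - X k)" by (rule summable_LIMSEQ)
  then have "(\<lambda>n. X n - X 0) \<longlonglongrightarrow> (\<Sum>k. X (Suc k) - X k)" by (simp add: sum_lessThan_telescope)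
  from tendsto_add[OF this tendsto_const[of "X 0"]]
  obtain xs where xs: "X \<longlonglongrightarrow> xs" by auto
  have U0: "(\<lambda>n. U (Suc n)) \<longlonglongrightarrow> 0"
  proof (rule Lim_null_comparison)
    show "\<forall>\<^sub>F n in sequentially. norm (U (Suc n)) \<le> C * (D n + \<epsilon> n)"
      by (rule always_eventually) (use Ub in \<open>simp add: D_def\<close>)
    have "(\<lambda>n. C * (D n + \<epsilon> n)) \<longlonglongrightarrow> C * (0 + 0)"
      by (intro tendsto_intros summable_LIMSEQ_zero sumD \<epsilon>(2))
    then show "(\<lambda>n. C * (D n + \<epsilon> n)) \<longlonglongrightarrow> 0" by simp
  qed
  have "\<Phi> xs = ereal c"
  proof (rule antisym)
    show "ereal c \<le> \<Phi> xs"
    proof (rule LIMSEQ_le_const2)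
      have "(\<lambda>n. \<phi> (Suc n) + U (Suc n) \<bullet> (xs - X (Suc n)) - K * (norm (xs - X (Suc n)))\<^sup>2)
          \<longlonglongrightarrow> c + 0 \<bullet> (xs - xs) - K * (norm (xs - xs))\<^sup>2"
        by (intro tendsto_intros U0 LIMSEQ_Suc[OF xs] LIMSEQ_Suc[OF \<phi>c])
      then show "(\<lambda>n. ereal (\<phi> (Suc n) + U (Suc n) \<bullet> (xs - X (Suc n)) - K * (norm (xs - X (Suc n)))\<^sup>2)) \<longlonglongrightarrow> ereal c"
        by simp
      show "\<exists>N. \<forall>n\<ge>N. ereal (\<phi> (Suc n) + U (Suc n) \<bullet> (xs - X (Suc n)) - K * (norm (xs - X (Suc n)))\<^sup>2) \<le> \<Phi> xs"
        using sub by (auto simp: quad_subgradient_def)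
    qed
    show "\<Phi> xs \<le> ereal c"
    proof (rule ereal_le_epsilon2)
      fix d :: real assume "0 < d"
      then have "\<forall>\<^sub>F n in sequentially. \<phi> n < c + d" using order_tendstoD(2)[OF \<phi>c, of "c + d"] by simp
      then obtain n1 where n1: "\<And>n. n \<ge> n1 \<Longrightarrow> \<phi> n < c + d" unfolding eventually_sequentially by blast
      have "\<Phi> xs \<le> ereal (c + d)"
        by (rule lsc[OF LIMSEQ_ignore_initial_segment[OF xs, of n1]]) (use n1 in \<open>simp add: val less_imp_le\<close>)
      then show "\<Phi> xs \<le> ereal c + ereal d" by simp
    qed
  qed
  moreover have "(\<lambda>n. \<Phi> (X (Suc n))) \<longlonglongrightarrow> ereal c" using LIMSEQ_Suc[OF \<phi>c] by (simp add: val)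
  ultimately have "critical_point \<Phi> xs"
    unfolding critical_point_def limiting_subdiff_def mem_Collect_eq
    using LIMSEQ_Suc[OF xs] U0 quad_subgradient_imp_frechet[OF sub]
    by (intro exI[of _ "\<lambda>n. X (Suc n)"] exI[of _ "\<lambda>n. U (Suc n)"]) simp
  then show ?thesis using sumD xs by (auto simp: D_def[abs_def])
qed

section \<open>Partial gradients, proximal points and separable sums\<close>

text \<open>
  The gradient represents the derivative; it is the adjoint of the derivative applied to \<open>1\<close>.
\<close>
lemma GDERIV_gradient:
  fixes F :: "'a::euclidean_space \<Rightarrow> real"
  assumes "F differentiable (at x)"
  shows "GDERIV F x :> gradient F x"
proof -
  obtain F' where F': "(F has_derivative F') (at x)" using assms by (auto simp: differentiable_def)
  have lin: "linear F'" using has_derivative_linear[OF F'] .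
  have "(\<lambda>h. h \<bullet> adjoint F' 1) = F'" using adjoint_works[OF lin, of _ 1] by (simp add: fun_eq_iff)
  then have ex: "GDERIV F x :> adjoint F' 1" unfolding gderiv_def using F' by simp
  have "D = adjoint F' 1" if "GDERIV F x :> D" for D
  proof -
    have eq: "(\<lambda>h. h \<bullet> D) = (\<lambda>h. h \<bullet> adjoint F' 1)"
      by (rule has_derivative_unique[OF that[unfolded gderiv_def] ex[unfolded gderiv_def]])
    have "h \<bullet> D = h \<bullet> adjoint F' 1" for h using fun_cong[OF eq, of h] .
    then show ?thesis using vector_eq_ldot by blast
  qed
  then show ?thesis unfolding gradient_def by (rule theI[where P = "\<lambda>D. GDERIV F x :> D", OF ex])
qed

lemma GDERIV_grad_fst:
  fixes H :: "'a::euclidean_space \<times> 'b::euclidean_space \<Rightarrow> real"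
  assumes "\<And>w. H differentiable (at w)"
  shows "GDERIV (\<lambda>y. H (y, v)) y :> grad_fst H (y, v)"
proof -
  have "(\<lambda>y. H (y, v)) differentiable (at y)"
    using differentiable_chain_at[of "\<lambda>y. (y, v)" y H] assms
    by (simp add: o_def differentiable_Pair)
  from GDERIV_gradient[OF this] show ?thesis by (simp add: grad_fst_def)
qed

lemma GDERIV_grad_snd:
  fixes H :: "'a::euclidean_space \<times> 'b::euclidean_space \<Rightarrow> real"
  assumes "\<And>w. H differentiable (at w)"
  shows "GDERIV (\<lambda>z. H (u, z)) z :> grad_snd H (u, z)"
proof -
  have "(\<lambda>z. H (u, z)) differentiable (at z)"
    using differentiable_chain_at[of "\<lambda>z. (u, z)" z H] assms
    by (simp add: o_def differentiable_Pair)
  from GDERIV_gradient[OF this] show ?thesis by (simp add: grad_snd_def)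
qed

lemma descent_inequality:
  fixes F :: "'a::real_inner \<Rightarrow> real"
  assumes F: "\<And>x. GDERIV F x :> G x" and lip: "\<And>x y. norm (G x - G y) \<le> M * norm (x - y)"
  shows "F y \<le> F x + G x \<bullet> (y - x) + M / 2 * (norm (y - x))\<^sup>2"
proof -
  define d where "d = y - x"
  define \<phi> where "\<phi> s = F (x + s *\<^sub>R d) - s * (G x \<bullet> d) - M / 2 * s\<^sup>2 * (norm d)\<^sup>2" for s
  have der: "(\<phi> has_real_derivative (G (x + s *\<^sub>R d) \<bullet> d - G x \<bullet> d - M * s * (norm d)\<^sup>2)) (at s)" for s
  proof -
    have "((\<lambda>s. x + s *\<^sub>R d) has_derivative (\<lambda>h. h *\<^sub>R d)) (at s)"
      by (auto intro!: derivative_eq_intros)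
    from has_derivative_compose[OF this F[of "x + s *\<^sub>R d", unfolded gderiv_def]]
    have "((\<lambda>s. F (x + s *\<^sub>R d)) has_derivative (\<lambda>h. (h *\<^sub>R d) \<bullet> G (x + s *\<^sub>R d))) (at s)" .
    then have "((\<lambda>s. F (x + s *\<^sub>R d)) has_real_derivative (G (x + s *\<^sub>R d) \<bullet> d)) (at s)"
      unfolding has_field_derivative_def by (simp add: inner_commute mult.commute[of _ "_ \<bullet> _"])
    then show ?thesis unfolding \<phi>_def by (auto intro!: derivative_eq_intros)
  qed
  have "\<phi> 1 \<le> \<phi> 0"
  proof (rule DERIV_nonpos_imp_nonincreasing[of 0 1])
    fix s :: real assume s: "0 \<le> s" "s \<le> 1"
    have "G (x + s *\<^sub>R d) \<bullet> d - G x \<bullet> d \<le> norm (G (x + s *\<^sub>R d) - G x) * norm d"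
      by (simp add: inner_diff_left[symmetric] norm_cauchy_schwarz)
    also have "\<dots> \<le> (M * norm ((x + s *\<^sub>R d) - x)) * norm d" by (intro mult_right_mono lip) simp
    also have "\<dots> = M * s * (norm d)\<^sup>2" using s by (simp add: power2_eq_square)
    finally show "\<exists>D. (\<phi> has_real_derivative D) (at s) \<and> D \<le> 0" using der[of s] by (intro exI) auto
  qed simp
  then show ?thesis by (simp add: \<phi>_def d_def)
qed

lemma descent_inequality_lower:
  fixes F :: "'a::real_inner \<Rightarrow> real"
  assumes F: "\<And>x. GDERIV F x :> G x" and lip: "\<And>x y. norm (G x - G y) \<le> M * norm (x - y)"
  shows "F x + G x \<bullet> (y - x) - M / 2 * (norm (y - x))\<^sup>2 \<le> F y"
proof -
  have "- F y \<le> - F x + (- G x) \<bullet> (y - x) + M / 2 * (norm (y - x))\<^sup>2"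
  proof (rule descent_inequality[of "\<lambda>x. - F x" "\<lambda>x. - G x"])
    show "GDERIV (\<lambda>x. - F x) x :> - G x" for x
      using has_derivative_minus[OF F[of x, unfolded gderiv_def]] by (simp add: gderiv_def)
    show "norm (- G x - - G y) \<le> M * norm (x - y)" for x y
      using lip[of x y] by (simp add: norm_minus_commute)
  qed
  then show ?thesis by simp
qed

text \<open>
  Expanding the square in the minimality condition at \<open>y\<close>.
\<close>
lemma prox_quad_subgradient:
  fixes f :: "'a::euclidean_space \<Rightarrow> ereal"
  assumes f: "proper_fun f" and \<gamma>: "0 < \<gamma>" and y: "y \<in> prox (\<lambda>u. ereal \<gamma> * f u) q"
  shows "\<exists>r. quad_subgradient f (1 / (2 * \<gamma>)) y r ((1 / \<gamma>) *\<^sub>R (q - y))"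
proof -
  have ninf: "\<And>x. f x \<noteq> -\<infinity>" and "\<exists>x. f x < \<infinity>" using f by (auto simp: proper_fun_def)
  then obtain x0 r0 where x0: "f x0 = ereal r0" by (metis ereal_cases less_irrefl)
  have le: "ereal \<gamma> * f y + ereal ((norm (y - q))\<^sup>2 / 2) \<le> ereal \<gamma> * f w + ereal ((norm (w - q))\<^sup>2 / 2)" for w
    using y by (auto simp: prox_def is_arg_min_linorder)
  have "f y \<noteq> \<infinity>" using le[of x0] \<gamma> x0 by auto
  then obtain r where r: "f y = ereal r" using ninf[of y] by (cases "f y") auto
  have "ereal (r + ((1 / \<gamma>) *\<^sub>R (q - y)) \<bullet> (w - y) - 1 / (2 * \<gamma>) * (norm (w - y))\<^sup>2) \<le> f w" for w
  proof (cases "f w")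
    case (real v)
    have "\<gamma> * r + (norm (y - q))\<^sup>2 / 2 \<le> \<gamma> * v + (norm (w - q))\<^sup>2 / 2" using le[of w] r real by simp
    moreover have "(norm (w - q))\<^sup>2 = (norm (w - y))\<^sup>2 + (norm (y - q))\<^sup>2 - 2 * ((q - y) \<bullet> (w - y))"
      by (simp add: power2_norm_eq_inner inner_diff_left inner_diff_right inner_commute)
    moreover have "\<gamma> * (r + (1 / \<gamma>) * ((q - y) \<bullet> (w - y)) - 1 / (2 * \<gamma>) * (norm (w - y))\<^sup>2)
        = \<gamma> * r + (q - y) \<bullet> (w - y) - (norm (w - y))\<^sup>2 / 2"
      using \<gamma> by (simp add: right_diff_distrib distrib_left)
    ultimately have "\<gamma> * (r + (1 / \<gamma>) * ((q - y) \<bullet> (w - y)) - 1 / (2 * \<gamma>) * (norm (w - y))\<^sup>2) \<le> \<gamma> * v"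
      by linarith
    then show ?thesis using \<gamma> by (simp add: real)
  qed (use ninf[of w] in auto)
  then show ?thesis using r by (auto simp: quad_subgradient_def)
qed

lemma lsc_fun_eventually:
  assumes "lsc_fun f" "a < f x" "X \<longlonglongrightarrow> x"
  shows "\<forall>\<^sub>F n in sequentially. a < f (X n)"
proof -
  have "a < Liminf (at x) f" using assms(1,2) unfolding lsc_fun_def by (meson less_le_trans)
  then have "\<forall>\<^sub>F w in at x. a < f w" by (rule less_LiminfD)
  then have "\<forall>\<^sub>F w in nhds x. a < f w" using assms(2) by (auto simp: eventually_at_filter elim!: eventually_mono)
  then show ?thesis using assms(3) by (rule eventually_compose_filterlim)
qed

text \<open>
  If the sum exceeded \<open>b\<close> at the limit, real lower bounds \<open>p\<close> and \<open>q\<close> for the two lower semicontinuous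
  terms, valid along the sequence, would already push it above \<open>b\<close>.
\<close>
lemma lsc_separable_sum:
  fixes f :: "'a::euclidean_space \<Rightarrow> ereal" and g :: "'b::euclidean_space \<Rightarrow> ereal"
  assumes f: "proper_fun f" "lsc_fun f" and g: "proper_fun g" "lsc_fun g"
    and H: "\<And>w. H differentiable (at w)"
    and X: "X \<longlonglongrightarrow> x" and le: "\<And>j::nat. f (fst (X j)) + ereal (H (X j)) + g (snd (X j)) \<le> ereal b"
  shows "f (fst x) + ereal (H x) + g (snd x) \<le> ereal b"
proof (rule ccontr)
  assume "\<not> ?thesis"
  then have gt: "ereal b < f (fst x) + ereal (H x) + g (snd x)" by simp
  have ninf: "f u \<noteq> -\<infinity>" "g v \<noteq> -\<infinity>" for u v using f g by (auto simp: proper_fun_def)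
  have "\<exists>p q e. ereal p < f (fst x) \<and> ereal q < g (snd x) \<and> 0 < e \<and> b \<le> p + q + H x - e"
  proof (cases "f (fst x)"; cases "g (snd x)")
    fix r s assume rs: "f (fst x) = ereal r" "g (snd x) = ereal s"
    define e where "e = (r + s + H x - b) / 3"
    have "0 < e" using gt rs by (simp add: e_def)
    then show ?thesis using rs by (intro exI[of _ "r - e"] exI[of _ "s - e"] exI[of _ e]) (auto simp: e_def field_simps)
  next
    fix r assume rs: "f (fst x) = ereal r" "g (snd x) = \<infinity>"
    then show ?thesis by (intro exI[of _ "r - 1"] exI[of _ "b - H x - r + 2"] exI[of _ 1]) auto
  next
    fix s assume rs: "f (fst x) = \<infinity>" "g (snd x) = ereal s"
    then show ?thesis by (intro exI[of _ "b - H x - s + 2"] exI[of _ "s - 1"] exI[of _ 1]) auto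
  next
    assume rs: "f (fst x) = \<infinity>" "g (snd x) = \<infinity>"
    then show ?thesis by (intro exI[of _ "b - H x + 1"] exI[of _ 0] exI[of _ 1]) auto
  qed (use ninf in auto)
  then obtain p q e where pq: "ereal p < f (fst x)" "ereal q < g (snd x)" "0 < e" "b \<le> p + q + H x - e" by blast
  have "isCont H x" using H by (simp add: differentiable_imp_continuous_within)
  then have HX: "(\<lambda>n. H (X n)) \<longlonglongrightarrow> H x" using X by (rule isCont_tendsto_compose)
  have "\<forall>\<^sub>F n in sequentially. H x - e < H (X n)" by (rule order_tendstoD(1)[OF HX]) (use pq in simp)
  moreover have "\<forall>\<^sub>F n in sequentially. ereal p < f (fst (X n))"
    by (rule lsc_fun_eventually[OF f(2) pq(1) tendsto_fst[OF X]])
  moreover have "\<forall>\<^sub>F n in sequentially. ereal q < g (snd (X n))"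
    by (rule lsc_fun_eventually[OF g(2) pq(2) tendsto_snd[OF X]])
  ultimately have "\<forall>\<^sub>F n::nat in sequentially. False"
  proof eventually_elim
    case (elim n)
    then have "ereal b < f (fst (X n)) + ereal (H (X n)) + g (snd (X n))"
      using pq(4) ninf(1)[of "fst (X n)"] ninf(2)[of "snd (X n)"]
      by (cases "f (fst (X n))"; cases "g (snd (X n))") auto
    then show ?case using le[of n] by simp
  qed
  then show False by simp
qed

lemma definable_separable_sum:
  fixes f :: "'a::euclidean_space \<Rightarrow> ereal" and g :: "'b::euclidean_space \<Rightarrow> ereal"
  assumes f: "proper_fun f" "semialgebraic_fun f" and g: "proper_fun g" "semialgebraic_fun g"
    and H: "semialgebraic_fun (\<lambda>w. ereal (H w))"
  shows "definable (\<lambda>p::('a \<times> 'b) \<times> real. f (fst (fst p)) + ereal (H (fst p)) + g (snd (fst p)) = ereal (snd p))"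
proof -
  have gr: "definable (\<lambda>x. J (k x) = ereal (l x))"
    if "semialgebraic_fun J" "polynomial_function k" "polynomial_function l"
    for J :: "'e::euclidean_space \<Rightarrow> ereal" and k and l :: "'z::real_normed_vector \<Rightarrow> real"
    using definable_compose[OF definable_semialgebraic[OF that(1)[unfolded semialgebraic_fun_def]]
      polynomial_function_Pair[OF that(2,3)]] by simp
  have "definable (\<lambda>p::('a \<times> 'b) \<times> real. \<exists>a. \<exists>b. \<exists>c. f (fst (fst p)) = ereal a \<and> ereal (H (fst p)) = ereal b \<and>
     g (snd (fst p)) = ereal c \<and> snd p = a + b + c)"
    by (intro definable_ex definable_conj gr[OF f(2)] gr[OF g(2)] gr[OF H] definable_eq term_intros)
  moreover have "(\<exists>a. \<exists>b. \<exists>c. f (fst (fst p)) = ereal a \<and> ereal (H (fst p)) = ereal b \<and>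
     g (snd (fst p)) = ereal c \<and> snd p = a + b + c) \<longleftrightarrow>
     f (fst (fst p)) + ereal (H (fst p)) + g (snd (fst p)) = ereal (snd p)" for p :: "('a \<times> 'b) \<times> real"
  proof -
    have "f (fst (fst p)) \<noteq> -\<infinity>" "g (snd (fst p)) \<noteq> -\<infinity>" using f g by (auto simp: proper_fun_def)
    then show ?thesis by (cases "f (fst (fst p))"; cases "g (snd (fst p))") auto
  qed
  ultimately show ?thesis by simp
qed

text \<open>
  By the mean value theorem the decrement at \<open>k\<close> is of order \<open>k powr (-p - 1)\<close>, and \<open>p + 1 \<le> 2 * p\<close>.
\<close>
lemma powr_tail_decrement:
  assumes "p > 1"
  shows "\<exists>c>0. \<forall>k\<ge>1. c * (1 / real k powr p)\<^sup>2 \<le> 1 / real k powr p - 1 / real (Suc k) powr p"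
proof (intro exI[of _ "p / 2 powr (p + 1)"] conjI allI impI)
  show "0 < p / 2 powr (p + 1)" using assms by simp
  fix k :: nat assume k: "1 \<le> k"
  define t where "t = real k"
  have t: "1 \<le> t" using k by (simp add: t_def)
  have "\<exists>z. t < z \<and> z < t + 1 \<and> (t + 1) powr (-p) - t powr (-p) = ((t + 1) - t) * ((-p) * z powr (-p - 1))"
  proof (rule MVT2)
    show "((\<lambda>x. x powr (-p)) has_real_derivative (-p) * x powr (-p - 1)) (at x)" if "t \<le> x" for x
      using that t by (auto intro!: derivative_eq_intros)
  qed simp
  then obtain z where z: "t < z" "z < t + 1" "t powr (-p) - (t + 1) powr (-p) = p * z powr (-p - 1)" by auto
  have "-p - 1 = - (p + 1)" by simp
  then have "2 powr (-p - 1) = 1 / 2 powr (p + 1)" by (simp only: powr_minus_divide)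
  then have "p / 2 powr (p + 1) = p * 2 powr (-p - 1)" by simp
  moreover have "(t powr (-p))\<^sup>2 = t powr (-2 * p)" by (simp add: power2_eq_square powr_add[symmetric])
  ultimately have "p / 2 powr (p + 1) * (t powr (-p))\<^sup>2 = p * (2 powr (-p - 1) * t powr (-2 * p))" by simp
  also have "\<dots> \<le> p * (2 powr (-p - 1) * t powr (-p - 1))"
    using t assms by (intro mult_left_mono powr_mono) auto
  also have "2 powr (-p - 1) * t powr (-p - 1) = (2 * t) powr (-p - 1)" using t by (simp add: powr_mult)
  also have "p * (2 * t) powr (-p - 1) \<le> p * z powr (-p - 1)"
    using t z assms by (intro mult_left_mono powr_mono2') auto
  also have "\<dots> = t powr (-p) - (t + 1) powr (-p)" using z(3) by simp
  finally show "p / 2 powr (p + 1) * (1 / real k powr p)\<^sup>2 \<le> 1 / real k powr p - 1 / real (Suc k) powr p"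
    by (simp add: t_def powr_minus divide_inverse add.commute)
qed

section \<open>One inexact step\<close>

text \<open>
  The segment from \<open>(y, z)\<close> to \<open>(u, v)\<close> is replaced by the path through \<open>(y, v)\<close>, along which one block
  varies at a time. The first gradient is taken at \<open>(y, v)\<close>; moving it to \<open>(y, z)\<close> costs the mixed term
  that the joint Lipschitz bound controls.
\<close>
lemma partial_gradients_lower_bound:
  fixes H :: "'a::euclidean_space \<times> 'b::euclidean_space \<Rightarrow> real"
  assumes H: "\<And>w. H differentiable (at w)"
    and lipy: "\<And>y1 y2 v. norm (grad_fst H (y1, v) - grad_fst H (y2, v)) \<le> M * norm (y1 - y2)"
    and lipz: "\<And>u z1 z2. norm (grad_snd H (u, z1) - grad_snd H (u, z2)) \<le> N * norm (z1 - z2)"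
    and lip: "\<And>x1 x2. norm (grad_fst H x1 - grad_fst H x2) \<le> L * norm (x1 - x2)" and L: "0 \<le> L"
  shows "H (y, z) + grad_fst H (y, z) \<bullet> (u - y) + grad_snd H (y, z) \<bullet> (v - z)
      - (M + L) / 2 * (norm (u - y))\<^sup>2 - (N + L) / 2 * (norm (v - z))\<^sup>2 \<le> H (u, v)"
proof -
  have 1: "H (y, v) + grad_fst H (y, v) \<bullet> (u - y) - M / 2 * (norm (u - y))\<^sup>2 \<le> H (u, v)"
    by (rule descent_inequality_lower[of "\<lambda>y. H (y, v)" "\<lambda>y. grad_fst H (y, v)"])
       (rule GDERIV_grad_fst[OF H], rule lipy)
  have 2: "H (y, z) + grad_snd H (y, z) \<bullet> (v - z) - N / 2 * (norm (v - z))\<^sup>2 \<le> H (y, v)"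
    by (rule descent_inequality_lower[of "\<lambda>z. H (y, z)" "\<lambda>z. grad_snd H (y, z)"])
       (rule GDERIV_grad_snd[OF H], rule lipz)
  have "(grad_fst H (y, z) - grad_fst H (y, v)) \<bullet> (u - y) \<le> norm (grad_fst H (y, z) - grad_fst H (y, v)) * norm (u - y)"
    by (rule norm_cauchy_schwarz)
  also have "\<dots> \<le> (L * norm ((y, z) - (y, v))) * norm (u - y)" by (intro mult_right_mono lip) simp
  also have "norm ((y, z) - (y, v)) = norm (v - z)" by (simp add: norm_Pair norm_minus_commute)
  also have "(L * norm (v - z)) * norm (u - y) = L * (norm (v - z) * norm (u - y))" by simp
  also have "\<dots> \<le> L * (((norm (u - y))\<^sup>2 + (norm (v - z))\<^sup>2) / 2)"
  proof (rule mult_left_mono[OF _ L])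
    have "b * a \<le> (a\<^sup>2 + b\<^sup>2) / 2" for a b :: real using sum_squares_bound[of a b] by (simp add: mult_ac)
    then show "norm (v - z) * norm (u - y) \<le> ((norm (u - y))\<^sup>2 + (norm (v - z))\<^sup>2) / 2" .
  qed
  finally have 3: "(grad_fst H (y, z) - grad_fst H (y, v)) \<bullet> (u - y) \<le> L / 2 * (norm (u - y))\<^sup>2 + L / 2 * (norm (v - z))\<^sup>2"
    by (simp add: distrib_left)
  have "(M + L) / 2 * (norm (u - y))\<^sup>2 = M / 2 * (norm (u - y))\<^sup>2 + L / 2 * (norm (u - y))\<^sup>2"
    "(N + L) / 2 * (norm (v - z))\<^sup>2 = N / 2 * (norm (v - z))\<^sup>2 + L / 2 * (norm (v - z))\<^sup>2"
    by (simp_all add: add_divide_distrib distrib_right)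
  then show ?thesis using 1 2 3 unfolding inner_diff_left by linarith
qed

lemma quad_subgradient_separable_sum:
  fixes H :: "'a::euclidean_space \<times> 'b::euclidean_space \<Rightarrow> real"
    and f :: "'a \<Rightarrow> ereal" and g :: "'b \<Rightarrow> ereal" and \<Phi> :: "'a \<times> 'b \<Rightarrow> ereal"
  assumes H: "\<And>u v. H (y, z) + p \<bullet> (u - y) + q \<bullet> (v - z) - A * (norm (u - y))\<^sup>2 - B * (norm (v - z))\<^sup>2 \<le> H (u, v)"
    and f: "quad_subgradient f K1 y r \<xi>" and g: "quad_subgradient g K2 z s \<zeta>"
    and K: "K1 + A \<le> K" "K2 + B \<le> K"
    and \<Phi>: "\<And>u v. \<Phi> (u, v) = f u + ereal (H (u, v)) + g v"
  shows "quad_subgradient \<Phi> K (y, z) (r + H (y, z) + s) (\<xi> + p, \<zeta> + q)"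
  unfolding quad_subgradient_def
proof (intro conjI allI)
  show "\<Phi> (y, z) = ereal (r + H (y, z) + s)"
    using f g by (simp add: quad_subgradient_def \<Phi>)
  fix w :: "'a \<times> 'b"
  obtain u v where w: "w = (u, v)" by (cases w)
  have F: "ereal (r + \<xi> \<bullet> (u - y) - K1 * (norm (u - y))\<^sup>2) \<le> f u"
    and G: "ereal (s + \<zeta> \<bullet> (v - z) - K2 * (norm (v - z))\<^sup>2) \<le> g v"
    using f g by (auto simp: quad_subgradient_def)
  have "r + H (y, z) + s + (\<xi> + p, \<zeta> + q) \<bullet> (w - (y, z)) - K * (norm (w - (y, z)))\<^sup>2
     \<le> (r + \<xi> \<bullet> (u - y) - K1 * (norm (u - y))\<^sup>2) + H (u, v) + (s + \<zeta> \<bullet> (v - z) - K2 * (norm (v - z))\<^sup>2)"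
  proof -
    have n: "(norm (w - (y, z)))\<^sup>2 = (norm (u - y))\<^sup>2 + (norm (v - z))\<^sup>2"
      by (simp add: w norm_Pair)
    have i: "(\<xi> + p, \<zeta> + q) \<bullet> (w - (y, z)) = \<xi> \<bullet> (u - y) + p \<bullet> (u - y) + (\<zeta> \<bullet> (v - z) + q \<bullet> (v - z))"
      by (simp add: w inner_add_left)
    have "(K1 + A) * (norm (u - y))\<^sup>2 \<le> K * (norm (u - y))\<^sup>2" "(K2 + B) * (norm (v - z))\<^sup>2 \<le> K * (norm (v - z))\<^sup>2"
      using K by (auto intro: mult_right_mono)
    then show ?thesis using H[of u v] unfolding n i distrib_left distrib_right by linarith
  qed
  then have "ereal (r + H (y, z) + s + (\<xi> + p, \<zeta> + q) \<bullet> (w - (y, z)) - K * (norm (w - (y, z)))\<^sup>2)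
    \<le> ereal (r + \<xi> \<bullet> (u - y) - K1 * (norm (u - y))\<^sup>2) + ereal (H (u, v)) + ereal (s + \<zeta> \<bullet> (v - z) - K2 * (norm (v - z))\<^sup>2)"
    by simp
  also have "\<dots> \<le> f u + ereal (H (u, v)) + g v" by (intro add_mono F G order_refl)
  finally show "ereal (r + H (y, z) + s + (\<xi> + p, \<zeta> + q) \<bullet> (w - (y, z)) - K * (norm (w - (y, z)))\<^sup>2) \<le> \<Phi> w"
    by (simp add: w \<Phi>)
qed

text \<open>
  The subgradient inequality of the prox step against the old point \<open>y\<close>, added to the descent inequality
  \<open>h\<close> of the smooth part; the terms with the gradient \<open>G\<close> cancel.
\<close>
lemma prox_block_decrease:
  fixes f :: "'a::euclidean_space \<Rightarrow> ereal"
  assumes f: "quad_subgradient f (1 / (2 * \<gamma>)) y' r' ((1 / \<gamma>) *\<^sub>R ((y - \<gamma> *\<^sub>R G + \<alpha>) - y'))"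
    and fy: "f y = ereal r" and \<gamma>: "0 < \<gamma>" and h: "h' \<le> h + G \<bullet> (y' - y) + M / 2 * (norm (y' - y))\<^sup>2"
  shows "r' + h' \<le> r + h - (1 / \<gamma> - M) / 2 * (norm (y' - y))\<^sup>2 + (1 / \<gamma>) * (norm \<alpha> * norm (y' - y))"
proof -
  have "ereal (r' + ((1 / \<gamma>) *\<^sub>R ((y - \<gamma> *\<^sub>R G + \<alpha>) - y')) \<bullet> (y - y') - 1 / (2 * \<gamma>) * (norm (y - y'))\<^sup>2) \<le> f y"
    using f unfolding quad_subgradient_def by blast
  then have 1: "r' + ((1 / \<gamma>) *\<^sub>R ((y - \<gamma> *\<^sub>R G + \<alpha>) - y')) \<bullet> (y - y') - 1 / (2 * \<gamma>) * (norm (y - y'))\<^sup>2 \<le> r"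
    by (simp add: fy)
  have "((y - \<gamma> *\<^sub>R G + \<alpha>) - y') \<bullet> (y - y') = (norm (y' - y))\<^sup>2 + \<gamma> * (G \<bullet> (y' - y)) - \<alpha> \<bullet> (y' - y)"
    by (simp add: power2_norm_eq_inner inner_diff_left inner_diff_right inner_add_left inner_commute algebra_simps)
  then have 2: "((1 / \<gamma>) *\<^sub>R ((y - \<gamma> *\<^sub>R G + \<alpha>) - y')) \<bullet> (y - y')
     = (1 / \<gamma>) * (norm (y' - y))\<^sup>2 + G \<bullet> (y' - y) - (1 / \<gamma>) * (\<alpha> \<bullet> (y' - y))"
    using \<gamma> by (simp only: inner_scaleR_left) (simp add: distrib_left right_diff_distrib)
  have 3: "(1 / \<gamma>) * (\<alpha> \<bullet> (y' - y)) \<le> (1 / \<gamma>) * (norm \<alpha> * norm (y' - y))"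
    using \<gamma> by (intro mult_left_mono norm_cauchy_schwarz) auto
  define a b e m where "a = (1 / \<gamma>) * (norm (y' - y))\<^sup>2" and "b = (1 / \<gamma>) * (\<alpha> \<bullet> (y' - y))"
    and "e = (1 / \<gamma>) * (norm \<alpha> * norm (y' - y))" and "m = M / 2 * (norm (y' - y))\<^sup>2"
  have 4: "1 / (2 * \<gamma>) * (norm (y - y'))\<^sup>2 = a / 2"
    by (simp add: a_def norm_minus_commute)
  have 5: "(1 / \<gamma> - M) / 2 * (norm (y' - y))\<^sup>2 = a / 2 - m"
    by (simp add: a_def m_def diff_divide_distrib left_diff_distrib)
  have "r' + (a + G \<bullet> (y' - y) - b) - a / 2 \<le> r" using 1 unfolding 2 4 a_def b_def .
  moreover have "b \<le> e" using 3 unfolding b_def e_def .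
  moreover have "h' \<le> h + G \<bullet> (y' - y) + m" using h unfolding m_def .
  ultimately show ?thesis unfolding 5 e_def[symmetric] by linarith
qed

text \<open>
  The vector \<open>U\<close> replaces the gradients used in the step by those at the new point; this is where the
  step length enters its bound. In the decrease, the product of noise and step length is split by
  completing the square, which leaves \<open>\<mu> / 4\<close> of the coefficient \<open>\<mu> / 2\<close>.
\<close>
lemma inexact_step:
  fixes f :: "'a::euclidean_space \<Rightarrow> ereal" and g :: "'b::euclidean_space \<Rightarrow> ereal"
    and H :: "'a \<times> 'b \<Rightarrow> real" and \<Phi> :: "'a \<times> 'b \<Rightarrow> ereal"
  assumes f: "proper_fun f" and g: "proper_fun g" and H: "\<And>w. H differentiable (at w)"
    and pos: "0 < L" "0 < \<gamma>" "0 < lam"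
    and lipy: "\<And>y1 y2 v. norm (grad_fst H (y1, v) - grad_fst H (y2, v)) \<le> M * norm (y1 - y2)"
    and lipz: "\<And>u z1 z2. norm (grad_snd H (u, z1) - grad_snd H (u, z2)) \<le> N * norm (z1 - z2)"
    and lip: "\<And>x1 x2. norm (grad_fst H x1 - grad_fst H x2) \<le> L * norm (x1 - x2)"
    and \<Phi>: "\<And>u v. \<Phi> (u, v) = f u + ereal (H (u, v)) + g v"
    and N: "0 < N"
    and \<mu>: "0 < \<mu>" "\<mu> \<le> 1 / \<gamma> - M" "\<mu> \<le> 1 / lam - N"
    and K: "1 / (2 * \<gamma>) + (M + L) / 2 \<le> K" "1 / (2 * lam) + (N + L) / 2 \<le> K"
    and y': "y' \<in> prox (\<lambda>u. ereal \<gamma> * f u) (y - \<gamma> *\<^sub>R grad_fst H (y, z) + \<alpha>)"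
    and z': "z' \<in> prox (\<lambda>v. ereal lam * g v) (z - lam *\<^sub>R grad_snd H (y', z) + \<beta>)"
  shows "\<exists>R U. quad_subgradient \<Phi> K (y', z') R U \<and>
    norm U \<le> (1 / \<gamma> + 1 / lam + L + N) * (norm ((y', z') - (y, z)) + (norm \<alpha> + norm \<beta>)) \<and>
    (\<forall>r0. \<Phi> (y, z) = ereal r0 \<longrightarrow>
       R \<le> r0 - \<mu> / 4 * (norm ((y', z') - (y, z)))\<^sup>2 + (1 / \<gamma> + 1 / lam)\<^sup>2 / \<mu> * (norm \<alpha> + norm \<beta>)\<^sup>2)"
proof -
  define \<xi> where "\<xi> = (1 / \<gamma>) *\<^sub>R ((y - \<gamma> *\<^sub>R grad_fst H (y, z) + \<alpha>) - y')"
  define \<zeta> where "\<zeta> = (1 / lam) *\<^sub>R ((z - lam *\<^sub>R grad_snd H (y', z) + \<beta>) - z')"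
  define d where "d = norm ((y', z') - (y, z))"
  define \<epsilon> where "\<epsilon> = norm \<alpha> + norm \<beta>"
  define U where "U = (\<xi> + grad_fst H (y', z'), \<zeta> + grad_snd H (y', z'))"
  obtain r where r: "quad_subgradient f (1 / (2 * \<gamma>)) y' r \<xi>"
    using prox_quad_subgradient[OF f pos(2) y'] unfolding \<xi>_def by blast
  obtain s where s: "quad_subgradient g (1 / (2 * lam)) z' s \<zeta>"
    using prox_quad_subgradient[OF g pos(3) z'] unfolding \<zeta>_def by blast
  have dd: "d\<^sup>2 = (norm (y' - y))\<^sup>2 + (norm (z' - z))\<^sup>2" by (simp add: d_def norm_Pair)
  have dy: "norm (y' - y) \<le> d" and dz: "norm (z' - z) \<le> d"
    using norm_fst_le[of "y' - y" "z' - z"] norm_snd_le[of "z' - z" "y' - y"] by (simp_all add: d_def)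
  have quad: "quad_subgradient \<Phi> K (y', z') (r + H (y', z') + s) U"
    unfolding U_def
    by (rule quad_subgradient_separable_sum[OF partial_gradients_lower_bound[OF H lipy lipz lip] r s K \<Phi>])
       (use pos in auto)
  have "norm U \<le> norm (\<xi> + grad_fst H (y', z')) + norm (\<zeta> + grad_snd H (y', z'))"
    unfolding U_def by (rule norm_Pair_le)
  moreover have "norm (\<xi> + grad_fst H (y', z')) \<le> (1 / \<gamma>) * d + (1 / \<gamma>) * norm \<alpha> + L * d"
  proof -
    have "\<xi> + grad_fst H (y', z') = (1 / \<gamma>) *\<^sub>R (y - y') + (1 / \<gamma>) *\<^sub>R \<alpha> + (grad_fst H (y', z') - grad_fst H (y, z))"
      using pos by (simp add: \<xi>_def algebra_simps)
    then have "norm (\<xi> + grad_fst H (y', z'))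
        \<le> norm ((1 / \<gamma>) *\<^sub>R (y - y')) + norm ((1 / \<gamma>) *\<^sub>R \<alpha>) + norm (grad_fst H (y', z') - grad_fst H (y, z))"
      by (metis norm_triangle_mono norm_triangle_ineq order_refl)
    moreover have "norm ((1 / \<gamma>) *\<^sub>R (y - y')) \<le> (1 / \<gamma>) * d"
      using dy pos by (simp add: norm_minus_commute divide_right_mono)
    moreover have "norm ((1 / \<gamma>) *\<^sub>R \<alpha>) = (1 / \<gamma>) * norm \<alpha>" using pos by simp
    moreover have "norm (grad_fst H (y', z') - grad_fst H (y, z)) \<le> L * d" unfolding d_def by (rule lip)
    ultimately show ?thesis by linarith
  qed
  moreover have "norm (\<zeta> + grad_snd H (y', z')) \<le> (1 / lam) * d + (1 / lam) * norm \<beta> + N * d"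
  proof -
    have "\<zeta> + grad_snd H (y', z') = (1 / lam) *\<^sub>R (z - z') + (1 / lam) *\<^sub>R \<beta> + (grad_snd H (y', z') - grad_snd H (y', z))"
      using pos by (simp add: \<zeta>_def algebra_simps)
    then have "norm (\<zeta> + grad_snd H (y', z'))
        \<le> norm ((1 / lam) *\<^sub>R (z - z')) + norm ((1 / lam) *\<^sub>R \<beta>) + norm (grad_snd H (y', z') - grad_snd H (y', z))"
      by (metis norm_triangle_mono norm_triangle_ineq order_refl)
    moreover have "norm ((1 / lam) *\<^sub>R (z - z')) \<le> (1 / lam) * d"
      using dz pos by (simp add: norm_minus_commute divide_right_mono)
    moreover have "norm ((1 / lam) *\<^sub>R \<beta>) = (1 / lam) * norm \<beta>" using pos by simp
    moreover have "norm (grad_snd H (y', z') - grad_snd H (y', z)) \<le> N * d"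
      using lipz[of y' z' z] mult_left_mono[OF dz, of N] N by linarith
    ultimately show ?thesis by linarith
  qed
  moreover have "(1 / \<gamma>) * d + (1 / \<gamma>) * norm \<alpha> + L * d + ((1 / lam) * d + (1 / lam) * norm \<beta> + N * d)
      \<le> (1 / \<gamma> + 1 / lam + L + N) * (d + \<epsilon>)"
  proof -
    have nn: "0 \<le> (1 / \<gamma>) * norm \<beta>" "0 \<le> (1 / lam) * norm \<alpha>" "0 \<le> L * \<epsilon>" "0 \<le> N * \<epsilon>"
      using pos N by (simp_all add: \<epsilon>_def)
    have "(1 / \<gamma> + 1 / lam + L + N) * (d + \<epsilon>)
      = (1 / \<gamma>) * d + (1 / lam) * d + L * d + N * d + ((1 / \<gamma>) * norm \<alpha> + (1 / \<gamma>) * norm \<beta>)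
        + ((1 / lam) * norm \<alpha> + (1 / lam) * norm \<beta>) + L * \<epsilon> + N * \<epsilon>"
      unfolding \<epsilon>_def by (simp only: distrib_left distrib_right add_ac)
    then show ?thesis using nn by linarith
  qed
  ultimately have Ub: "norm U \<le> (1 / \<gamma> + 1 / lam + L + N) * (d + \<epsilon>)" by linarith
  have dec: "r + H (y', z') + s \<le> r0 - \<mu> / 4 * d\<^sup>2 + (1 / \<gamma> + 1 / lam)\<^sup>2 / \<mu> * \<epsilon>\<^sup>2"
    if r0: "\<Phi> (y, z) = ereal r0" for r0
  proof -
    have ninf: "f y \<noteq> -\<infinity>" "g z \<noteq> -\<infinity>" using f g by (auto simp: proper_fun_def)
    then obtain ry sz where fin: "f y = ereal ry" "g z = ereal sz"
      using r0 unfolding \<Phi> by (cases "f y"; cases "g z") auto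
    then have r0': "r0 = ry + H (y, z) + sz" using r0 by (simp add: \<Phi>)
    have 1: "r + H (y', z) \<le> ry + H (y, z) - (1 / \<gamma> - M) / 2 * (norm (y' - y))\<^sup>2 + (1 / \<gamma>) * (norm \<alpha> * norm (y' - y))"
      by (rule prox_block_decrease[OF r[unfolded \<xi>_def] fin(1) pos(2)])
        (rule descent_inequality[of "\<lambda>y. H (y, z)" "\<lambda>y. grad_fst H (y, z)"], rule GDERIV_grad_fst[OF H], rule lipy)
    have 2: "s + H (y', z') \<le> sz + H (y', z) - (1 / lam - N) / 2 * (norm (z' - z))\<^sup>2 + (1 / lam) * (norm \<beta> * norm (z' - z))"
      by (rule prox_block_decrease[OF s[unfolded \<zeta>_def] fin(2) pos(3)])
        (rule descent_inequality[of "\<lambda>z. H (y', z)" "\<lambda>z. grad_snd H (y', z)"], rule GDERIV_grad_snd[OF H], rule lipz)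
    have 3: "\<mu> / 2 * d\<^sup>2 \<le> (1 / \<gamma> - M) / 2 * (norm (y' - y))\<^sup>2 + (1 / lam - N) / 2 * (norm (z' - z))\<^sup>2"
      unfolding dd distrib_left using \<mu> by (intro add_mono mult_right_mono) auto
    have 4: "(1 / \<gamma>) * (norm \<alpha> * norm (y' - y)) + (1 / lam) * (norm \<beta> * norm (z' - z)) \<le> ((1 / \<gamma> + 1 / lam) * \<epsilon>) * d"
    proof -
      have "norm \<alpha> * norm (y' - y) \<le> \<epsilon> * d" "norm \<beta> * norm (z' - z) \<le> \<epsilon> * d"
        using dy dz by (auto simp: \<epsilon>_def intro!: mult_mono)
      then have "(1 / \<gamma>) * (norm \<alpha> * norm (y' - y)) \<le> (1 / \<gamma>) * (\<epsilon> * d)"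
        "(1 / lam) * (norm \<beta> * norm (z' - z)) \<le> (1 / lam) * (\<epsilon> * d)"
        using pos by (auto intro!: mult_left_mono divide_right_mono)
      then show ?thesis by (simp only: distrib_right mult.assoc)
    qed
    have 5: "a * d \<le> \<mu> / 4 * d\<^sup>2 + a\<^sup>2 / \<mu>" for a
    proof -
      have "\<mu> / 4 * d\<^sup>2 + a\<^sup>2 / \<mu> - a * d = (\<mu> * d / 2 - a)\<^sup>2 / \<mu>"
        using \<mu>(1) by (simp add: power2_eq_square field_simps)
      moreover have "\<dots> \<ge> 0" using \<mu>(1) by simp
      ultimately show ?thesis by linarith
    qed
    have "((1 / \<gamma> + 1 / lam) * \<epsilon>) * d \<le> \<mu> / 4 * d\<^sup>2 + (1 / \<gamma> + 1 / lam)\<^sup>2 / \<mu> * \<epsilon>\<^sup>2"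
      using 5[of "(1 / \<gamma> + 1 / lam) * \<epsilon>"] by (simp only: power_mult_distrib times_divide_eq_left)
    moreover have "\<mu> / 2 * d\<^sup>2 = \<mu> / 4 * d\<^sup>2 + \<mu> / 4 * d\<^sup>2" by simp
    ultimately show ?thesis using 1 2 3 4 r0' by linarith
  qed
  show ?thesis using quad Ub dec unfolding d_def \<epsilon>_def by blast
qed

section \<open>Convergence of the inexact alternating scheme\<close>

lemma coercive_sublevel_bounded:
  fixes \<Phi> :: "'a::real_normed_vector \<Rightarrow> ereal"
  assumes "coercive \<Phi>"
  shows "\<exists>\<rho>. \<forall>x. \<Phi> x \<le> ereal b \<longrightarrow> norm x \<le> \<rho>"
proof -
  have "\<forall>\<^sub>F x in at_infinity. ereal b < \<Phi> x"
    using assms unfolding coercive_def tendsto_PInfty by blast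
  then obtain \<rho> where "\<And>x. \<rho> \<le> norm x \<Longrightarrow> ereal b < \<Phi> x" unfolding eventually_at_infinity by blast
  then have "\<forall>x. \<Phi> x \<le> ereal b \<longrightarrow> norm x \<le> \<rho>" by (meson leD linear)
  then show ?thesis ..
qed

theorem proposition2:
  fixes f :: "real ^ 'n \<Rightarrow> ereal" and g :: "real ^ 'm \<Rightarrow> ereal"
    and H :: "(real ^ 'n) \<times> (real ^ 'm) \<Rightarrow> real"
    and \<Phi> :: "(real ^ 'n) \<times> (real ^ 'm) \<Rightarrow> ereal"
    and M N L \<gamma> lam p :: real
    and y \<alpha> :: "nat \<Rightarrow> real ^ 'n" and z \<beta> :: "nat \<Rightarrow> real ^ 'm"
    and x :: "nat \<Rightarrow> (real ^ 'n) \<times> (real ^ 'm)"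
  assumes "proper_fun f" and "lsc_fun f"
    and "proper_fun g" and "lsc_fun g"
    and "\<And>w. H differentiable (at w)"
    and "M > 0" and "N > 0" and "L > 0"
    and "\<And>y1 y2 v. norm (grad_fst H (y1, v) - grad_fst H (y2, v)) \<le> M * norm (y1 - y2)"
    and "\<And>u z1 z2. norm (grad_snd H (u, z1) - grad_snd H (u, z2)) \<le> N * norm (z1 - z2)"
    and "\<And>x1 x2. norm (grad_fst H x1 - grad_fst H x2) \<le> L * norm (x1 - x2)"
    and "\<And>u v. \<Phi> (u, v) = f u + ereal (H (u, v)) + g v"
    and "coercive \<Phi>"
    and "semialgebraic_fun f" and "semialgebraic_fun g"
    and "semialgebraic_fun (\<lambda>w. ereal (H w))"
    and "\<gamma> > 0" and "lam > 0"
    and "min (1 / \<gamma> - M) (1 / lam - N) > 0"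
    and "\<And>k. x k = (y k, z k)"
    and "\<And>k. y (Suc k) \<in> prox (\<lambda>u. ereal \<gamma> * f u)
                             (y k - \<gamma> *\<^sub>R grad_fst H (y k, z k) + \<alpha> k)"
    and "\<And>k. z (Suc k) \<in> prox (\<lambda>v. ereal lam * g v)
                             (z k - lam *\<^sub>R grad_snd H (y (Suc k), z k) + \<beta> k)"
    and "p > 1"
    and "(\<lambda>k. norm (\<alpha> k) + norm (\<beta> k)) \<in> O(\<lambda>k. 1 / real k powr p)"
  shows "summable (\<lambda>k. norm (x (Suc k) - x k)) \<and>
         (\<exists>xs. x \<longlonglongrightarrow> xs \<and> critical_point \<Phi> xs)"
proof -
  note f = assms(1) and f_lsc = assms(2) and g = assms(3) and g_lsc = assms(4) and H = assms(5)
    and M = assms(6) and N = assms(7) and L = assms(8) and lipy = assms(9) and lipz = assms(10)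
    and lip = assms(11) and \<Phi> = assms(12) and coer = assms(13)
    and f_sa = assms(14) and g_sa = assms(15) and H_sa = assms(16) and \<gamma> = assms(17) and lam = assms(18)
    and step = assms(19) and x = assms(20) and y = assms(21) and z = assms(22) and p = assms(23) and noise = assms(24)
  define \<mu> where "\<mu> = min (1 / \<gamma> - M) (1 / lam - N)"
  define \<kappa> where "\<kappa> = 1 / \<gamma> + 1 / lam"
  define C where "C = 1 / \<gamma> + 1 / lam + L + N"
  define K where "K = 1 / (2 * \<gamma>) + 1 / (2 * lam) + (M + N + L) / 2"
  define \<epsilon> where "\<epsilon> k = norm (\<alpha> k) + norm (\<beta> k)" for k
  have \<mu>: "0 < \<mu>" "\<mu> \<le> 1 / \<gamma> - M" "\<mu> \<le> 1 / lam - N" using step by (simp_all add: \<mu>_def)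
  have K: "1 / (2 * \<gamma>) + (M + L) / 2 \<le> K" "1 / (2 * lam) + (N + L) / 2 \<le> K"
  proof -
    have "0 < 1 / (2 * \<gamma>)" "0 < 1 / (2 * lam)" using \<gamma> lam by simp_all
    then show "1 / (2 * \<gamma>) + (M + L) / 2 \<le> K" "1 / (2 * lam) + (N + L) / 2 \<le> K"
      using M N unfolding K_def by (auto simp: add_divide_distrib)
  qed
  have K0: "0 \<le> K" and C0: "0 \<le> C" using \<gamma> lam M N L by (simp_all add: K_def C_def)
  have "\<exists>R U. quad_subgradient \<Phi> K (x (Suc k)) R U \<and>
      norm U \<le> C * (norm (x (Suc k) - x k) + \<epsilon> k) \<and>
      (\<forall>r0. \<Phi> (x k) = ereal r0 \<longrightarrow>
         R \<le> r0 - \<mu> / 4 * (norm (x (Suc k) - x k))\<^sup>2 + \<kappa>\<^sup>2 / \<mu> * (\<epsilon> k)\<^sup>2)" for k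
    unfolding x \<epsilon>_def C_def \<kappa>_def
    by (rule inexact_step[OF f g H L \<gamma> lam lipy lipz lip \<Phi> N \<mu> K y z])
  then obtain R U where quad: "\<And>k. quad_subgradient \<Phi> K (x (Suc k)) (R k) (U k)"
    and Ub: "\<And>k. norm (U k) \<le> C * (norm (x (Suc k) - x k) + \<epsilon> k)"
    and dec: "\<And>k r0. \<Phi> (x k) = ereal r0 \<Longrightarrow>
         R k \<le> r0 - \<mu> / 4 * (norm (x (Suc k) - x k))\<^sup>2 + \<kappa>\<^sup>2 / \<mu> * (\<epsilon> k)\<^sup>2" by metis
  have dec': "R (Suc k) \<le> R k - \<mu> / 4 * (norm (x (Suc (Suc k)) - x (Suc k)))\<^sup>2 + \<kappa>\<^sup>2 / \<mu> * (\<epsilon> (Suc k))\<^sup>2" for k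
    by (rule dec) (use quad[of k] in \<open>simp add: quad_subgradient_def\<close>)
  obtain A where A: "0 < A" "\<forall>\<^sub>F k in sequentially. norm (norm (\<alpha> k) + norm (\<beta> k)) \<le> A * norm (1 / real k powr p)"
    using landau_o.bigE[OF noise] by blast
  then obtain j where j: "\<And>k. j \<le> k \<Longrightarrow> norm (norm (\<alpha> k) + norm (\<beta> k)) \<le> A * norm (1 / real k powr p)"
    unfolding eventually_sequentially by blast
  define w where "w k = 1 / real k powr p" for k
  have \<epsilon>w: "0 \<le> \<epsilon> k" "\<epsilon> (k + Suc j) \<le> A * w (k + Suc j)" for k
    using j[of "k + Suc j"] by (simp_all add: \<epsilon>_def w_def)
  have w: "w k = real k powr (-p)" for k by (simp add: w_def powr_minus_divide)
  have sum_w: "summable w" using p by (simp add: w[abs_def] summable_real_powr_iff)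
  obtain c where c: "0 < c" "\<And>k. 1 \<le> k \<Longrightarrow> c * (w k)\<^sup>2 \<le> w k - w (Suc k)"
    using powr_tail_decrement[OF p] unfolding w_def by blast
  \<comment> \<open>\<open>T\<close> decreases at each step by at least what the noise can add to the objective.\<close>
  define B where "B = \<kappa>\<^sup>2 / \<mu> * A\<^sup>2 / c"
  define T where "T n = B * w (n + Suc j)" for n
  have B0: "0 \<le> B" using \<mu> c by (simp add: B_def)
  have T_dec: "\<kappa>\<^sup>2 / \<mu> * (\<epsilon> (n + Suc j))\<^sup>2 \<le> T n - T (Suc n)" for n
  proof -
    have "(\<epsilon> (n + Suc j))\<^sup>2 \<le> (A * w (n + Suc j))\<^sup>2" using \<epsilon>w by (intro power_mono) auto
    then have "\<kappa>\<^sup>2 / \<mu> * (\<epsilon> (n + Suc j))\<^sup>2 \<le> \<kappa>\<^sup>2 / \<mu> * (A * w (n + Suc j))\<^sup>2"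
      using \<mu> by (intro mult_left_mono) auto
    also have "\<dots> = B * (c * (w (n + Suc j))\<^sup>2)" using c by (simp add: B_def power_mult_distrib)
    also have "\<dots> \<le> B * (w (n + Suc j) - w (Suc (n + Suc j)))" using c(2)[of "n + Suc j"] B0 by (intro mult_left_mono) auto
    also have "\<dots> = T n - T (Suc n)" by (simp add: T_def right_diff_distrib)
    finally show ?thesis .
  qed
  \<comment> \<open>Only from index \<open>1\<close> on are the iterates results of prox steps, so that \<open>\<Phi>\<close> is finite there; hence
     \<open>Suc j\<close>.\<close>
  define X where "X n = x (n + Suc j)" for n
  define \<phi> where "\<phi> n = R (n + j)" for n
  have X_quad: "quad_subgradient \<Phi> K (X n) (\<phi> n) (U (n + j))" for n
    using quad[of "n + j"] by (simp add: X_def \<phi>_def)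
  have X_dec: "\<phi> (Suc n) + T (Suc n) \<le> \<phi> n + T n - \<mu> / 4 * (norm (X (Suc n) - X n))\<^sup>2" for n
    using dec'[of "n + j"] T_dec[of n] by (simp add: X_def \<phi>_def)
  have T0: "0 \<le> T n" for n using B0 by (simp add: T_def w_def)
  have "\<phi> n \<le> \<phi> 0 + T 0" for n
  proof -
    have "\<phi> n + T n \<le> \<phi> 0 + T 0"
    proof (induction n)
      case (Suc n)
      have "0 \<le> \<mu> / 4 * (norm (X (Suc n) - X n))\<^sup>2" using \<mu>(1) by simp
      then show ?case using X_dec[of n] Suc by linarith
    qed simp
    then show ?thesis using T0[of n] by linarith
  qed
  then have "\<Phi> (X n) \<le> ereal (\<phi> 0 + T 0)" for n
    using X_quad[of n] by (simp add: quad_subgradient_def)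
  then obtain \<rho> where \<rho>: "\<And>n. norm (X n) \<le> \<rho>" using coercive_sublevel_bounded[OF coer] by blast
  have \<Phi>_eq: "\<Phi> q = f (fst q) + ereal (H q) + g (snd q)" for q using \<Phi>[of "fst q" "snd q"] by simp
  have ninf: "\<Phi> q \<noteq> -\<infinity>" for q using f g by (auto simp: \<Phi>_eq proper_fun_def)
  have graph: "definable (\<lambda>q::((real ^ 'n) \<times> (real ^ 'm)) \<times> real. \<Phi> (fst q) = ereal (snd q))"
    unfolding \<Phi>_eq by (rule definable_separable_sum[OF f f_sa g g_sa H_sa])
  have lsc: "\<Phi> q \<le> ereal b" if "Y \<longlonglongrightarrow> q" "\<And>i::nat. \<Phi> (Y i) \<le> ereal b" for Y q b
    using lsc_separable_sum[OF f f_lsc g g_lsc H that(1)] that(2) unfolding \<Phi>_eq by blast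
  have "summable (\<lambda>n. norm (X (Suc n) - X n)) \<and> (\<exists>xs. X \<longlonglongrightarrow> xs \<and> critical_point \<Phi> xs)"
    \<comment> \<open>The threshold exponent is the midpoint of \<open>1 / p\<close> and \<open>1\<close>.\<close>
  proof (rule noisy_descent_converges[where K = K and a = "\<mu> / 4" and C = C and \<rho> = \<rho> and T = T and \<phi> = \<phi>
        and U = "\<lambda>n. U (n + j)" and \<epsilon> = "\<lambda>n. \<epsilon> (n + Suc j)" and \<sigma> = "(1 + 1 / p) / 2"])
    show "\<Phi> q \<le> ereal b" if "Y \<longlonglongrightarrow> q" "\<And>i::nat. \<Phi> (Y i) \<le> ereal b" for Y q b using that by (rule lsc)
    show "quad_subgradient \<Phi> K (X n) (\<phi> n) (U (n + j))" for n by (rule X_quad)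
    show "\<phi> (Suc n) + T (Suc n) \<le> \<phi> n + T n - \<mu> / 4 * (norm (X (Suc n) - X n))\<^sup>2" for n by (rule X_dec)
    show "norm (X n) \<le> \<rho>" for n by (rule \<rho>)
    show "0 \<le> T n" for n by (rule T0)
    show "0 < \<mu> / 4" using \<mu>(1) by simp
    show "norm (U (Suc n + j)) \<le> C * (norm (X (Suc n) - X n) + \<epsilon> (n + Suc j))" for n
      using Ub[of "Suc n + j"] by (simp add: X_def)
    show "0 \<le> \<epsilon> (n + Suc j)" for n by (rule \<epsilon>w)
    have "summable (\<lambda>n. A * w (n + Suc j))" by (intro summable_mult summable_ignore_initial_segment sum_w)
    then show "summable (\<lambda>n. \<epsilon> (n + Suc j))"
    proof (rule summable_comparison_test'[of _ 0])
      show "norm (\<epsilon> (n + Suc j)) \<le> A * w (n + Suc j)" for n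
        using \<epsilon>w(1)[of "n + Suc j"] \<epsilon>w(2)[of n] unfolding real_norm_def by linarith
    qed
    have "summable T" unfolding T_def by (intro summable_mult summable_ignore_initial_segment sum_w)
    then show "T \<longlonglongrightarrow> 0" by (rule summable_LIMSEQ_zero)
    show "(1 + 1 / p) / 2 < 1" using p by simp
    fix \<theta> assume \<theta>: "(1 + 1 / p) / 2 \<le> \<theta>"
    have "p * ((1 + 1 / p) / 2) \<le> p * \<theta>" using \<theta> p by (intro mult_left_mono) auto
    moreover have "p * ((1 + 1 / p) / 2) = (p + 1) / 2" using p by (simp add: field_simps)
    moreover have "1 < (p + 1) / 2" using p by simp
    ultimately have "1 < p * \<theta>" by (metis less_le_trans)
    then have "summable (\<lambda>k. real k powr (- p * \<theta>))" by (simp add: summable_real_powr_iff)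
    then have "summable (\<lambda>n. B powr \<theta> * real (n + Suc j) powr (- p * \<theta>))"
      by (intro summable_mult summable_ignore_initial_segment[where f = "\<lambda>k. real k powr (- p * \<theta>)"])
    moreover have "T n powr \<theta> = B powr \<theta> * real (n + Suc j) powr (- p * \<theta>)" for n
      using B0 by (simp add: T_def w powr_mult powr_powr)
    ultimately show "summable (\<lambda>n. T n powr \<theta>)" by simp
  qed (fact graph, rule ninf, fact K0, fact C0)
  then obtain xs where sum: "summable (\<lambda>n. norm (X (Suc n) - X n))" and xs: "X \<longlonglongrightarrow> xs" "critical_point \<Phi> xs"
    by blast
  have "summable (\<lambda>k. norm (x (Suc k) - x k))"
    using sum summable_iff_shift[of "\<lambda>k. norm (x (Suc k) - x k)" "Suc j"] by (simp add: X_def)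
  moreover have "x \<longlonglongrightarrow> xs" using xs(1) LIMSEQ_offset[of x "Suc j" xs] by (simp add: X_def[abs_def])
  ultimately show ?thesis using xs(2) by blast
qed

end
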